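(* Let $\Bbbk$ be a field of characteristic $p>0$, let $G\simeq C_p\times\cdots\times C_p$ be an elementary abelian $p$-group, and let $\ell:\Bbbk C_p\to\Bbbk G$ be a cyclic shifted subgroup, i.e. a ring homomorphism such that $\Bbbk G$ is flat (i.e. free) as a $\Bbbk C_p$-module via $\ell$. Let $\mathscr C(G)=\Bbbk G\text{-}\mathrm{Stab}$ and $\mathscr C(C_p)=\Bbbk C_p\text{-}\mathrm{Stab}$ be the stable categories and let $\mathbf A_\ell=\mathrm{CoInd}_\ell\circ\mathrm{Res}_\ell$ be the monad on $\mathscr C(G)$ induced by the adjunction $\mathrm{Res}_\ell:\mathscr C(G)\leftrightarrows\mathscr C(C_p):\mathrm{CoInd}_\ell$. Then the Eilenberg-Moore functor $E:\mathscr C(C_p)\to\mathbf A_\ell\text{-}\mathrm{Mod}_{\mathscr C(G)}$ is an equivalence such that $\ell^*=\mathrm{Res}_\ell$ coincides with the extension-of-scalars functor $F_{\mathbf A_\ell}:\mathscr C(G)\to\mathbf A_\ell\text{-}\mathrm{Mod}_{\mathscr C(G)}$ (that is, $E\circ\mathrm{Res}_\ell=F_{\mathbf A_\ell}$).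
   Context: $C_p$ is the cyclic group of order $p$. The stable category of a finite group algebra is the category of all modules modulo maps factoring through projective modules. $\mathrm{Res}_\ell$ is restriction along $\ell$ and $\mathrm{CoInd}_\ell=\mathrm{Hom}_{\Bbbk C_p}(\Bbbk G,-)$ is its right adjoint; both are exact and preserve projectives, so they induce an adjunction on stable categories. An adjunction $L:\mathscr C\leftrightarrows\mathscr D:R$ with unit $\eta$ and counit $\epsilon$ induces a monad $\mathbf A=RL$ on $\mathscr C$ with unit $\eta$ and multiplication $\mu=R\epsilon L$. An $\mathbf A$-module in $\mathscr C$ is a pair $(X,\varrho:\mathbf A(X)\to X)$ with $\varrho\circ\mathbf A(\varrho)=\varrho\circ\mu_X$ and $\varrho\circ\eta_X=\mathrm{id}_X$; morphisms are morphisms in $\mathscr C$ commuting with the actions. $F_{\mathbf A}(Y)=(\mathbf A(Y),\mu_Y)$ and $E(Z)=(R(Z),R(\epsilon_Z))$, $E(f)=R(f)$. *)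

theory Defs
  imports "HOL-Algebra.Module" "HOL-Algebra.Multiplicative_Group" "HOL-Algebra.Product_Groups"
begin

section \<open>Categories, functors, natural transformations\<close>

text \<open>
  Hom-sets are indexed by pairs of objects and need not be disjoint, so composition and the
  action of functors on morphisms carry the objects as arguments:
  for \<open>f\<close> in \<open>Hom C X Y\<close> and \<open>g\<close> in \<open>Hom C Y Z\<close> the composite is \<open>Cmp C X Y Z g f\<close>.
\<close>

record ('o, 'm) cat =
  Ob :: "'o set"
  Hom :: "'o \<Rightarrow> 'o \<Rightarrow> 'm set"
  Idn :: "'o \<Rightarrow> 'm"
  Cmp :: "'o \<Rightarrow> 'o \<Rightarrow> 'o \<Rightarrow> 'm \<Rightarrow> 'm \<Rightarrow> 'm"

locale category =
  fixes C :: "('o, 'm) cat"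
  assumes Idn_in_Hom: "X \<in> Ob C \<Longrightarrow> Idn C X \<in> Hom C X X"
    and Cmp_in_Hom: "\<lbrakk>X \<in> Ob C; Y \<in> Ob C; Z \<in> Ob C; f \<in> Hom C X Y; g \<in> Hom C Y Z\<rbrakk>
      \<Longrightarrow> Cmp C X Y Z g f \<in> Hom C X Z"
    and Cmp_Idn_left: "\<lbrakk>X \<in> Ob C; Y \<in> Ob C; f \<in> Hom C X Y\<rbrakk> \<Longrightarrow> Cmp C X Y Y (Idn C Y) f = f"
    and Cmp_Idn_right: "\<lbrakk>X \<in> Ob C; Y \<in> Ob C; f \<in> Hom C X Y\<rbrakk> \<Longrightarrow> Cmp C X X Y f (Idn C X) = f"
    and Cmp_assoc: "\<lbrakk>W \<in> Ob C; X \<in> Ob C; Y \<in> Ob C; Z \<in> Ob C;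
        f \<in> Hom C W X; g \<in> Hom C X Y; h \<in> Hom C Y Z\<rbrakk>
      \<Longrightarrow> Cmp C W X Z (Cmp C X Y Z h g) f = Cmp C W Y Z h (Cmp C W X Y g f)"

record ('o, 'm, 'o2, 'm2) cfun =
  FOb :: "'o \<Rightarrow> 'o2"
  FMap :: "'o \<Rightarrow> 'o \<Rightarrow> 'm \<Rightarrow> 'm2"

locale cat_functor = dom: category C + cod: category D
  for C :: "('o, 'm) cat" and D :: "('o2, 'm2) cat" +
  fixes F :: "('o, 'm, 'o2, 'm2) cfun"
  assumes FOb_in_Ob: "X \<in> Ob C \<Longrightarrow> FOb F X \<in> Ob D"
    and FMap_in_Hom: "\<lbrakk>X \<in> Ob C; Y \<in> Ob C; f \<in> Hom C X Y\<rbrakk>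
      \<Longrightarrow> FMap F X Y f \<in> Hom D (FOb F X) (FOb F Y)"
    and FMap_Idn: "X \<in> Ob C \<Longrightarrow> FMap F X X (Idn C X) = Idn D (FOb F X)"
    and FMap_Cmp: "\<lbrakk>X \<in> Ob C; Y \<in> Ob C; Z \<in> Ob C; f \<in> Hom C X Y; g \<in> Hom C Y Z\<rbrakk>
      \<Longrightarrow> FMap F X Z (Cmp C X Y Z g f)
        = Cmp D (FOb F X) (FOb F Y) (FOb F Z) (FMap F Y Z g) (FMap F X Y f)"

definition id_cfun :: "('o, 'm, 'o, 'm) cfun"
  where "id_cfun = \<lparr>FOb = (\<lambda>X. X), FMap = (\<lambda>X Y f. f)\<rparr>"

definition comp_cfun ::
  "('o2, 'm2, 'o3, 'm3) cfun \<Rightarrow> ('o, 'm, 'o2, 'm2) cfun \<Rightarrow> ('o, 'm, 'o3, 'm3) cfun"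
  where "comp_cfun G F =
    \<lparr>FOb = (\<lambda>X. FOb G (FOb F X)),
     FMap = (\<lambda>X Y f. FMap G (FOb F X) (FOb F Y) (FMap F X Y f))\<rparr>"

definition cfun_eq ::
  "('o, 'm) cat \<Rightarrow> ('o, 'm, 'o2, 'm2) cfun \<Rightarrow> ('o, 'm, 'o2, 'm2) cfun \<Rightarrow> bool"
  where "cfun_eq C F G \<longleftrightarrow>
    (\<forall>X \<in> Ob C. FOb F X = FOb G X) \<and>
    (\<forall>X \<in> Ob C. \<forall>Y \<in> Ob C. \<forall>f \<in> Hom C X Y. FMap F X Y f = FMap G X Y f)"

definition natural_transformation ::
  "('o, 'm) cat \<Rightarrow> ('o2, 'm2) cat \<Rightarrow> ('o, 'm, 'o2, 'm2) cfun \<Rightarrow> ('o, 'm, 'o2, 'm2) cfun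
    \<Rightarrow> ('o \<Rightarrow> 'm2) \<Rightarrow> bool"
  where "natural_transformation C D F G \<tau> \<longleftrightarrow>
    cat_functor C D F \<and> cat_functor C D G \<and>
    (\<forall>X \<in> Ob C. \<tau> X \<in> Hom D (FOb F X) (FOb G X)) \<and>
    (\<forall>X \<in> Ob C. \<forall>Y \<in> Ob C. \<forall>f \<in> Hom C X Y.
      Cmp D (FOb F X) (FOb F Y) (FOb G Y) (\<tau> Y) (FMap F X Y f)
        = Cmp D (FOb F X) (FOb G X) (FOb G Y) (FMap G X Y f) (\<tau> X))"

definition is_isomorphism :: "('o, 'm) cat \<Rightarrow> 'o \<Rightarrow> 'o \<Rightarrow> 'm \<Rightarrow> bool"
  where "is_isomorphism C X Y f \<longleftrightarrow> f \<in> Hom C X Y \<and>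
    (\<exists>g \<in> Hom C Y X. Cmp C X Y X g f = Idn C X \<and> Cmp C Y X Y f g = Idn C Y)"

definition naturally_isomorphic ::
  "('o, 'm) cat \<Rightarrow> ('o2, 'm2) cat \<Rightarrow> ('o, 'm, 'o2, 'm2) cfun \<Rightarrow> ('o, 'm, 'o2, 'm2) cfun \<Rightarrow> bool"
  where "naturally_isomorphic C D F G \<longleftrightarrow>
    (\<exists>\<tau>. natural_transformation C D F G \<tau> \<and>
      (\<forall>X \<in> Ob C. is_isomorphism D (FOb F X) (FOb G X) (\<tau> X)))"

definition equivalence_of_categories ::
  "('o, 'm) cat \<Rightarrow> ('o2, 'm2) cat \<Rightarrow> ('o, 'm, 'o2, 'm2) cfun \<Rightarrow> bool"
  where "equivalence_of_categories C D F \<longleftrightarrow> cat_functor C D F \<and>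
    (\<exists>G. cat_functor D C G \<and>
      naturally_isomorphic C C id_cfun (comp_cfun G F) \<and>
      naturally_isomorphic D D (comp_cfun F G) id_cfun)"

section \<open>Adjunctions, monads and Eilenberg--Moore categories\<close>

record ('o, 'm, 'o2, 'm2) adj =
  Lft :: "('o, 'm, 'o2, 'm2) cfun"
  Rgt :: "('o2, 'm2, 'o, 'm) cfun"
  unt :: "'o \<Rightarrow> 'm"
  cnt :: "'o2 \<Rightarrow> 'm2"

definition adjunction ::
  "('o, 'm) cat \<Rightarrow> ('o2, 'm2) cat \<Rightarrow> ('o, 'm, 'o2, 'm2) adj \<Rightarrow> bool"
  where "adjunction C D \<Phi> \<longleftrightarrow>
    (let L = Lft \<Phi>; R = Rgt \<Phi>; \<eta> = unt \<Phi>; \<epsilon> = cnt \<Phi> in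
      cat_functor C D L \<and> cat_functor D C R \<and>
      natural_transformation C C id_cfun (comp_cfun R L) \<eta> \<and>
      natural_transformation D D (comp_cfun L R) id_cfun \<epsilon> \<and>
      (\<forall>X \<in> Ob C. Cmp D (FOb L X) (FOb L (FOb R (FOb L X))) (FOb L X)
          (\<epsilon> (FOb L X)) (FMap L X (FOb R (FOb L X)) (\<eta> X)) = Idn D (FOb L X)) \<and>
      (\<forall>Z \<in> Ob D. Cmp C (FOb R Z) (FOb R (FOb L (FOb R Z))) (FOb R Z)
          (FMap R (FOb L (FOb R Z)) Z (\<epsilon> Z)) (\<eta> (FOb R Z)) = Idn C (FOb R Z)))"

record ('o, 'm) monad =
  Endo :: "('o, 'm, 'o, 'm) cfun"
  munit :: "'o \<Rightarrow> 'm"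
  mmult :: "'o \<Rightarrow> 'm"

definition induced_monad :: "('o, 'm, 'o2, 'm2) adj \<Rightarrow> ('o, 'm) monad"
  where "induced_monad \<Phi> =
    (let L = Lft \<Phi>; R = Rgt \<Phi> in
      \<lparr>Endo = comp_cfun R L,
       munit = unt \<Phi>,
       mmult = (\<lambda>X. FMap R (FOb L (FOb R (FOb L X))) (FOb L X) (cnt \<Phi> (FOb L X)))\<rparr>)"

definition monad_modules :: "('o, 'm) cat \<Rightarrow> ('o, 'm) monad \<Rightarrow> ('o \<times> 'm) set"
  where "monad_modules C A =
    (let T = FOb (Endo A) in
      {(X, \<rho>). X \<in> Ob C \<and> \<rho> \<in> Hom C (T X) X \<and>
        Cmp C (T (T X)) (T X) X \<rho> (FMap (Endo A) (T X) X \<rho>)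
          = Cmp C (T (T X)) (T X) X \<rho> (mmult A X) \<and>
        Cmp C X (T X) X \<rho> (munit A X) = Idn C X})"

definition monad_module_homs ::
  "('o, 'm) cat \<Rightarrow> ('o, 'm) monad \<Rightarrow> 'o \<times> 'm \<Rightarrow> 'o \<times> 'm \<Rightarrow> 'm set"
  where "monad_module_homs C A U V =
    (let T = FOb (Endo A); X = fst U; Y = fst V in
      {f \<in> Hom C X Y.
        Cmp C (T X) X Y f (snd U) = Cmp C (T X) (T Y) Y (snd V) (FMap (Endo A) X Y f)})"

definition EM_category :: "('o, 'm) cat \<Rightarrow> ('o, 'm) monad \<Rightarrow> ('o \<times> 'm, 'm) cat"
  where "EM_category C A =
    \<lparr>Ob = monad_modules C A,
     Hom = monad_module_homs C A,
     Idn = (\<lambda>U. Idn C (fst U)),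
     Cmp = (\<lambda>U V W. Cmp C (fst U) (fst V) (fst W))\<rparr>"

definition extension_of_scalars :: "('o, 'm) monad \<Rightarrow> ('o, 'm, 'o \<times> 'm, 'm) cfun"
  where "extension_of_scalars A =
    \<lparr>FOb = (\<lambda>Y. (FOb (Endo A) Y, mmult A Y)), FMap = FMap (Endo A)\<rparr>"

definition EM_functor :: "('o, 'm, 'o2, 'm2) adj \<Rightarrow> ('o2, 'm2, 'o \<times> 'm, 'm) cfun"
  where "EM_functor \<Phi> =
    (let L = Lft \<Phi>; R = Rgt \<Phi> in
      \<lparr>FOb = (\<lambda>Z. (FOb R Z, FMap R (FOb L (FOb R Z)) Z (cnt \<Phi> Z))), FMap = FMap R\<rparr>)"

section \<open>Modules and stable module categories\<close>

definition module_homs ::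
  "('r, 's) ring_scheme \<Rightarrow> ('r, 'a, 't) module_scheme \<Rightarrow> ('r, 'b, 'w) module_scheme
    \<Rightarrow> ('a \<Rightarrow> 'b) set"
  where "module_homs R M N =
    {f \<in> carrier M \<rightarrow>\<^sub>E carrier N.
      (\<forall>x \<in> carrier M. \<forall>y \<in> carrier M. f (x \<oplus>\<^bsub>M\<^esub> y) = f x \<oplus>\<^bsub>N\<^esub> f y) \<and>
      (\<forall>a \<in> carrier R. \<forall>x \<in> carrier M. f (a \<odot>\<^bsub>M\<^esub> x) = a \<odot>\<^bsub>N\<^esub> f x)}"

definition free_module :: "('r, 's) ring_scheme \<Rightarrow> ('r, 'a, 't) module_scheme \<Rightarrow> bool"
  where "free_module R M \<longleftrightarrow> module R M \<and>
    (\<exists>B \<subseteq> carrier M. \<forall>x \<in> carrier M.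
      \<exists>!c. c \<in> B \<rightarrow>\<^sub>E carrier R \<and> finite {b \<in> B. c b \<noteq> \<zero>\<^bsub>R\<^esub>} \<and>
        x = (\<Oplus>\<^bsub>M\<^esub> b \<in> {b \<in> B. c b \<noteq> \<zero>\<^bsub>R\<^esub>}. c b \<odot>\<^bsub>M\<^esub> b))"

text \<open>
  The lifting property is tested against modules with elements in the same type \<open>'u\<close>. This is
  projectivity in the usual sense as soon as \<open>'u\<close> is large enough to contain a copy of the free
  module on the set \<open>carrier P\<close>; the type \<open>univ\<close> below is.
\<close>

definition projective_module :: "('r, 's) ring_scheme \<Rightarrow> ('r, 'u) module \<Rightarrow> bool"
  where "projective_module R P \<longleftrightarrow> module R P \<and>
    (\<forall>(M :: ('r, 'u) module) (N :: ('r, 'u) module) q f.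
      module R M \<longrightarrow> module R N \<longrightarrow>
      q \<in> module_homs R M N \<longrightarrow> q ` carrier M = carrier N \<longrightarrow> f \<in> module_homs R P N \<longrightarrow>
      (\<exists>g \<in> module_homs R P M. compose (carrier P) q g = f))"

definition factors_through_projective ::
  "('r, 's) ring_scheme \<Rightarrow> ('r, 'u) module \<Rightarrow> ('r, 'u) module \<Rightarrow> ('u \<Rightarrow> 'u) \<Rightarrow> bool"
  where "factors_through_projective R M N f \<longleftrightarrow>
    (\<exists>P :: ('r, 'u) module. projective_module R P \<and>
      (\<exists>i \<in> module_homs R M P. \<exists>q \<in> module_homs R P N. f = compose (carrier M) q i))"

definition stable_class ::
  "('r, 's) ring_scheme \<Rightarrow> ('r, 'u) module \<Rightarrow> ('r, 'u) module \<Rightarrow> ('u \<Rightarrow> 'u) \<Rightarrow> ('u \<Rightarrow> 'u) set"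
  where "stable_class R M N f =
    {g \<in> module_homs R M N.
      factors_through_projective R M N (\<lambda>x \<in> carrier M. f x \<ominus>\<^bsub>N\<^esub> g x)}"

text \<open>
  Operations on stable morphisms are given by representatives: the union over all representatives
  of the classes of the results is itself a class exactly because the operation is well defined.
\<close>

definition Stab :: "('r, 's) ring_scheme \<Rightarrow> (('r, 'u) module, ('u \<Rightarrow> 'u) set) cat"
  where "Stab R =
    \<lparr>Ob = {M. module R M},
     Hom = (\<lambda>M N. stable_class R M N ` module_homs R M N),
     Idn = (\<lambda>M. stable_class R M M (\<lambda>x \<in> carrier M. x)),
     Cmp = (\<lambda>M N P \<beta> \<alpha>. \<Union>g \<in> \<beta>. \<Union>f \<in> \<alpha>. stable_class R M P (compose (carrier M) g f))\<rparr>"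

section \<open>Restriction and coinduction\<close>

definition regular_module :: "('r, 's) ring_scheme \<Rightarrow> ('r, 'r) module"
  where "regular_module S =
    \<lparr>carrier = carrier S, monoid.mult = monoid.mult S, one = one S,
     zero = zero S, add = add S, smult = monoid.mult S\<rparr>"

definition restrict_scalars ::
  "('r \<Rightarrow> 's) \<Rightarrow> ('s, 'a) module \<Rightarrow> ('r, 'a) module"
  where "restrict_scalars \<phi> M =
    \<lparr>carrier = carrier M, monoid.mult = monoid.mult M, one = one M,
     zero = zero M, add = add M, smult = (\<lambda>a x. \<phi> a \<odot>\<^bsub>M\<^esub> x)\<rparr>"

text \<open>
  A universe of module elements: it contains \<open>'v\<close> and every function from \<open>'i\<close> to the universe.
  Over a ring with elements in \<open>'i\<close>, coinduced modules therefore again have elements in the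
  universe, and so do countable direct sums and free modules on such modules up to isomorphism. As \<open>'v\<close> is arbitrary, every
  module is isomorphic to one with elements in such a universe.
\<close>

datatype ('i, 'v) univ = Elt 'v | Fun (app: "'i \<Rightarrow> ('i, 'v) univ")

text \<open>
  The \<open>S\<close>-module \<open>Hom_R(S, N)\<close> for \<open>\<phi> : R \<rightarrow> S\<close>; \<open>S\<close> acts by \<open>(b f)(a) = f(a b)\<close>. The ring fields
  \<open>mult\<close> and \<open>one\<close> of a module record carry no meaning.
\<close>

definition coinduced_module ::
  "('r, 'z) ring_scheme \<Rightarrow> ('s, 'w) ring_scheme \<Rightarrow> ('r \<Rightarrow> 's)
    \<Rightarrow> ('r, ('s, 'v) univ) module \<Rightarrow> ('s, ('s, 'v) univ) module"
  where "coinduced_module R S \<phi> N =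
    \<lparr>carrier = Fun ` module_homs R (restrict_scalars \<phi> (regular_module S)) N,
     monoid.mult = undefined, one = undefined,
     zero = Fun (\<lambda>a \<in> carrier S. \<zero>\<^bsub>N\<^esub>),
     add = (\<lambda>u v. Fun (\<lambda>a \<in> carrier S. app u a \<oplus>\<^bsub>N\<^esub> app v a)),
     smult = (\<lambda>b u. Fun (\<lambda>a \<in> carrier S. app u (a \<otimes>\<^bsub>S\<^esub> b)))\<rparr>"

definition coinduced_map ::
  "('r, 'z) ring_scheme \<Rightarrow> ('s, 'w) ring_scheme \<Rightarrow> ('r \<Rightarrow> 's) \<Rightarrow> ('r, ('s, 'v) univ) module
    \<Rightarrow> (('s, 'v) univ \<Rightarrow> ('s, 'v) univ) \<Rightarrow> ('s, 'v) univ \<Rightarrow> ('s, 'v) univ"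
  where "coinduced_map R S \<phi> M f =
    (\<lambda>u \<in> carrier (coinduced_module R S \<phi> M). Fun (compose (carrier S) f (app u)))"

definition Res ::
  "('r, 'z) ring_scheme \<Rightarrow> ('r \<Rightarrow> 's)
    \<Rightarrow> (('s, 'u) module, ('u \<Rightarrow> 'u) set, ('r, 'u) module, ('u \<Rightarrow> 'u) set) cfun"
  where "Res R \<phi> =
    \<lparr>FOb = restrict_scalars \<phi>,
     FMap = (\<lambda>M N \<alpha>. \<Union>f \<in> \<alpha>. stable_class R (restrict_scalars \<phi> M) (restrict_scalars \<phi> N) f)\<rparr>"

definition CoInd ::
  "('r, 'z) ring_scheme \<Rightarrow> ('s, 'w) ring_scheme \<Rightarrow> ('r \<Rightarrow> 's)
    \<Rightarrow> (('r, ('s, 'v) univ) module, (('s, 'v) univ \<Rightarrow> ('s, 'v) univ) set,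
        ('s, ('s, 'v) univ) module, (('s, 'v) univ \<Rightarrow> ('s, 'v) univ) set) cfun"
  where "CoInd R S \<phi> =
    \<lparr>FOb = coinduced_module R S \<phi>,
     FMap = (\<lambda>M N \<alpha>. \<Union>f \<in> \<alpha>.
       stable_class S (coinduced_module R S \<phi> M) (coinduced_module R S \<phi> N)
         (coinduced_map R S \<phi> M f))\<rparr>"

text \<open>The unit is \<open>x \<mapsto> (a \<mapsto> a x)\<close>, the counit is evaluation at \<open>1\<close>.\<close>

definition Res_CoInd ::
  "('r, 'z) ring_scheme \<Rightarrow> ('s, 'w) ring_scheme \<Rightarrow> ('r \<Rightarrow> 's)
    \<Rightarrow> (('s, ('s, 'v) univ) module, (('s, 'v) univ \<Rightarrow> ('s, 'v) univ) set,
        ('r, ('s, 'v) univ) module, (('s, 'v) univ \<Rightarrow> ('s, 'v) univ) set) adj"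
  where "Res_CoInd R S \<phi> =
    \<lparr>Lft = Res R \<phi>,
     Rgt = CoInd R S \<phi>,
     unt = (\<lambda>M. stable_class S M (coinduced_module R S \<phi> (restrict_scalars \<phi> M))
       (\<lambda>x \<in> carrier M. Fun (\<lambda>a \<in> carrier S. a \<odot>\<^bsub>M\<^esub> x))),
     cnt = (\<lambda>N. stable_class R (restrict_scalars \<phi> (coinduced_module R S \<phi> N)) N
       (\<lambda>u \<in> carrier (coinduced_module R S \<phi> N). app u \<one>\<^bsub>S\<^esub>))\<rparr>"

section \<open>Group algebras and cyclic shifted subgroups\<close>

definition group_algebra ::
  "('k, 'x) ring_scheme \<Rightarrow> ('g, 'y) monoid_scheme \<Rightarrow> ('g \<Rightarrow> 'k) ring"
  where "group_algebra K G =
    \<lparr>carrier = carrier G \<rightarrow>\<^sub>E carrier K,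
     monoid.mult = (\<lambda>f h. \<lambda>x \<in> carrier G.
       \<Oplus>\<^bsub>K\<^esub> y \<in> carrier G. f y \<otimes>\<^bsub>K\<^esub> h (inv\<^bsub>G\<^esub> y \<otimes>\<^bsub>G\<^esub> x)),
     one = (\<lambda>x \<in> carrier G. if x = \<one>\<^bsub>G\<^esub> then \<one>\<^bsub>K\<^esub> else \<zero>\<^bsub>K\<^esub>),
     zero = (\<lambda>x \<in> carrier G. \<zero>\<^bsub>K\<^esub>),
     add = (\<lambda>f h. \<lambda>x \<in> carrier G. f x \<oplus>\<^bsub>K\<^esub> h x)\<rparr>"

definition ring_characteristic :: "('k, 'x) ring_scheme \<Rightarrow> nat"
  where "ring_characteristic K = group.ord (add_monoid K) \<one>\<^bsub>K\<^esub>"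

definition elementary_abelian :: "nat \<Rightarrow> ('g, 'y) monoid_scheme \<Rightarrow> bool"
  where "elementary_abelian p G \<longleftrightarrow> group G \<and>
    (\<exists>r :: nat. G \<cong> product_group {..<r} (\<lambda>_. integer_mod_group p))"

definition cyclic_shifted_subgroup ::
  "('k, 'x) ring_scheme \<Rightarrow> nat \<Rightarrow> ('g, 'y) monoid_scheme \<Rightarrow> ((int \<Rightarrow> 'k) \<Rightarrow> ('g \<Rightarrow> 'k)) \<Rightarrow> bool"
  where "cyclic_shifted_subgroup K p G \<phi> \<longleftrightarrow>
    \<phi> \<in> ring_hom (group_algebra K (integer_mod_group p)) (group_algebra K G) \<and>
    free_module (group_algebra K (integer_mod_group p))
      (restrict_scalars \<phi> (regular_module (group_algebra K G)))"

end

theory Submission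
  imports Defs "HOL-Computational_Algebra.Primes"
begin

text \<open>
  Restriction and coinduction along \<open>l\<close> are adjoint on modules, with unit \<open>x \<mapsto> (a \<mapsto> a x)\<close> and counit
  evaluation at \<open>1\<close>. The counit has a natural section. Indeed \<open>kC\<close> is local and \<open>kG\<close> is free over
  it, so some coordinate of \<open>1\<close> in a basis is a unit, and rescaling that coordinate function gives a
  \<open>kC\<close>-linear map \<open>\<pi> : kG \<rightarrow> kC\<close> with \<open>\<pi> 1 = 1\<close> (\<open>linear_retraction\<close>); the section is
  \<open>x \<mapsto> (a \<mapsto> \<pi>(a) x)\<close>. For any adjunction \<open>L \<stileturn> R\<close> whose counit \<open>\<epsilon>\<close> has a natural section \<open>\<xi>\<close>, the
  Eilenberg--Moore functor is fully faithful, and a module \<open>(X, \<rho>)\<close> over the monad is cut out of the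
  free module on \<open>X\<close> by the idempotent \<open>L\<rho> \<circ> \<xi>\<close> of \<open>L X\<close>. Hence it is an equivalence as soon as
  idempotents split in the target of \<open>L\<close> (\<open>EM_functor_equivalence\<close>). The identity
  \<open>E \<circ> Res = F\<close> holds on the nose, by unfolding definitions.

  Two things have to be shown about stable categories.

  The first is that both functors preserve projectives, so that the adjunction descends. Restriction
  does, because coinduction preserves surjections: \<open>kG\<close> is free over \<open>kC\<close>. For coinduction one cannot
  argue with bases, because \<open>l\<close> is only a ring homomorphism: it need not be \<open>K\<close>-linear, and \<open>kG\<close> may
  have infinite rank over \<open>kC\<close>. Instead, coinduction preserves injectives, being right adjoint to an
  exact functor, and over a group algebra the projective and the injective modules coincide. Both are
  characterised by Higman's criterion: the identity of \<open>M\<close> is a trace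
  \<open>x \<mapsto> (\<Sum>g. g h(g\<inverse> x))\<close> with \<open>h\<close> linear over \<open>K\<close>
  (\<open>projective_iff_trace_split\<close>, \<open>trace_split_extend\<close>, \<open>extension_property_imp_trace_split\<close>). In the
  same way the maps that factor through a projective are exactly the traces of linear maps
  (\<open>factors_through_projective_iff_trace\<close>), so they are closed under differences without any appeal
  to direct sums. All this is done for Frobenius algebras with a chosen pair of dual bases.

  The second is that idempotents split in the stable category of \<open>kC\<close>, for modules of any
  dimension (\<open>stably_idempotent_splits\<close>). Let \<open>e\<close> represent an idempotent on \<open>M\<close>, let \<open>t = \<sigma> - 1\<close>
  and let \<open>N\<close> be the sum of the powers of \<open>\<sigma>\<close>. There is an endomorphism \<open>\<delta>\<close> of \<open>M\<close> that factors
  through a projective and is the identity on \<open>N M\<close>. The representative \<open>e\<^sub>1 = (1 - \<delta>) e\<close>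
  of the same class satisfies \<open>e\<^sub>1\<^sup>2 - e\<^sub>1 = (1 - \<delta>) q j\<close> with \<open>j : M \<rightarrow> P\<close>, \<open>q : P \<rightarrow> M\<close> and \<open>P\<close>
  projective. The map \<open>j (1 - \<delta>) q\<close> kills \<open>N P\<close>, so its image is killed by \<open>N\<close> and lies in \<open>t P\<close>;
  as \<open>t\<close> is nilpotent, so is \<open>e\<^sub>1\<^sup>2 - e\<^sub>1\<close>. In characteristic \<open>p\<close> a large power \<open>e\<^sub>1 ^ p\<^sup>k\<close> is then
  idempotent on the nose, and its image splits \<open>e\<close>.
\<close>

section \<open>Sums in abelian groups\<close>

text \<open>
  This equips the normalisation method \<open>algebra\<close> to decide equations in abelian groups.
\<close>

lemmas (in abelian_group) abelian_group_simprules
  [algebra abelian_group "zero G" "add G" "a_inv G" "a_minus G"] =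
  a_closed zero_closed a_inv_closed minus_closed
  a_assoc l_zero l_neg a_comm minus_eq
  r_zero r_neg r_neg2 r_neg1 minus_add minus_minus minus_zero a_lcomm

lemma (in abelian_group) minus_eq_zero_iff:
  assumes "x \<in> carrier G" "y \<in> carrier G"
  shows "x \<ominus> y = \<zero> \<longleftrightarrow> x = y"
proof
  assume "x \<ominus> y = \<zero>"
  moreover have "x = (x \<ominus> y) \<oplus> y" using assms by algebra
  ultimately show "x = y" using assms by simp
qed (use assms in algebra)

lemma (in abelian_monoid) finsum_swap:
  assumes "finite A" "finite B" "\<And>a b. a \<in> A \<Longrightarrow> b \<in> B \<Longrightarrow> f a b \<in> carrier G"
  shows "(\<Oplus>a\<in>A. \<Oplus>b\<in>B. f a b) = (\<Oplus>b\<in>B. \<Oplus>a\<in>A. f a b)"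
  using assms(1,3)
proof (induction A)
  case empty
  then show ?case by (simp add: finsum_zero)
next
  case (insert x F)
  have "(\<Oplus>a\<in>insert x F. \<Oplus>b\<in>B. f a b) = (\<Oplus>b\<in>B. f x b) \<oplus> (\<Oplus>a\<in>F. \<Oplus>b\<in>B. f a b)"
    by (rule finsum_insert) (use insert in \<open>auto intro!: finsum_closed\<close>)
  also have "(\<Oplus>a\<in>F. \<Oplus>b\<in>B. f a b) = (\<Oplus>b\<in>B. \<Oplus>a\<in>F. f a b)"
    using insert by simp
  also have "(\<Oplus>b\<in>B. f x b) \<oplus> (\<Oplus>b\<in>B. \<Oplus>a\<in>F. f a b) = (\<Oplus>b\<in>B. f x b \<oplus> (\<Oplus>a\<in>F. f a b))"
    by (rule finsum_addf[symmetric]) (use insert in \<open>auto intro!: finsum_closed\<close>)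
  also have "\<dots> = (\<Oplus>b\<in>B. \<Oplus>a\<in>insert x F. f a b)"
    by (rule finsum_cong') (use insert in \<open>auto simp: Pi_iff intro!: finsum_insert[symmetric] finsum_closed a_closed\<close>)
  finally show ?case .
qed

lemma additive_finsum:
  assumes "abelian_group A" "abelian_group B" "finite I" "g \<in> I \<rightarrow> carrier A"
    and closed: "\<And>x. x \<in> carrier A \<Longrightarrow> f x \<in> carrier B"
    and add: "\<And>x y. x \<in> carrier A \<Longrightarrow> y \<in> carrier A \<Longrightarrow> f (x \<oplus>\<^bsub>A\<^esub> y) = f x \<oplus>\<^bsub>B\<^esub> f y"
  shows "f (\<Oplus>\<^bsub>A\<^esub> i \<in> I. g i) = (\<Oplus>\<^bsub>B\<^esub> i \<in> I. f (g i))"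
proof -
  interpret A: abelian_group A by fact
  interpret B: abelian_group B by fact
  have "f \<zero>\<^bsub>A\<^esub> = f \<zero>\<^bsub>A\<^esub> \<oplus>\<^bsub>B\<^esub> f \<zero>\<^bsub>A\<^esub>" using add[of "\<zero>\<^bsub>A\<^esub>" "\<zero>\<^bsub>A\<^esub>"] by simp
  then have f0: "f \<zero>\<^bsub>A\<^esub> = \<zero>\<^bsub>B\<^esub>" using closed[of "\<zero>\<^bsub>A\<^esub>"] by (metis A.zero_closed B.add.r_cancel_one')
  show ?thesis using assms(3,4)
  proof (induction)
    case (insert x F)
    then have "(\<lambda>i. f (g i)) \<in> F \<rightarrow> carrier B" "f (g x) \<in> carrier B" using closed by auto
    with insert show ?case by (simp add: add Pi_iff)
  qed (simp add: f0)
qed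

lemma (in module) finsum_smult_rdistr:
  assumes "finite A" "x \<in> carrier M" "f \<in> A \<rightarrow> carrier R"
  shows "(\<Oplus>i \<in> A. f i) \<odot>\<^bsub>M\<^esub> x = (\<Oplus>\<^bsub>M\<^esub> i \<in> A. f i \<odot>\<^bsub>M\<^esub> x)"
  using assms by (induction) (auto simp: Pi_iff smult_l_distr)

section \<open>Module homomorphisms\<close>

lemma module_homsI:
  assumes "\<And>x. x \<in> carrier M \<Longrightarrow> f x \<in> carrier N" "f \<in> extensional (carrier M)"
    and "\<And>x y. x \<in> carrier M \<Longrightarrow> y \<in> carrier M \<Longrightarrow> f (x \<oplus>\<^bsub>M\<^esub> y) = f x \<oplus>\<^bsub>N\<^esub> f y"
    and "\<And>a x. a \<in> carrier R \<Longrightarrow> x \<in> carrier M \<Longrightarrow> f (a \<odot>\<^bsub>M\<^esub> x) = a \<odot>\<^bsub>N\<^esub> f x"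
  shows "f \<in> module_homs R M N"
  using assms by (auto simp: module_homs_def PiE_def)

lemma restrict_module_homsI:
  assumes "module R M"
    and "\<And>x. x \<in> carrier M \<Longrightarrow> f x \<in> carrier N"
    and "\<And>x y. x \<in> carrier M \<Longrightarrow> y \<in> carrier M \<Longrightarrow> f (x \<oplus>\<^bsub>M\<^esub> y) = f x \<oplus>\<^bsub>N\<^esub> f y"
    and "\<And>a x. a \<in> carrier R \<Longrightarrow> x \<in> carrier M \<Longrightarrow> f (a \<odot>\<^bsub>M\<^esub> x) = a \<odot>\<^bsub>N\<^esub> f x"
  shows "(\<lambda>x \<in> carrier M. f x) \<in> module_homs R M N"
proof -
  interpret module R M by fact
  show ?thesis by (rule module_homsI) (auto simp: assms)
qed

lemma hom_closed: "f \<in> module_homs R M N \<Longrightarrow> x \<in> carrier M \<Longrightarrow> f x \<in> carrier N"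
  and hom_extensional: "f \<in> module_homs R M N \<Longrightarrow> f \<in> extensional (carrier M)"
  and hom_add: "f \<in> module_homs R M N \<Longrightarrow> x \<in> carrier M \<Longrightarrow> y \<in> carrier M
    \<Longrightarrow> f (x \<oplus>\<^bsub>M\<^esub> y) = f x \<oplus>\<^bsub>N\<^esub> f y"
  and hom_smult: "f \<in> module_homs R M N \<Longrightarrow> a \<in> carrier R \<Longrightarrow> x \<in> carrier M
    \<Longrightarrow> f (a \<odot>\<^bsub>M\<^esub> x) = a \<odot>\<^bsub>N\<^esub> f x"
  by (auto simp: module_homs_def PiE_def)

lemma hom_eqI:
  assumes "f \<in> module_homs R M N" "g \<in> module_homs R M N" "\<And>x. x \<in> carrier M \<Longrightarrow> f x = g x"
  shows "f = g"
  using assms by (intro extensionalityI[of f "carrier M"] hom_extensional)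

lemma hom_zero:
  assumes "module R M" "module R N" "f \<in> module_homs R M N"
  shows "f \<zero>\<^bsub>M\<^esub> = \<zero>\<^bsub>N\<^esub>"
proof -
  interpret M: module R M by fact
  interpret N: module R N by fact
  have "f (\<zero>\<^bsub>R\<^esub> \<odot>\<^bsub>M\<^esub> \<zero>\<^bsub>M\<^esub>) = \<zero>\<^bsub>R\<^esub> \<odot>\<^bsub>N\<^esub> f \<zero>\<^bsub>M\<^esub>"
    by (rule hom_smult[OF assms(3)]) auto
  then show ?thesis using hom_closed[OF assms(3), of "\<zero>\<^bsub>M\<^esub>"] by simp
qed

lemma hom_neg:
  assumes "module R M" "module R N" "f \<in> module_homs R M N" "x \<in> carrier M"
  shows "f (\<ominus>\<^bsub>M\<^esub> x) = \<ominus>\<^bsub>N\<^esub> f x"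
proof -
  interpret M: module R M by fact
  interpret N: module R N by fact
  have "f x \<oplus>\<^bsub>N\<^esub> f (\<ominus>\<^bsub>M\<^esub> x) = \<zero>\<^bsub>N\<^esub>"
    using hom_add[OF assms(3,4), of "\<ominus>\<^bsub>M\<^esub> x"] hom_zero[OF assms(1-3)] assms(4)
    by (simp add: M.M.r_neg)
  then show ?thesis using hom_closed[OF assms(3)] assms(4)
    by (metis N.M.a_inv_closed M.M.a_inv_closed N.M.minus_equality N.M.a_comm)
qed

lemma hom_diff:
  assumes "module R M" "module R N" "f \<in> module_homs R M N" "x \<in> carrier M" "y \<in> carrier M"
  shows "f (x \<ominus>\<^bsub>M\<^esub> y) = f x \<ominus>\<^bsub>N\<^esub> f y"
proof -
  interpret M: module R M by fact
  show ?thesis using assms by (simp add: a_minus_def hom_add hom_neg)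
qed

lemma hom_finsum:
  assumes "module R M" "module R N" "f \<in> module_homs R M N" "finite A" "g \<in> A \<rightarrow> carrier M"
  shows "f (\<Oplus>\<^bsub>M\<^esub> i \<in> A. g i) = (\<Oplus>\<^bsub>N\<^esub> i \<in> A. f (g i))"
  by (rule additive_finsum[OF module.axioms(2)[OF assms(1)] module.axioms(2)[OF assms(2)] assms(4,5)])
    (use assms(3) in \<open>auto simp: hom_closed hom_add\<close>)

lemma hom_id: "module R M \<Longrightarrow> (\<lambda>x \<in> carrier M. x) \<in> module_homs R M M"
  by (rule restrict_module_homsI) auto

lemma hom_compose:
  assumes "module R L" "f \<in> module_homs R L M" "g \<in> module_homs R M N"
  shows "compose (carrier L) g f \<in> module_homs R L N"
  unfolding compose_def
  by (rule restrict_module_homsI)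
    (use assms in \<open>auto simp: hom_add hom_smult hom_closed\<close>)

lemma hom_zero_map:
  assumes "module R M" "module R N"
  shows "(\<lambda>x \<in> carrier M. \<zero>\<^bsub>N\<^esub>) \<in> module_homs R M N"
proof -
  interpret N: module R N by fact
  show ?thesis using assms(1) by (rule restrict_module_homsI) auto
qed

lemma hom_diff_map:
  assumes "module R M" "module R N" "f \<in> module_homs R M N" "g \<in> module_homs R M N"
  shows "(\<lambda>x \<in> carrier M. f x \<ominus>\<^bsub>N\<^esub> g x) \<in> module_homs R M N"
proof -
  interpret M: module R M by fact
  interpret N: module R N by fact
  show ?thesis
  proof (rule restrict_module_homsI[OF assms(1)])
    fix x y assume xy: "x \<in> carrier M" "y \<in> carrier M"
    note c = this hom_closed[OF assms(3)] hom_closed[OF assms(4)]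
    show "f (x \<oplus>\<^bsub>M\<^esub> y) \<ominus>\<^bsub>N\<^esub> g (x \<oplus>\<^bsub>M\<^esub> y) = (f x \<ominus>\<^bsub>N\<^esub> g x) \<oplus>\<^bsub>N\<^esub> (f y \<ominus>\<^bsub>N\<^esub> g y)"
      using c by (simp add: hom_add[OF assms(3)] hom_add[OF assms(4)] a_minus_def N.M.minus_add N.M.a_ac)
  qed (use assms in \<open>auto simp: hom_smult hom_closed a_minus_def N.smult_r_distr N.smult_r_minus\<close>)
qed

lemma module_compose_assoc:
  "f \<in> module_homs R L M \<Longrightarrow>
    compose (carrier L) h (compose (carrier L) g f) = compose (carrier L) (compose (carrier M) h g) f"
  by (rule ext) (auto simp: compose_def hom_closed)

lemma compose_id_left: "f \<in> module_homs R M N \<Longrightarrow> compose (carrier M) (\<lambda>x \<in> carrier N. x) f = f"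
  by (rule Id_compose) (auto simp: hom_closed hom_extensional)

lemma compose_id_right: "f \<in> module_homs R M N \<Longrightarrow> compose (carrier M) f (\<lambda>x \<in> carrier M. x) = f"
  by (rule compose_Id) (auto simp: hom_closed hom_extensional)

section \<open>Restriction of scalars\<close>

lemma restrict_scalars_simps [simp]:
  "carrier (restrict_scalars \<phi> M) = carrier M"
  "\<zero>\<^bsub>restrict_scalars \<phi> M\<^esub> = \<zero>\<^bsub>M\<^esub>"
  "x \<oplus>\<^bsub>restrict_scalars \<phi> M\<^esub> y = x \<oplus>\<^bsub>M\<^esub> y"
  "a \<odot>\<^bsub>restrict_scalars \<phi> M\<^esub> x = \<phi> a \<odot>\<^bsub>M\<^esub> x"
  by (auto simp: restrict_scalars_def)

lemma finsum_restrict_scalars [simp]: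
  "finsum (restrict_scalars \<phi> M) f A = finsum M f A"
  by (simp add: finsum_def finprod_def restrict_scalars_def)

lemma a_inv_restrict_scalars [simp]:
  "\<ominus>\<^bsub>restrict_scalars \<phi> M\<^esub> x = \<ominus>\<^bsub>M\<^esub> x"
  by (simp add: a_inv_def m_inv_def)

lemma a_minus_restrict_scalars [simp]:
  "x \<ominus>\<^bsub>restrict_scalars \<phi> M\<^esub> y = x \<ominus>\<^bsub>M\<^esub> y"
  by (simp add: a_minus_def)

text \<open>
  Restricting scalars changes the type of the record, so that the two additive groups cannot be
  equated; only their components can.
\<close>

lemma abelian_group_cong:
  assumes "abelian_group M" "carrier N = carrier M" "\<zero>\<^bsub>N\<^esub> = \<zero>\<^bsub>M\<^esub>"
    and "\<And>x y. x \<oplus>\<^bsub>N\<^esub> y = x \<oplus>\<^bsub>M\<^esub> y"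
  shows "abelian_group N"
proof -
  interpret M: abelian_group M by fact
  show ?thesis
    by (rule abelian_groupI) (auto simp: assms(2-4) M.a_ac intro: M.l_neg)
qed

lemma restrict_scalars_module:
  assumes "\<phi> \<in> ring_hom R S" "cring R" "module S M"
  shows "module R (restrict_scalars \<phi> M)"
proof -
  interpret M: module S M by fact
  interpret R: cring R by fact
  show ?thesis
  proof (rule moduleI)
    show "abelian_group (restrict_scalars \<phi> M)"
      by (rule abelian_group_cong[OF M.M.abelian_group_axioms]) auto
  qed (use assms in \<open>auto simp: ring_hom_closed ring_hom_add ring_hom_mult ring_hom_one
      M.smult_l_distr M.smult_r_distr M.smult_assoc1\<close>)
qed

lemma restrict_scalars_hom:
  assumes "\<phi> \<in> ring_hom R S" "f \<in> module_homs S M N"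
  shows "f \<in> module_homs R (restrict_scalars \<phi> M) (restrict_scalars \<phi> N)"
  using assms
  by (intro module_homsI) (auto simp: ring_hom_closed hom_add hom_smult hom_closed hom_extensional)

lemma regular_module_simps [simp]:
  "carrier (regular_module S) = carrier S"
  "\<zero>\<^bsub>regular_module S\<^esub> = \<zero>\<^bsub>S\<^esub>"
  "x \<oplus>\<^bsub>regular_module S\<^esub> y = x \<oplus>\<^bsub>S\<^esub> y"
  "a \<odot>\<^bsub>regular_module S\<^esub> x = a \<otimes>\<^bsub>S\<^esub> x"
  by (auto simp: regular_module_def)

lemma regular_module_module:
  assumes "cring S" shows "module S (regular_module S)"
proof -
  interpret cring S by fact
  show ?thesis
  proof (rule moduleI)
    show "abelian_group (regular_module S)"
      by (rule abelian_group_cong[OF abelian_group_axioms]) auto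
  qed (auto simp: l_distr r_distr m_assoc assms)
qed

section \<open>Linear algebra over a field\<close>

text \<open>
  By Zorn's lemma there is a subspace \<open>W\<close> that is maximal among those that meet \<open>U\<close> only in zero. For
  \<open>x\<close> outside \<open>W\<close> the larger space \<open>W + K x\<close> meets \<open>U\<close> in a nonzero vector \<open>w + a x\<close>; here \<open>a \<noteq> 0\<close>,
  so \<open>x\<close> lies in \<open>U + W\<close>.
\<close>

lemma subspace_complement:
  assumes "field K" "module K X" "submodule U K X"
  shows "\<exists>W. submodule W K X \<and> U \<inter> W = {\<zero>\<^bsub>X\<^esub>} \<and>
    (\<forall>x \<in> carrier X. \<exists>u \<in> U. \<exists>w \<in> W. x = u \<oplus>\<^bsub>X\<^esub> w)"
proof -
  interpret K: field K by fact
  interpret X: module K X by fact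
  note U = X.submoduleE[OF assms(3)]
  have U0: "\<zero>\<^bsub>X\<^esub> \<in> U"
    using U(1,2,3,5) by (metis X.M.r_neg all_not_in_conv subsetD)
  define F where "F = {W. submodule W K X \<and> U \<inter> W = {\<zero>\<^bsub>X\<^esub>}}"
  have "\<exists>W\<in>F. \<forall>V\<in>F. W \<subseteq> V \<longrightarrow> V = W"
  proof (rule subset_Zorn_nonempty)
    have "submodule {\<zero>\<^bsub>X\<^esub>} K X" by (rule X.submoduleI) auto
    then show "F \<noteq> {}" using U0 by (auto simp: F_def)
  next
    fix C assume C: "C \<noteq> {}" "subset.chain F C"
    then have CF: "\<And>W. W \<in> C \<Longrightarrow> submodule W K X" "\<And>W. W \<in> C \<Longrightarrow> U \<inter> W = {\<zero>\<^bsub>X\<^esub>}"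
      by (auto simp: F_def subset.chain_def)
    note W = X.submoduleE[OF CF(1)]
    have "submodule (\<Union>C) K X"
    proof (rule X.submoduleI)
      show "\<Union>C \<subseteq> carrier X" using W(1) by auto
      show "\<zero>\<^bsub>X\<^esub> \<in> \<Union>C" using C(1) CF(2) by blast
      show "\<ominus>\<^bsub>X\<^esub> a \<in> \<Union>C" if "a \<in> \<Union>C" for a using that W(3) by auto
      show "a \<odot>\<^bsub>X\<^esub> x \<in> \<Union>C" if "a \<in> carrier K" "x \<in> \<Union>C" for a x using that W(4) by auto
      fix a b assume "a \<in> \<Union>C" "b \<in> \<Union>C"
      then obtain A B where AB: "A \<in> C" "B \<in> C" "a \<in> A" "b \<in> B" by auto
      then have "A \<subseteq> B \<or> B \<subseteq> A" using C(2) by (auto simp: subset.chain_def)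
      then show "a \<oplus>\<^bsub>X\<^esub> b \<in> \<Union>C" using AB W(5) by (metis UnionI subsetD)
    qed
    then show "\<Union>C \<in> F" using C(1) CF(2) by (auto simp: F_def)
  qed
  then obtain W where WF: "W \<in> F" and max: "\<And>V. V \<in> F \<Longrightarrow> W \<subseteq> V \<Longrightarrow> V = W" by blast
  have Wsub: "submodule W K X" and UW: "U \<inter> W = {\<zero>\<^bsub>X\<^esub>}" using WF by (auto simp: F_def)
  note W = X.submoduleE[OF Wsub]
  have "\<exists>u \<in> U. \<exists>w \<in> W. x = u \<oplus>\<^bsub>X\<^esub> w" if x: "x \<in> carrier X" for x
  proof (cases "x \<in> W")
    case True
    then show ?thesis using U0 x by (metis X.M.l_zero)
  next
    case False
    define V where "V = {w \<oplus>\<^bsub>X\<^esub> a \<odot>\<^bsub>X\<^esub> x | w a. w \<in> W \<and> a \<in> carrier K}"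
    have Vsub: "submodule V K X"
    proof (rule X.submoduleI)
      show "V \<subseteq> carrier X" using W(1) x by (auto simp: V_def)
      have "\<zero>\<^bsub>X\<^esub> = \<zero>\<^bsub>X\<^esub> \<oplus>\<^bsub>X\<^esub> \<zero>\<^bsub>K\<^esub> \<odot>\<^bsub>X\<^esub> x" using x by simp
      then show "\<zero>\<^bsub>X\<^esub> \<in> V" using UW by (auto simp: V_def)
      fix v assume "v \<in> V"
      then obtain w a where v: "v = w \<oplus>\<^bsub>X\<^esub> a \<odot>\<^bsub>X\<^esub> x" "w \<in> W" "a \<in> carrier K"
        by (auto simp: V_def)
      have "\<ominus>\<^bsub>X\<^esub> v = \<ominus>\<^bsub>X\<^esub> w \<oplus>\<^bsub>X\<^esub> (\<ominus>\<^bsub>K\<^esub> a) \<odot>\<^bsub>X\<^esub> x"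
        using v x W(1) by (auto simp: X.M.minus_add X.smult_l_minus)
      then show "\<ominus>\<^bsub>X\<^esub> v \<in> V" using v W(3) by (auto simp: V_def)
      { fix b assume b: "b \<in> carrier K"
        have "b \<odot>\<^bsub>X\<^esub> v = b \<odot>\<^bsub>X\<^esub> w \<oplus>\<^bsub>X\<^esub> (b \<otimes>\<^bsub>K\<^esub> a) \<odot>\<^bsub>X\<^esub> x"
          using v x W(1) b by (auto simp: X.smult_r_distr X.smult_assoc1)
        then show "b \<odot>\<^bsub>X\<^esub> v \<in> V" using v W(4) b by (auto simp: V_def) }
      fix v' assume "v' \<in> V"
      then obtain w' a' where v': "v' = w' \<oplus>\<^bsub>X\<^esub> a' \<odot>\<^bsub>X\<^esub> x" "w' \<in> W" "a' \<in> carrier K"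
        by (auto simp: V_def)
      have "w \<in> carrier X" "w' \<in> carrier X" using v v' W(1) by auto
      then have "v \<oplus>\<^bsub>X\<^esub> v' = (w \<oplus>\<^bsub>X\<^esub> w') \<oplus>\<^bsub>X\<^esub> (a \<oplus>\<^bsub>K\<^esub> a') \<odot>\<^bsub>X\<^esub> x"
        using v v' x by (simp add: X.smult_l_distr X.M.a_ac)
      then show "v \<oplus>\<^bsub>X\<^esub> v' \<in> V" using v v' W(5) by (auto simp: V_def)
    qed
    have WV: "W \<subseteq> V"
    proof
      fix w assume "w \<in> W"
      moreover have "w = w \<oplus>\<^bsub>X\<^esub> \<zero>\<^bsub>K\<^esub> \<odot>\<^bsub>X\<^esub> x" using \<open>w \<in> W\<close> W(1) x by auto
      ultimately show "w \<in> V" by (auto simp: V_def)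
    qed
    have "x = \<zero>\<^bsub>X\<^esub> \<oplus>\<^bsub>X\<^esub> \<one>\<^bsub>K\<^esub> \<odot>\<^bsub>X\<^esub> x" using x by simp
    then have "x \<in> V" using UW by (auto simp: V_def)
    with False max WV have "V \<notin> F" by blast
    then obtain v where v: "v \<in> U" "v \<in> V" "v \<noteq> \<zero>\<^bsub>X\<^esub>"
      using Vsub U0 X.submoduleE(1)[OF Vsub] WV UW by (auto simp: F_def)
    then obtain w a where wa: "v = w \<oplus>\<^bsub>X\<^esub> a \<odot>\<^bsub>X\<^esub> x" "w \<in> W" "a \<in> carrier K"
      by (auto simp: V_def)
    have a0: "a \<noteq> \<zero>\<^bsub>K\<^esub>"
    proof
      assume "a = \<zero>\<^bsub>K\<^esub>"
      then have "v = w" using wa x W(1) by auto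
      then show False using v wa UW by auto
    qed
    define c where "c = inv\<^bsub>K\<^esub> a"
    have c: "c \<in> carrier K" "c \<otimes>\<^bsub>K\<^esub> a = \<one>\<^bsub>K\<^esub>" using a0 wa(3) by (auto simp: c_def K.field_Units)
    have wX: "w \<in> carrier X" using wa W(1) by auto
    have "c \<odot>\<^bsub>X\<^esub> v = c \<odot>\<^bsub>X\<^esub> w \<oplus>\<^bsub>X\<^esub> x"
      using wa wX x c by (simp add: X.smult_r_distr flip: X.smult_assoc1)
    then have "x = c \<odot>\<^bsub>X\<^esub> v \<oplus>\<^bsub>X\<^esub> (\<ominus>\<^bsub>X\<^esub> (c \<odot>\<^bsub>X\<^esub> w))"
      using wX x c by (simp add: X.M.a_ac X.M.r_neg)
    moreover have "c \<odot>\<^bsub>X\<^esub> v \<in> U" "\<ominus>\<^bsub>X\<^esub> (c \<odot>\<^bsub>X\<^esub> w) \<in> W" using U(4) W(3,4) v c wa by auto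
    ultimately show ?thesis by blast
  qed
  then show ?thesis using Wsub UW by blast
qed

lemma subspace_projection:
  assumes "field K" "module K X" "submodule U K X"
  obtains e where "e \<in> module_homs K X X" "\<And>x. x \<in> carrier X \<Longrightarrow> e x \<in> U"
    "\<And>u. u \<in> U \<Longrightarrow> e u = u"
proof -
  interpret K: field K by fact
  interpret X: module K X by fact
  obtain W where Wsub: "submodule W K X" and UW: "U \<inter> W = {\<zero>\<^bsub>X\<^esub>}"
    and dec: "\<And>x. x \<in> carrier X \<Longrightarrow> \<exists>u \<in> U. \<exists>w \<in> W. x = u \<oplus>\<^bsub>X\<^esub> w"
    using subspace_complement[OF assms] by blast
  note U = X.submoduleE[OF assms(3)] and W = X.submoduleE[OF Wsub]
  have Uc: "\<And>u. u \<in> U \<Longrightarrow> u \<in> carrier X" and Wc: "\<And>u. u \<in> W \<Longrightarrow> u \<in> carrier X"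
    using U(1) W(1) by auto
  have uniq: "u = u'" if "u \<in> U" "u' \<in> U" "w \<in> W" "w' \<in> W" "u \<oplus>\<^bsub>X\<^esub> w = u' \<oplus>\<^bsub>X\<^esub> w'" for u u' w w'
  proof -
    have c: "u \<in> carrier X" "u' \<in> carrier X" "w \<in> carrier X" "w' \<in> carrier X" using that Uc Wc by auto
    have "u \<ominus>\<^bsub>X\<^esub> u' = (u \<oplus>\<^bsub>X\<^esub> w) \<ominus>\<^bsub>X\<^esub> (u' \<oplus>\<^bsub>X\<^esub> w)"
      using c by algebra
    also have "\<dots> = w' \<ominus>\<^bsub>X\<^esub> w"
      using c unfolding that(5) by algebra
    finally have *: "u \<ominus>\<^bsub>X\<^esub> u' = w' \<ominus>\<^bsub>X\<^esub> w" .
    have "u \<ominus>\<^bsub>X\<^esub> u' \<in> U" "w' \<ominus>\<^bsub>X\<^esub> w \<in> W"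
      using that U(3,5) W(3,5) by (simp_all add: a_minus_def)
    then have "u \<ominus>\<^bsub>X\<^esub> u' \<in> U \<inter> W" using * by simp
    then show ?thesis using UW c by (simp add: X.M.minus_eq_zero_iff)
  qed
  define e where "e = (\<lambda>x \<in> carrier X. SOME u. u \<in> U \<and> (\<exists>w \<in> W. x = u \<oplus>\<^bsub>X\<^esub> w))"
  have e_eq: "e (u \<oplus>\<^bsub>X\<^esub> w) = u" if "u \<in> U" "w \<in> W" for u w
  proof -
    have "u \<oplus>\<^bsub>X\<^esub> w \<in> carrier X" using that Uc Wc by auto
    moreover have "(SOME v. v \<in> U \<and> (\<exists>w' \<in> W. u \<oplus>\<^bsub>X\<^esub> w = v \<oplus>\<^bsub>X\<^esub> w')) = u"
      by (rule some_equality) (use that uniq in blast)+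
    ultimately show ?thesis by (simp add: e_def)
  qed
  have "e \<in> module_homs K X X"
  proof (rule module_homsI)
    fix x assume x: "x \<in> carrier X"
    then obtain u w where uw: "u \<in> U" "w \<in> W" "x = u \<oplus>\<^bsub>X\<^esub> w" using dec by blast
    then show "e x \<in> carrier X" using e_eq Uc by auto
    { fix a assume a: "a \<in> carrier K"
      have "a \<odot>\<^bsub>X\<^esub> x = a \<odot>\<^bsub>X\<^esub> u \<oplus>\<^bsub>X\<^esub> a \<odot>\<^bsub>X\<^esub> w" using uw a Uc Wc by (simp add: X.smult_r_distr)
      then show "e (a \<odot>\<^bsub>X\<^esub> x) = a \<odot>\<^bsub>X\<^esub> e x" using e_eq uw U(4) W(4) a by auto }
    fix y assume y: "y \<in> carrier X"
    then obtain u' w' where uw': "u' \<in> U" "w' \<in> W" "y = u' \<oplus>\<^bsub>X\<^esub> w'" using dec by blast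
    have "x \<oplus>\<^bsub>X\<^esub> y = (u \<oplus>\<^bsub>X\<^esub> u') \<oplus>\<^bsub>X\<^esub> (w \<oplus>\<^bsub>X\<^esub> w')" using uw uw' Uc Wc by (simp add: X.M.a_ac)
    then show "e (x \<oplus>\<^bsub>X\<^esub> y) = e x \<oplus>\<^bsub>X\<^esub> e y" using e_eq uw uw' U(5) W(5) by auto
  qed (simp add: e_def)
  moreover have "e x \<in> U" if "x \<in> carrier X" for x
    using dec[OF that] e_eq by auto
  moreover have "e u = u" if "u \<in> U" for u
    using e_eq[OF that, of "\<zero>\<^bsub>X\<^esub>"] UW that Uc by auto
  ultimately show ?thesis using that by blast
qed

text \<open>
  Linear maps are von Neumann regular: \<open>w\<close> inverts \<open>f\<close> from the image of \<open>f\<close> to a complement of its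
  kernel and vanishes on a complement of the image. The single statement covers sections of
  surjections, retractions of injections, and the projection onto the multiples of the norm element
  below, where \<open>f\<close> is neither injective nor surjective.
\<close>

lemma linear_generalized_inverse:
  assumes "field K" "module K X" "module K Y" "f \<in> module_homs K X Y"
  obtains w where "w \<in> module_homs K Y X" "\<And>x. x \<in> carrier X \<Longrightarrow> f (w (f x)) = f x"
proof -
  interpret X: module K X by fact
  interpret Y: module K Y by fact
  note f [simp] = hom_closed[OF assms(4)] hom_add[OF assms(4)] hom_smult[OF assms(4)]
    hom_zero[OF assms(2-4)] hom_neg[OF assms(2-4)] hom_diff[OF assms(2-4)]
  define U where "U = {x \<in> carrier X. f x = \<zero>\<^bsub>Y\<^esub>}"
  have "submodule U K X" by (rule X.submoduleI) (auto simp: U_def)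
  then obtain e where e: "e \<in> module_homs K X X" "\<And>x. x \<in> carrier X \<Longrightarrow> e x \<in> U"
    "\<And>u. u \<in> U \<Longrightarrow> e u = u"
    by (rule subspace_projection[OF assms(1,2)]) blast
  have "submodule (f ` carrier X) K Y"
  proof (rule Y.submoduleI)
    show "\<zero>\<^bsub>Y\<^esub> \<in> f ` carrier X" by (rule image_eqI[of _ _ "\<zero>\<^bsub>X\<^esub>"]) auto
  next
    fix a assume "a \<in> f ` carrier X"
    then obtain x where x: "a = f x" "x \<in> carrier X" by auto
    then show "\<ominus>\<^bsub>Y\<^esub> a \<in> f ` carrier X" by (auto intro!: image_eqI[of _ _ "\<ominus>\<^bsub>X\<^esub> x"])
    { fix r assume "r \<in> carrier K"
      then show "r \<odot>\<^bsub>Y\<^esub> a \<in> f ` carrier X" using x by (auto intro!: image_eqI[of _ _ "r \<odot>\<^bsub>X\<^esub> x"]) }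
    fix b assume "b \<in> f ` carrier X"
    then obtain y where y: "b = f y" "y \<in> carrier X" by auto
    then show "a \<oplus>\<^bsub>Y\<^esub> b \<in> f ` carrier X" using x by (auto intro!: image_eqI[of _ _ "x \<oplus>\<^bsub>X\<^esub> y"])
  qed auto
  then obtain e' where e': "e' \<in> module_homs K Y Y" "\<And>y. y \<in> carrier Y \<Longrightarrow> e' y \<in> f ` carrier X"
    "\<And>x. x \<in> carrier X \<Longrightarrow> e' (f x) = f x"
    by (rule subspace_projection[OF assms(1,3)]) blast
  have ec: "\<And>x. x \<in> carrier X \<Longrightarrow> e x \<in> carrier X" and fe: "\<And>x. x \<in> carrier X \<Longrightarrow> f (e x) = \<zero>\<^bsub>Y\<^esub>"
    using e(2) by (auto simp: U_def)
  \<comment> \<open>subtracting \<open>e\<close> makes the choice of the preimage irrelevant, hence \<open>w\<close> linear\<close>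
  define g where "g y = (SOME z. z \<in> carrier X \<and> f z = e' y)" for y
  define w where "w = (\<lambda>y \<in> carrier Y. g y \<ominus>\<^bsub>X\<^esub> e (g y))"
  have g: "g y \<in> carrier X" "f (g y) = e' y" if y: "y \<in> carrier Y" for y
  proof -
    obtain z where "z \<in> carrier X" "f z = e' y" using e'(2)[OF y] by force
    then have "g y \<in> carrier X \<and> f (g y) = e' y"
      unfolding g_def by (intro someI[of "\<lambda>z. z \<in> carrier X \<and> f z = e' y"] conjI)
    then show "g y \<in> carrier X" "f (g y) = e' y" by blast+
  qed
  have w_eq: "w y = z \<ominus>\<^bsub>X\<^esub> e z" if "y \<in> carrier Y" "z \<in> carrier X" "f z = e' y" for y z
  proof -
    have "g y \<ominus>\<^bsub>X\<^esub> z \<in> U" using that g[of y]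
      by (auto simp: U_def hom_closed[OF e'(1)] Y.M.minus_eq_zero_iff)
    then have eq: "e (g y) \<ominus>\<^bsub>X\<^esub> e z = g y \<ominus>\<^bsub>X\<^esub> z"
      using e(3) hom_diff[OF assms(2,2) e(1), of "g y" z] that g[of y] by auto
    have swap: "a \<ominus>\<^bsub>X\<^esub> c = b \<ominus>\<^bsub>X\<^esub> d"
      if "c \<ominus>\<^bsub>X\<^esub> d = a \<ominus>\<^bsub>X\<^esub> b" "a \<in> carrier X" "b \<in> carrier X" "c \<in> carrier X" "d \<in> carrier X" for a b c d
    proof -
      have "a \<ominus>\<^bsub>X\<^esub> c = (a \<ominus>\<^bsub>X\<^esub> b) \<oplus>\<^bsub>X\<^esub> b \<ominus>\<^bsub>X\<^esub> c" using that(2-) by algebra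
      also have "\<dots> = (c \<ominus>\<^bsub>X\<^esub> d) \<oplus>\<^bsub>X\<^esub> b \<ominus>\<^bsub>X\<^esub> c" unfolding that(1) ..
      also have "\<dots> = b \<ominus>\<^bsub>X\<^esub> d" using that(2-) by algebra
      finally show ?thesis .
    qed
    have "g y \<ominus>\<^bsub>X\<^esub> e (g y) = z \<ominus>\<^bsub>X\<^esub> e z"
      by (rule swap[OF eq]) (use that g[of y] ec in auto)
    then show ?thesis using that by (simp add: w_def)
  qed
  have "w \<in> module_homs K Y X"
  proof (rule module_homsI)
    fix y assume y: "y \<in> carrier Y"
    show "w y \<in> carrier X" using y g[OF y] ec by (simp add: w_def)
    { fix a assume a: "a \<in> carrier K"
      have "w (a \<odot>\<^bsub>Y\<^esub> y) = (a \<odot>\<^bsub>X\<^esub> g y) \<ominus>\<^bsub>X\<^esub> e (a \<odot>\<^bsub>X\<^esub> g y)"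
        by (rule w_eq) (use a y g[OF y] in \<open>auto simp: hom_smult[OF e'(1)]\<close>)
      also have "\<dots> = a \<odot>\<^bsub>X\<^esub> w y"
        using a y g[OF y] ec
        by (simp add: w_def hom_smult[OF e(1)] a_minus_def X.smult_r_distr X.smult_r_minus)
      finally show "w (a \<odot>\<^bsub>Y\<^esub> y) = a \<odot>\<^bsub>X\<^esub> w y" . }
    fix y' assume y': "y' \<in> carrier Y"
    have "w (y \<oplus>\<^bsub>Y\<^esub> y') = (g y \<oplus>\<^bsub>X\<^esub> g y') \<ominus>\<^bsub>X\<^esub> e (g y \<oplus>\<^bsub>X\<^esub> g y')"
      by (rule w_eq) (use y y' g[OF y] g[OF y'] in \<open>auto simp: hom_add[OF e'(1)]\<close>)
    also have "\<dots> = w y \<oplus>\<^bsub>X\<^esub> w y'"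
      using y y' g[OF y] g[OF y'] ec
      by (simp add: w_def hom_add[OF e(1)] a_minus_def X.M.minus_add X.M.a_ac)
    finally show "w (y \<oplus>\<^bsub>Y\<^esub> y') = w y \<oplus>\<^bsub>X\<^esub> w y'" .
  qed (simp add: w_def)
  moreover have "f (w (f x)) = f x" if "x \<in> carrier X" for x
    using w_eq[of "f x" x] that e'(3)[of x] ec[of x] fe[of x]
    by (simp add: a_minus_def)
  ultimately show ?thesis using that by blast
qed

section \<open>Coinduction\<close>

text \<open>
  The module \<open>Hom_R(S, N)\<close> with the functions encoded in a type \<open>'b\<close>. For the encoding \<open>Fun\<close> it is
  the coinduced module; other encodings allow coinduction from a field to \<open>kC\<close> to stay in the universe
  that is closed under functions on \<open>kG\<close>, in which projectivity is tested.
\<close>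

definition hom_module ::
  "(('s \<Rightarrow> 'a) \<Rightarrow> 'b) \<Rightarrow> ('b \<Rightarrow> 's \<Rightarrow> 'a) \<Rightarrow> ('r, 'z) ring_scheme \<Rightarrow> ('s, 'w) ring_scheme
    \<Rightarrow> ('r \<Rightarrow> 's) \<Rightarrow> ('r, 'a) module \<Rightarrow> ('s, 'b) module"
  where "hom_module enc dec R S \<phi> N =
    \<lparr>carrier = enc ` module_homs R (restrict_scalars \<phi> (regular_module S)) N,
     monoid.mult = undefined, one = undefined,
     zero = enc (\<lambda>a \<in> carrier S. \<zero>\<^bsub>N\<^esub>),
     add = (\<lambda>u v. enc (\<lambda>a \<in> carrier S. dec u a \<oplus>\<^bsub>N\<^esub> dec v a)),
     smult = (\<lambda>b u. enc (\<lambda>a \<in> carrier S. dec u (a \<otimes>\<^bsub>S\<^esub> b)))\<rparr>"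

lemma coinduced_module_eq_hom_module:
  "coinduced_module R S \<phi> N = hom_module Fun app R S \<phi> N"
  by (simp add: coinduced_module_def hom_module_def)

locale coinduction = R: cring R + S: cring S
  for R :: "('r, 'z) ring_scheme" and S :: "('s, 'w) ring_scheme" +
  fixes \<phi> :: "'r \<Rightarrow> 's" and enc :: "('s \<Rightarrow> 'a) \<Rightarrow> 'b" and dec :: "'b \<Rightarrow> 's \<Rightarrow> 'a"
  assumes ring_hom: "\<phi> \<in> ring_hom R S"
    and dec_enc: "g \<in> extensional (carrier S) \<Longrightarrow> dec (enc g) = g"
begin

abbreviation scalars :: "('r, 's) module"
  where "scalars \<equiv> restrict_scalars \<phi> (regular_module S)"

abbreviation coind :: "('r, 'a) module \<Rightarrow> ('s, 'b) module"
  where "coind N \<equiv> hom_module enc dec R S \<phi> N"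

definition transpose ::
  "('s, 'c) module \<Rightarrow> ('c \<Rightarrow> 'a) \<Rightarrow> 'c \<Rightarrow> 'b"
  where "transpose M f = (\<lambda>x \<in> carrier M. enc (\<lambda>a \<in> carrier S. f (a \<odot>\<^bsub>M\<^esub> x)))"

lemma hom_ring_closed [simp]: "r \<in> carrier R \<Longrightarrow> \<phi> r \<in> carrier S"
  using ring_hom by (rule ring_hom_closed)

lemma scalars_module: "module R scalars"
  by (intro restrict_scalars_module[OF ring_hom R.cring_axioms] regular_module_module S.cring_axioms)

lemma dec_enc_hom: "g \<in> module_homs R scalars N \<Longrightarrow> dec (enc g) = g"
  using hom_extensional[of g R scalars N] by (simp add: dec_enc)

lemma coind_closed: "g \<in> module_homs R scalars N \<Longrightarrow> enc g \<in> carrier (coind N)"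
  by (simp add: hom_module_def)

lemma dec_hom: "u \<in> carrier (coind N) \<Longrightarrow> dec u \<in> module_homs R scalars N"
  by (auto simp: hom_module_def dec_enc_hom)

lemma enc_dec: "u \<in> carrier (coind N) \<Longrightarrow> enc (dec u) = u"
  by (auto simp: hom_module_def dec_enc_hom)

lemma dec_closed [simp]: "u \<in> carrier (coind N) \<Longrightarrow> a \<in> carrier S \<Longrightarrow> dec u a \<in> carrier N"
  using hom_closed[OF dec_hom, of u N a] by simp

lemma coind_eqI:
  assumes "u \<in> carrier (coind N)" "v \<in> carrier (coind N)"
    and "\<And>a. a \<in> carrier S \<Longrightarrow> dec u a = dec v a"
  shows "u = v"
proof -
  have "dec u = dec v"
    by (rule hom_eqI[OF dec_hom[OF assms(1)] dec_hom[OF assms(2)]]) (simp add: assms(3))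
  then show ?thesis using enc_dec[OF assms(1)] enc_dec[OF assms(2)] by metis
qed

lemma dec_enc_apply [simp]: "a \<in> carrier S \<Longrightarrow> dec (enc (\<lambda>a \<in> carrier S. g a)) a = g a"
  by (simp add: dec_enc)

lemma dec_add [simp]: "a \<in> carrier S \<Longrightarrow> dec (u \<oplus>\<^bsub>coind N\<^esub> v) a = dec u a \<oplus>\<^bsub>N\<^esub> dec v a"
  and dec_zero [simp]: "a \<in> carrier S \<Longrightarrow> dec \<zero>\<^bsub>coind N\<^esub> a = \<zero>\<^bsub>N\<^esub>"
  and dec_smult [simp]: "a \<in> carrier S \<Longrightarrow> dec (c \<odot>\<^bsub>coind N\<^esub> u) a = dec u (a \<otimes>\<^bsub>S\<^esub> c)"
  by (simp_all add: hom_module_def)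

lemma dec_linear:
  assumes "u \<in> carrier (coind N)" "a \<in> carrier S"
  shows "a' \<in> carrier S \<Longrightarrow> dec u (a \<oplus>\<^bsub>S\<^esub> a') = dec u a \<oplus>\<^bsub>N\<^esub> dec u a'"
    and "r \<in> carrier R \<Longrightarrow> dec u (\<phi> r \<otimes>\<^bsub>S\<^esub> a) = r \<odot>\<^bsub>N\<^esub> dec u a"
  using hom_add[OF dec_hom[OF assms(1)], of a a'] hom_smult[OF dec_hom[OF assms(1)], of r a] assms(2)
  by auto

lemma enc_restrict_closed:
  assumes "\<And>a. a \<in> carrier S \<Longrightarrow> g a \<in> carrier N"
    and "\<And>a a'. a \<in> carrier S \<Longrightarrow> a' \<in> carrier S \<Longrightarrow> g (a \<oplus>\<^bsub>S\<^esub> a') = g a \<oplus>\<^bsub>N\<^esub> g a'"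
    and "\<And>r a. r \<in> carrier R \<Longrightarrow> a \<in> carrier S \<Longrightarrow> g (\<phi> r \<otimes>\<^bsub>S\<^esub> a) = r \<odot>\<^bsub>N\<^esub> g a"
  shows "enc (\<lambda>a \<in> carrier S. g a) \<in> carrier (coind N)"
  using restrict_module_homsI[OF scalars_module, of g N] assms by (simp add: coind_closed)

lemma coind_module:
  assumes N: "module R N"
  shows "module S (coind N)"
proof (rule moduleI)
  interpret N: module R N by fact
  show "cring S" by (rule S.cring_axioms)
  have add: "u \<oplus>\<^bsub>coind N\<^esub> v \<in> carrier (coind N)" if "u \<in> carrier (coind N)" "v \<in> carrier (coind N)" for u v
  proof -
    have "enc (\<lambda>a \<in> carrier S. dec u a \<oplus>\<^bsub>N\<^esub> dec v a) \<in> carrier (coind N)"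
      by (rule enc_restrict_closed)
        (use that in \<open>auto simp: dec_linear N.M.a_ac N.smult_r_distr\<close>)
    then show ?thesis by (simp add: hom_module_def)
  qed
  have zero: "\<zero>\<^bsub>coind N\<^esub> \<in> carrier (coind N)"
  proof -
    have "enc (\<lambda>a \<in> carrier S. \<zero>\<^bsub>N\<^esub>) \<in> carrier (coind N)"
      by (rule enc_restrict_closed) auto
    then show ?thesis by (simp add: hom_module_def)
  qed
  have smult: "c \<odot>\<^bsub>coind N\<^esub> u \<in> carrier (coind N)" if "u \<in> carrier (coind N)" "c \<in> carrier S" for u c
  proof -
    have "enc (\<lambda>a \<in> carrier S. dec u (a \<otimes>\<^bsub>S\<^esub> c)) \<in> carrier (coind N)"
      by (rule enc_restrict_closed)
        (use that in \<open>auto simp: dec_linear S.l_distr S.m_assoc\<close>)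
    then show ?thesis by (simp add: hom_module_def)
  qed
  have neg: "\<exists>v \<in> carrier (coind N). v \<oplus>\<^bsub>coind N\<^esub> u = \<zero>\<^bsub>coind N\<^esub>" if u: "u \<in> carrier (coind N)" for u
  proof
    show v: "enc (\<lambda>a \<in> carrier S. \<ominus>\<^bsub>N\<^esub> dec u a) \<in> carrier (coind N)"
      by (rule enc_restrict_closed)
        (use u in \<open>auto simp: dec_linear N.M.minus_add N.smult_r_minus\<close>)
    show "enc (\<lambda>a \<in> carrier S. \<ominus>\<^bsub>N\<^esub> dec u a) \<oplus>\<^bsub>coind N\<^esub> u = \<zero>\<^bsub>coind N\<^esub>"
      by (rule coind_eqI[OF add[OF v u] zero]) (use u in \<open>auto simp: N.M.l_neg\<close>)
  qed
  show "abelian_group (coind N)"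
  proof (rule abelian_groupI)
    fix x y z assume "x \<in> carrier (coind N)" "y \<in> carrier (coind N)" "z \<in> carrier (coind N)"
    then show "x \<oplus>\<^bsub>coind N\<^esub> y \<oplus>\<^bsub>coind N\<^esub> z = x \<oplus>\<^bsub>coind N\<^esub> (y \<oplus>\<^bsub>coind N\<^esub> z)"
      by (intro coind_eqI[of _ N] add) (auto simp: N.M.a_ac)
  next
    fix x y assume "x \<in> carrier (coind N)" "y \<in> carrier (coind N)"
    then show "x \<oplus>\<^bsub>coind N\<^esub> y = y \<oplus>\<^bsub>coind N\<^esub> x"
      by (intro coind_eqI[of _ N] add) (auto simp: N.M.a_ac)
  next
    fix x assume "x \<in> carrier (coind N)"
    then show "\<zero>\<^bsub>coind N\<^esub> \<oplus>\<^bsub>coind N\<^esub> x = x"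
      by (intro coind_eqI[of _ N] add zero) auto
  qed (fact add zero neg)+
  { fix x assume "x \<in> carrier (coind N)"
    then show "\<one>\<^bsub>S\<^esub> \<odot>\<^bsub>coind N\<^esub> x = x"
      by (intro coind_eqI[of _ N] smult) auto }
  fix x c assume xc: "x \<in> carrier (coind N)" "c \<in> carrier S"
  then show "c \<odot>\<^bsub>coind N\<^esub> x \<in> carrier (coind N)" by (simp add: smult)
  { fix d assume d: "d \<in> carrier S"
    show "(c \<oplus>\<^bsub>S\<^esub> d) \<odot>\<^bsub>coind N\<^esub> x = c \<odot>\<^bsub>coind N\<^esub> x \<oplus>\<^bsub>coind N\<^esub> d \<odot>\<^bsub>coind N\<^esub> x"
      by (rule coind_eqI[of _ N]) (use xc d in \<open>simp_all add: S.r_distr dec_linear add smult\<close>)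
    show "(c \<otimes>\<^bsub>S\<^esub> d) \<odot>\<^bsub>coind N\<^esub> x = c \<odot>\<^bsub>coind N\<^esub> (d \<odot>\<^bsub>coind N\<^esub> x)"
      by (rule coind_eqI[of _ N]) (use xc d in \<open>simp_all add: S.m_assoc smult\<close>) }
  { fix y assume y: "y \<in> carrier (coind N)"
    show "c \<odot>\<^bsub>coind N\<^esub> (x \<oplus>\<^bsub>coind N\<^esub> y) = c \<odot>\<^bsub>coind N\<^esub> x \<oplus>\<^bsub>coind N\<^esub> c \<odot>\<^bsub>coind N\<^esub> y"
      by (rule coind_eqI[of _ N]) (use xc y in \<open>simp_all add: add smult\<close>) }
qed

lemma evaluation_hom:
  assumes "module R N" "a \<in> carrier S"
  shows "(\<lambda>u \<in> carrier (coind N). dec u a) \<in> module_homs R (restrict_scalars \<phi> (coind N)) N"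
proof -
  have M: "module R (restrict_scalars \<phi> (coind N))"
    by (rule restrict_scalars_module[OF ring_hom R.cring_axioms coind_module[OF assms(1)]])
  have "dec u (a \<otimes>\<^bsub>S\<^esub> \<phi> r) = r \<odot>\<^bsub>N\<^esub> dec u a" if "r \<in> carrier R" "u \<in> carrier (coind N)" for r u
    using that assms(2) S.m_comm[OF assms(2) hom_ring_closed[of r]] by (simp add: dec_linear)
  then show ?thesis
    using restrict_module_homsI[OF M, of "\<lambda>u. dec u a" N] assms(2) by simp
qed

lemma dec_finsum:
  assumes "module R N" "a \<in> carrier S" "finite A" "g \<in> A \<rightarrow> carrier (coind N)"
  shows "dec (\<Oplus>\<^bsub>coind N\<^esub> i \<in> A. g i) a = (\<Oplus>\<^bsub>N\<^esub> i \<in> A. dec (g i) a)"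
proof -
  interpret N: module R N by fact
  interpret C: module S "coind N" using coind_module[OF assms(1)] .
  have "(\<lambda>u \<in> carrier (coind N). dec u a) (\<Oplus>\<^bsub>coind N\<^esub> i \<in> A. g i)
      = (\<Oplus>\<^bsub>N\<^esub> i \<in> A. (\<lambda>u \<in> carrier (coind N). dec u a) (g i))"
    using hom_finsum[OF _ assms(1) evaluation_hom[OF assms(1,2)] assms(3), of g]
      restrict_scalars_module[OF ring_hom R.cring_axioms coind_module[OF assms(1)]] assms(4) by simp
  also have "\<dots> = (\<Oplus>\<^bsub>N\<^esub> i \<in> A. dec (g i) a)"
    by (rule N.M.finsum_cong') (use assms in \<open>auto simp: Pi_iff\<close>)
  finally show ?thesis using assms(4) C.M.finsum_closed by simp
qed

lemma dec_transpose [simp]: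
  "x \<in> carrier M \<Longrightarrow> a \<in> carrier S \<Longrightarrow> dec (transpose M f x) a = f (a \<odot>\<^bsub>M\<^esub> x)"
  by (simp add: transpose_def)

lemma transpose_hom:
  assumes M: "module S M" and N: "module R N" and f: "f \<in> module_homs R (restrict_scalars \<phi> M) N"
  shows "transpose M f \<in> module_homs S M (coind N)"
proof -
  interpret M: module S M by fact
  interpret C: module S "coind N" using coind_module[OF N] .
  have fc: "\<And>x. x \<in> carrier M \<Longrightarrow> f x \<in> carrier N"
    "\<And>x y. x \<in> carrier M \<Longrightarrow> y \<in> carrier M \<Longrightarrow> f (x \<oplus>\<^bsub>M\<^esub> y) = f x \<oplus>\<^bsub>N\<^esub> f y"
    "\<And>r x. r \<in> carrier R \<Longrightarrow> x \<in> carrier M \<Longrightarrow> f (\<phi> r \<odot>\<^bsub>M\<^esub> x) = r \<odot>\<^bsub>N\<^esub> f x"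
    using hom_closed[OF f] hom_add[OF f] hom_smult[OF f] by auto
  have cl: "transpose M f x \<in> carrier (coind N)" if x: "x \<in> carrier M" for x
    using enc_restrict_closed[of "\<lambda>a. f (a \<odot>\<^bsub>M\<^esub> x)" N] x fc
    by (simp add: transpose_def M.smult_l_distr M.smult_assoc1)
  show ?thesis
  proof (rule module_homsI)
    fix x y assume "x \<in> carrier M" "y \<in> carrier M"
    then show "transpose M f (x \<oplus>\<^bsub>M\<^esub> y) = transpose M f x \<oplus>\<^bsub>coind N\<^esub> transpose M f y"
      by (intro coind_eqI[of _ N]) (auto simp: cl M.smult_r_distr fc)
  next
    fix c x assume "c \<in> carrier S" "x \<in> carrier M"
    then show "transpose M f (c \<odot>\<^bsub>M\<^esub> x) = c \<odot>\<^bsub>coind N\<^esub> transpose M f x"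
      by (intro coind_eqI[of _ N]) (auto simp: cl M.smult_assoc1 fc)
  qed (use cl in \<open>auto simp: transpose_def\<close>)
qed

end

section \<open>Frobenius algebras and traces\<close>

text \<open>
  A commutative Frobenius algebra: \<open>\<theta>\<close> is the Frobenius form and \<open>b\<close>, \<open>b'\<close> are dual bases for it. In
  the group algebra of a finite abelian group, \<open>\<theta>\<close> is the coefficient at \<open>1\<close> and the dual bases are the
  group elements and their inverses. The pair \<open>enc\<close>, \<open>dec\<close> embeds the functions on \<open>R\<close> with values in
  \<open>'u\<close> into \<open>'u\<close>, so that every module over \<open>R\<close> with elements in \<open>'u\<close> has a cofree hull there.
\<close>

locale frobenius_algebra = K: field K + R: cring R + T: coinduction K R \<iota> enc dec
  for K :: "('k, 'x) ring_scheme" and R :: "('r, 'z) ring_scheme" and \<iota>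
    and enc :: "('r \<Rightarrow> 'u) \<Rightarrow> 'u" and dec +
  fixes \<theta> :: "'r \<Rightarrow> 'k" and I :: "'i set" and b b' :: "'i \<Rightarrow> 'r"
  assumes \<theta>_hom: "\<theta> \<in> module_homs K (restrict_scalars \<iota> (regular_module R)) (regular_module K)"
    and finite_I: "finite I"
    and b_closed: "i \<in> I \<Longrightarrow> b i \<in> carrier R"
    and b'_closed: "i \<in> I \<Longrightarrow> b' i \<in> carrier R"
    and expand_b': "a \<in> carrier R \<Longrightarrow> (\<Oplus>\<^bsub>R\<^esub> i \<in> I. \<iota> (\<theta> (a \<otimes>\<^bsub>R\<^esub> b i)) \<otimes>\<^bsub>R\<^esub> b' i) = a"
    and expand_b: "a \<in> carrier R \<Longrightarrow> (\<Oplus>\<^bsub>R\<^esub> i \<in> I. \<iota> (\<theta> (a \<otimes>\<^bsub>R\<^esub> b' i)) \<otimes>\<^bsub>R\<^esub> b i) = a"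
begin

abbreviation lin :: "('r, 'c) module \<Rightarrow> ('k, 'c) module"
  where "lin M \<equiv> restrict_scalars \<iota> M"

text \<open>
  The generalisation of the transfer \<open>x \<mapsto> (\<Sum>g. g h(g\<inverse> x))\<close> of a linear map along a group.
\<close>

definition trace :: "('r, 'c) module \<Rightarrow> ('r, 'd) module \<Rightarrow> ('c \<Rightarrow> 'd) \<Rightarrow> 'c \<Rightarrow> 'd"
  where "trace M N h = (\<lambda>x \<in> carrier M. \<Oplus>\<^bsub>N\<^esub> i \<in> I. b i \<odot>\<^bsub>N\<^esub> h (b' i \<odot>\<^bsub>M\<^esub> x))"

definition trace_split :: "('r, 'c) module \<Rightarrow> bool"
  where "trace_split M \<longleftrightarrow>
    (\<exists>h \<in> module_homs K (lin M) (lin M). trace M M h = (\<lambda>x \<in> carrier M. x))"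

lemma \<theta>_closed [simp]: "a \<in> carrier R \<Longrightarrow> \<theta> a \<in> carrier K"
  using hom_closed[OF \<theta>_hom, of a] by simp

lemma \<theta>_add: "a \<in> carrier R \<Longrightarrow> c \<in> carrier R \<Longrightarrow> \<theta> (a \<oplus>\<^bsub>R\<^esub> c) = \<theta> a \<oplus>\<^bsub>K\<^esub> \<theta> c"
  using hom_add[OF \<theta>_hom, of a c] by simp

lemma \<theta>_smult: "k \<in> carrier K \<Longrightarrow> a \<in> carrier R \<Longrightarrow> \<theta> (\<iota> k \<otimes>\<^bsub>R\<^esub> a) = k \<otimes>\<^bsub>K\<^esub> \<theta> a"
  using hom_smult[OF \<theta>_hom, of k a] by simp

lemma lin_module: "module R M \<Longrightarrow> module K (lin M)"
  by (rule restrict_scalars_module[OF T.ring_hom K.cring_axioms])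

lemma lin_hom: "f \<in> module_homs R M N \<Longrightarrow> f \<in> module_homs K (lin M) (lin N)"
  by (rule restrict_scalars_hom[OF T.ring_hom])

lemma trace_summand_closed:
  assumes "module R M" "module R N" "h \<in> module_homs K (lin M) (lin N)" "i \<in> I" "x \<in> carrier M"
  shows "b i \<odot>\<^bsub>N\<^esub> h (b' i \<odot>\<^bsub>M\<^esub> x) \<in> carrier N"
proof -
  interpret M: module R M by fact
  interpret N: module R N by fact
  show ?thesis using hom_closed[OF assms(3), of "b' i \<odot>\<^bsub>M\<^esub> x"] assms(4,5) b_closed b'_closed by simp
qed

lemma trace_apply:
  "x \<in> carrier M \<Longrightarrow> trace M N h x = (\<Oplus>\<^bsub>N\<^esub> i \<in> I. b i \<odot>\<^bsub>N\<^esub> h (b' i \<odot>\<^bsub>M\<^esub> x))"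
  by (simp add: trace_def)

text \<open>
  The Casimir element \<open>\<Sum>i. b i \<otimes> b' i\<close> commutes with \<open>R\<close>. Expand \<open>b' i r\<close> in the basis \<open>b'\<close>, exchange
  the two sums, and collect the coefficients of \<open>b j r\<close> in the basis \<open>b\<close>. This is what makes traces
  \<open>R\<close>-linear.
\<close>

lemma casimir:
  fixes N :: "('r, 'c) module"
  assumes "module R N" "r \<in> carrier R"
    and "\<And>a. a \<in> carrier R \<Longrightarrow> H a \<in> carrier N"
    and "\<And>a a'. a \<in> carrier R \<Longrightarrow> a' \<in> carrier R \<Longrightarrow> H (a \<oplus>\<^bsub>R\<^esub> a') = H a \<oplus>\<^bsub>N\<^esub> H a'"
    and "\<And>k a. k \<in> carrier K \<Longrightarrow> a \<in> carrier R \<Longrightarrow> H (\<iota> k \<otimes>\<^bsub>R\<^esub> a) = \<iota> k \<odot>\<^bsub>N\<^esub> H a"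
  shows "(\<Oplus>\<^bsub>N\<^esub> i \<in> I. b i \<odot>\<^bsub>N\<^esub> H (b' i \<otimes>\<^bsub>R\<^esub> r)) = r \<odot>\<^bsub>N\<^esub> (\<Oplus>\<^bsub>N\<^esub> i \<in> I. b i \<odot>\<^bsub>N\<^esub> H (b' i))"
proof -
  interpret N: module R N by fact
  note [simp] = b_closed b'_closed assms(2,3,5) finite_I
  have step: "b i \<odot>\<^bsub>N\<^esub> H (b' i \<otimes>\<^bsub>R\<^esub> r)
      = (\<Oplus>\<^bsub>N\<^esub> j \<in> I. (\<iota> (\<theta> (r \<otimes>\<^bsub>R\<^esub> b j \<otimes>\<^bsub>R\<^esub> b' i)) \<otimes>\<^bsub>R\<^esub> b i) \<odot>\<^bsub>N\<^esub> H (b' j))" if i: "i \<in> I" for i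
  proof -
    have "H (b' i \<otimes>\<^bsub>R\<^esub> r) = H (\<Oplus>\<^bsub>R\<^esub> j \<in> I. \<iota> (\<theta> (b' i \<otimes>\<^bsub>R\<^esub> r \<otimes>\<^bsub>R\<^esub> b j)) \<otimes>\<^bsub>R\<^esub> b' j)"
      using i expand_b'[of "b' i \<otimes>\<^bsub>R\<^esub> r"] by simp
    also have "\<dots> = (\<Oplus>\<^bsub>N\<^esub> j \<in> I. H (\<iota> (\<theta> (b' i \<otimes>\<^bsub>R\<^esub> r \<otimes>\<^bsub>R\<^esub> b j)) \<otimes>\<^bsub>R\<^esub> b' j))"
      by (rule additive_finsum[OF R.abelian_group_axioms N.M.abelian_group_axioms finite_I])
        (use i assms(4) in auto)
    finally have "b i \<odot>\<^bsub>N\<^esub> H (b' i \<otimes>\<^bsub>R\<^esub> r)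
      = b i \<odot>\<^bsub>N\<^esub> (\<Oplus>\<^bsub>N\<^esub> j \<in> I. H (\<iota> (\<theta> (b' i \<otimes>\<^bsub>R\<^esub> r \<otimes>\<^bsub>R\<^esub> b j)) \<otimes>\<^bsub>R\<^esub> b' j))" by simp
    also have "\<dots> = (\<Oplus>\<^bsub>N\<^esub> j \<in> I. b i \<odot>\<^bsub>N\<^esub> H (\<iota> (\<theta> (b' i \<otimes>\<^bsub>R\<^esub> r \<otimes>\<^bsub>R\<^esub> b j)) \<otimes>\<^bsub>R\<^esub> b' j))"
      by (rule N.finsum_smult_ldistr) (use i in auto)
    also have "\<dots> = (\<Oplus>\<^bsub>N\<^esub> j \<in> I. (\<iota> (\<theta> (r \<otimes>\<^bsub>R\<^esub> b j \<otimes>\<^bsub>R\<^esub> b' i)) \<otimes>\<^bsub>R\<^esub> b i) \<odot>\<^bsub>N\<^esub> H (b' j))"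
    proof (rule N.M.finsum_cong')
      fix j assume j: "j \<in> I"
      have t: "b' i \<otimes>\<^bsub>R\<^esub> r \<otimes>\<^bsub>R\<^esub> b j = r \<otimes>\<^bsub>R\<^esub> b j \<otimes>\<^bsub>R\<^esub> b' i" using i j by (simp add: R.m_ac)
      define s where "s = \<theta> (r \<otimes>\<^bsub>R\<^esub> b j \<otimes>\<^bsub>R\<^esub> b' i)"
      have s: "s \<in> carrier K" using i j by (simp add: s_def)
      have "b i \<odot>\<^bsub>N\<^esub> H (\<iota> s \<otimes>\<^bsub>R\<^esub> b' j) = (b i \<otimes>\<^bsub>R\<^esub> \<iota> s) \<odot>\<^bsub>N\<^esub> H (b' j)"
        using i j s by (simp add: N.smult_assoc1)
      also have "b i \<otimes>\<^bsub>R\<^esub> \<iota> s = \<iota> s \<otimes>\<^bsub>R\<^esub> b i" using i s by (simp add: R.m_comm)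
      finally show "b i \<odot>\<^bsub>N\<^esub> H (\<iota> (\<theta> (b' i \<otimes>\<^bsub>R\<^esub> r \<otimes>\<^bsub>R\<^esub> b j)) \<otimes>\<^bsub>R\<^esub> b' j)
        = (\<iota> (\<theta> (r \<otimes>\<^bsub>R\<^esub> b j \<otimes>\<^bsub>R\<^esub> b' i)) \<otimes>\<^bsub>R\<^esub> b i) \<odot>\<^bsub>N\<^esub> H (b' j)"
        unfolding t s_def .
    qed (use i in auto)
    finally show ?thesis .
  qed
  have "(\<Oplus>\<^bsub>N\<^esub> i \<in> I. b i \<odot>\<^bsub>N\<^esub> H (b' i \<otimes>\<^bsub>R\<^esub> r))
    = (\<Oplus>\<^bsub>N\<^esub> i \<in> I. \<Oplus>\<^bsub>N\<^esub> j \<in> I. (\<iota> (\<theta> (r \<otimes>\<^bsub>R\<^esub> b j \<otimes>\<^bsub>R\<^esub> b' i)) \<otimes>\<^bsub>R\<^esub> b i) \<odot>\<^bsub>N\<^esub> H (b' j))"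
    by (rule N.M.finsum_cong') (auto simp: step intro!: N.M.finsum_closed)
  also have "\<dots> = (\<Oplus>\<^bsub>N\<^esub> j \<in> I. \<Oplus>\<^bsub>N\<^esub> i \<in> I. (\<iota> (\<theta> (r \<otimes>\<^bsub>R\<^esub> b j \<otimes>\<^bsub>R\<^esub> b' i)) \<otimes>\<^bsub>R\<^esub> b i) \<odot>\<^bsub>N\<^esub> H (b' j))"
    by (rule N.M.finsum_swap) auto
  also have "\<dots> = (\<Oplus>\<^bsub>N\<^esub> j \<in> I. r \<odot>\<^bsub>N\<^esub> (b j \<odot>\<^bsub>N\<^esub> H (b' j)))"
  proof (rule N.M.finsum_cong')
    fix j assume j: "j \<in> I"
    then have "(\<Oplus>\<^bsub>N\<^esub> i \<in> I. (\<iota> (\<theta> (r \<otimes>\<^bsub>R\<^esub> b j \<otimes>\<^bsub>R\<^esub> b' i)) \<otimes>\<^bsub>R\<^esub> b i) \<odot>\<^bsub>N\<^esub> H (b' j))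
      = (\<Oplus>\<^bsub>R\<^esub> i \<in> I. \<iota> (\<theta> (r \<otimes>\<^bsub>R\<^esub> b j \<otimes>\<^bsub>R\<^esub> b' i)) \<otimes>\<^bsub>R\<^esub> b i) \<odot>\<^bsub>N\<^esub> H (b' j)"
      by (intro N.finsum_smult_rdistr[symmetric]) auto
    also have "\<dots> = r \<odot>\<^bsub>N\<^esub> (b j \<odot>\<^bsub>N\<^esub> H (b' j))"
      using expand_b[of "r \<otimes>\<^bsub>R\<^esub> b j"] j by (simp add: N.smult_assoc1)
    finally show "(\<Oplus>\<^bsub>N\<^esub> i \<in> I. (\<iota> (\<theta> (r \<otimes>\<^bsub>R\<^esub> b j \<otimes>\<^bsub>R\<^esub> b' i)) \<otimes>\<^bsub>R\<^esub> b i) \<odot>\<^bsub>N\<^esub> H (b' j))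
      = r \<odot>\<^bsub>N\<^esub> (b j \<odot>\<^bsub>N\<^esub> H (b' j))" .
  qed auto
  also have "\<dots> = r \<odot>\<^bsub>N\<^esub> (\<Oplus>\<^bsub>N\<^esub> i \<in> I. b i \<odot>\<^bsub>N\<^esub> H (b' i))"
    by (rule N.finsum_smult_ldistr[symmetric]) auto
  finally show ?thesis .
qed

lemma trace_hom:
  assumes "module R M" "module R N" "h \<in> module_homs K (lin M) (lin N)"
  shows "trace M N h \<in> module_homs R M N"
proof -
  interpret M: module R M by fact
  interpret N: module R N by fact
  note [simp] = b_closed b'_closed trace_summand_closed[OF assms] finite_I
  note h = hom_closed[OF assms(3), simplified] hom_add[OF assms(3), simplified] hom_smult[OF assms(3), simplified]
  show ?thesis unfolding trace_def
  proof (rule restrict_module_homsI[OF assms(1)])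
    fix x assume x: "x \<in> carrier M"
    then show "(\<Oplus>\<^bsub>N\<^esub> i \<in> I. b i \<odot>\<^bsub>N\<^esub> h (b' i \<odot>\<^bsub>M\<^esub> x)) \<in> carrier N"
      by (intro N.M.finsum_closed) auto
    { fix r assume r: "r \<in> carrier R"
      have "(\<Oplus>\<^bsub>N\<^esub> i \<in> I. b i \<odot>\<^bsub>N\<^esub> h (b' i \<odot>\<^bsub>M\<^esub> (r \<odot>\<^bsub>M\<^esub> x)))
        = (\<Oplus>\<^bsub>N\<^esub> i \<in> I. b i \<odot>\<^bsub>N\<^esub> h ((b' i \<otimes>\<^bsub>R\<^esub> r) \<odot>\<^bsub>M\<^esub> x))"
        using x r by (intro N.M.finsum_cong') (auto simp: M.smult_assoc1 h)
      also have "\<dots> = r \<odot>\<^bsub>N\<^esub> (\<Oplus>\<^bsub>N\<^esub> i \<in> I. b i \<odot>\<^bsub>N\<^esub> h (b' i \<odot>\<^bsub>M\<^esub> x))"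
        by (rule casimir) (use x r assms(2) in \<open>auto simp: M.smult_assoc1 M.smult_l_distr h\<close>)
      finally show "(\<Oplus>\<^bsub>N\<^esub> i \<in> I. b i \<odot>\<^bsub>N\<^esub> h (b' i \<odot>\<^bsub>M\<^esub> (r \<odot>\<^bsub>M\<^esub> x)))
        = r \<odot>\<^bsub>N\<^esub> (\<Oplus>\<^bsub>N\<^esub> i \<in> I. b i \<odot>\<^bsub>N\<^esub> h (b' i \<odot>\<^bsub>M\<^esub> x))" . }
    fix y assume y: "y \<in> carrier M"
    have "(\<Oplus>\<^bsub>N\<^esub> i \<in> I. b i \<odot>\<^bsub>N\<^esub> h (b' i \<odot>\<^bsub>M\<^esub> (x \<oplus>\<^bsub>M\<^esub> y)))
      = (\<Oplus>\<^bsub>N\<^esub> i \<in> I. b i \<odot>\<^bsub>N\<^esub> h (b' i \<odot>\<^bsub>M\<^esub> x) \<oplus>\<^bsub>N\<^esub> b i \<odot>\<^bsub>N\<^esub> h (b' i \<odot>\<^bsub>M\<^esub> y))"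
      using x y by (intro N.M.finsum_cong') (auto simp: M.smult_r_distr N.smult_r_distr h)
    also have "\<dots> = (\<Oplus>\<^bsub>N\<^esub> i \<in> I. b i \<odot>\<^bsub>N\<^esub> h (b' i \<odot>\<^bsub>M\<^esub> x)) \<oplus>\<^bsub>N\<^esub> (\<Oplus>\<^bsub>N\<^esub> i \<in> I. b i \<odot>\<^bsub>N\<^esub> h (b' i \<odot>\<^bsub>M\<^esub> y))"
      using x y by (intro N.M.finsum_addf) auto
    finally show "(\<Oplus>\<^bsub>N\<^esub> i \<in> I. b i \<odot>\<^bsub>N\<^esub> h (b' i \<odot>\<^bsub>M\<^esub> (x \<oplus>\<^bsub>M\<^esub> y))) = \<dots>" .
  qed
qed

lemma compose_trace:
  assumes "module R M" "module R N" "module R P"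
    and "h \<in> module_homs K (lin M) (lin N)" "f \<in> module_homs R N P"
  shows "compose (carrier M) f (trace M N h) = trace M P (compose (carrier M) f h)"
proof -
  interpret M: module R M by fact
  interpret N: module R N by fact
  interpret P: module R P by fact
  note [simp] = b_closed b'_closed trace_summand_closed[OF assms(1,2,4)] finite_I
  note h = hom_closed[OF assms(4), simplified] hom_closed[OF assms(5)] hom_smult[OF assms(5)]
  show ?thesis
  proof (rule extensionalityI[of _ "carrier M"])
    fix x assume x: "x \<in> carrier M"
    have "f (\<Oplus>\<^bsub>N\<^esub> i \<in> I. b i \<odot>\<^bsub>N\<^esub> h (b' i \<odot>\<^bsub>M\<^esub> x)) = (\<Oplus>\<^bsub>P\<^esub> i \<in> I. f (b i \<odot>\<^bsub>N\<^esub> h (b' i \<odot>\<^bsub>M\<^esub> x)))"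
      by (rule hom_finsum[OF assms(2,3,5) finite_I]) (use x in auto)
    also have "\<dots> = (\<Oplus>\<^bsub>P\<^esub> i \<in> I. b i \<odot>\<^bsub>P\<^esub> compose (carrier M) f h (b' i \<odot>\<^bsub>M\<^esub> x))"
      by (rule P.M.finsum_cong') (use x in \<open>auto simp: h compose_eq\<close>)
    finally show "compose (carrier M) f (trace M N h) x = trace M P (compose (carrier M) f h) x"
      using x by (simp add: compose_eq trace_apply)
  qed (auto simp: compose_def trace_def)
qed

lemma trace_compose:
  assumes "module R L" "module R M" "module R N"
    and "h \<in> module_homs K (lin M) (lin N)" "f \<in> module_homs R L M"
  shows "compose (carrier L) (trace M N h) f = trace L N (compose (carrier L) h f)"
proof -
  interpret L: module R L by fact
  interpret M: module R M by fact
  interpret N: module R N by fact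
  note [simp] = b_closed b'_closed finite_I
  note h = hom_closed[OF assms(4), simplified] hom_closed[OF assms(5)] hom_smult[OF assms(5)]
  show ?thesis
  proof (rule extensionalityI[of _ "carrier L"])
    fix x assume x: "x \<in> carrier L"
    have "(\<Oplus>\<^bsub>N\<^esub> i \<in> I. b i \<odot>\<^bsub>N\<^esub> h (b' i \<odot>\<^bsub>M\<^esub> f x)) = (\<Oplus>\<^bsub>N\<^esub> i \<in> I. b i \<odot>\<^bsub>N\<^esub> compose (carrier L) h f (b' i \<odot>\<^bsub>L\<^esub> x))"
      by (rule N.M.finsum_cong') (use x in \<open>auto simp: h compose_eq\<close>)
    then show "compose (carrier L) (trace M N h) f x = trace L N (compose (carrier L) h f) x"
      using x h by (simp add: compose_eq trace_apply)
  qed (auto simp: compose_def trace_def)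
qed

lemma trace_diff:
  assumes "module R M" "module R N"
    and "h \<in> module_homs K (lin M) (lin N)" "h' \<in> module_homs K (lin M) (lin N)"
  shows "(\<lambda>x \<in> carrier M. trace M N h x \<ominus>\<^bsub>N\<^esub> trace M N h' x)
    = trace M N (\<lambda>x \<in> carrier M. h x \<ominus>\<^bsub>N\<^esub> h' x)" (is "?l = trace M N ?d")
proof -
  interpret M: module R M by fact
  interpret N: module R N by fact
  have d: "?d \<in> module_homs K (lin M) (lin N)"
    using hom_diff_map[OF lin_module[OF assms(1)] lin_module[OF assms(2)] assms(3,4)] by simp
  note cl = hom_closed[OF trace_hom[OF assms(1-2)]]
  note [simp] = b_closed b'_closed trace_summand_closed[OF assms(1-3)] trace_summand_closed[OF assms(1,2,4)]
    trace_summand_closed[OF assms(1,2) d] hom_closed[OF assms(3), simplified] hom_closed[OF assms(4), simplified]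
  show ?thesis
  proof (rule extensionalityI[of _ "carrier M"])
    fix x assume x: "x \<in> carrier M"
    have "trace M N ?d x \<oplus>\<^bsub>N\<^esub> trace M N h' x
      = (\<Oplus>\<^bsub>N\<^esub> i \<in> I. b i \<odot>\<^bsub>N\<^esub> ?d (b' i \<odot>\<^bsub>M\<^esub> x) \<oplus>\<^bsub>N\<^esub> b i \<odot>\<^bsub>N\<^esub> h' (b' i \<odot>\<^bsub>M\<^esub> x))"
      using x by (simp only: trace_apply) (rule N.M.finsum_addf[symmetric], auto)
    also have "\<dots> = trace M N h x"
      unfolding trace_apply[OF x]
    proof (rule N.M.finsum_cong')
      fix i assume i: "i \<in> I"
      define y where "y = b' i \<odot>\<^bsub>M\<^esub> x"
      have y: "y \<in> carrier M" using i x by (simp add: y_def)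
      have "b i \<odot>\<^bsub>N\<^esub> ?d y \<oplus>\<^bsub>N\<^esub> b i \<odot>\<^bsub>N\<^esub> h' y = b i \<odot>\<^bsub>N\<^esub> (?d y \<oplus>\<^bsub>N\<^esub> h' y)"
        using i y by (intro N.smult_r_distr[symmetric]) auto
      also have "?d y \<oplus>\<^bsub>N\<^esub> h' y = h y"
        using y by (simp add: a_minus_def N.M.a_assoc N.M.l_neg)
      finally show "b i \<odot>\<^bsub>N\<^esub> ?d (b' i \<odot>\<^bsub>M\<^esub> x) \<oplus>\<^bsub>N\<^esub> b i \<odot>\<^bsub>N\<^esub> h' (b' i \<odot>\<^bsub>M\<^esub> x) = b i \<odot>\<^bsub>N\<^esub> h (b' i \<odot>\<^bsub>M\<^esub> x)"
        unfolding y_def .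
    qed (use x in auto)
    finally have "trace M N h x = trace M N ?d x \<oplus>\<^bsub>N\<^esub> trace M N h' x" ..
    moreover have "trace M N ?d x \<in> carrier N" "trace M N h' x \<in> carrier N"
      using cl d assms(4) x by auto
    ultimately show "?l x = trace M N ?d x" using x
      by (simp add: a_minus_def N.M.a_assoc N.M.r_neg)
  qed (auto simp: trace_def)
qed

end

section \<open>Projective modules over a Frobenius algebra\<close>

context frobenius_algebra
begin

text \<open>
  If the identity of \<open>P\<close> is the trace of \<open>h\<close> and \<open>w\<close> is a linear section of \<open>q\<close>, then the trace of
  \<open>w f h\<close> lifts \<open>f\<close>, because \<open>q\<close> and \<open>f\<close> can be moved past the trace.
\<close>

lemma trace_split_lift:
  fixes P :: "('r, 'c) module" and A :: "('r, 'd) module" and B :: "('r, 'e) module"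
  assumes P: "module R P" and A: "module R A" and B: "module R B"
    and "trace_split P" and q: "q \<in> module_homs R A B" "q ` carrier A = carrier B"
    and f: "f \<in> module_homs R P B"
  shows "\<exists>g \<in> module_homs R P A. compose (carrier P) q g = f"
proof -
  obtain h where h: "h \<in> module_homs K (lin P) (lin P)" "trace P P h = (\<lambda>x \<in> carrier P. x)"
    using assms(4) by (auto simp: trace_split_def)
  obtain w where w: "w \<in> module_homs K (lin B) (lin A)" "\<And>x. x \<in> carrier A \<Longrightarrow> q (w (q x)) = q x"
    using linear_generalized_inverse[OF K.field_axioms lin_module[OF A] lin_module[OF B] lin_hom[OF q(1)]]
    by auto
  have qw: "q (w y) = y" if "y \<in> carrier B" for y
    using that w(2) unfolding q(2)[symmetric] by auto
  define fh where "fh = compose (carrier P) f h"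
  have fh: "fh \<in> module_homs K (lin P) (lin B)"
    using hom_compose[OF lin_module[OF P] h(1) lin_hom[OF f]] by (simp add: fh_def)
  define k where "k = compose (carrier P) w fh"
  have k: "k \<in> module_homs K (lin P) (lin A)"
    using hom_compose[OF lin_module[OF P] fh w(1)] by (simp add: k_def)
  have "compose (carrier P) q (trace P A k) = trace P B (compose (carrier P) q k)"
    by (rule compose_trace[OF P A B k q(1)])
  also have "compose (carrier P) q k = fh"
    by (rule extensionalityI[of _ "carrier P"])
      (use qw hom_closed[OF fh] in \<open>auto simp: k_def compose_eq\<close>, simp_all add: fh_def compose_def)
  also have "trace P B fh = compose (carrier P) f (trace P P h)"
    unfolding fh_def by (rule compose_trace[OF P P B h(1) f, symmetric])
  also have "\<dots> = f" using h(2) compose_id_right[OF f] by simp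
  finally show ?thesis using trace_hom[OF P A k] by blast
qed

text \<open>
  Dually, if \<open>w\<close> is a linear retraction of \<open>i\<close>, then the trace of \<open>h f w\<close> extends \<open>f\<close>.
\<close>

lemma trace_split_extend:
  fixes P :: "('r, 'c) module" and A :: "('r, 'd) module" and B :: "('r, 'e) module"
  assumes P: "module R P" and A: "module R A" and B: "module R B"
    and "trace_split P" and i: "i \<in> module_homs R A B" "inj_on i (carrier A)"
    and f: "f \<in> module_homs R A P"
  shows "\<exists>g \<in> module_homs R B P. compose (carrier A) g i = f"
proof -
  obtain h where h: "h \<in> module_homs K (lin P) (lin P)" "trace P P h = (\<lambda>x \<in> carrier P. x)"
    using assms(4) by (auto simp: trace_split_def)
  obtain w where w: "w \<in> module_homs K (lin B) (lin A)" "\<And>x. x \<in> carrier A \<Longrightarrow> i (w (i x)) = i x"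
    using linear_generalized_inverse[OF K.field_axioms lin_module[OF A] lin_module[OF B] lin_hom[OF i(1)]]
    by auto
  have wi: "w (i x) = x" if "x \<in> carrier A" for x
    using inj_onD[OF i(2) w(2)] that hom_closed[OF i(1)] hom_closed[OF w(1)] by simp
  define fw where "fw = compose (carrier B) f w"
  have fw: "fw \<in> module_homs K (lin B) (lin P)"
    using hom_compose[OF lin_module[OF B] w(1) lin_hom[OF f]] by (simp add: fw_def)
  define k where "k = compose (carrier B) h fw"
  have k: "k \<in> module_homs K (lin B) (lin P)"
    using hom_compose[OF lin_module[OF B] fw h(1)] by (simp add: k_def)
  have "compose (carrier A) (trace B P k) i = trace A P (compose (carrier A) k i)"
    by (rule trace_compose[OF A B P k i(1)])
  also have "compose (carrier A) k i = compose (carrier A) h f"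
    by (rule extensionalityI[of _ "carrier A"])
      (use wi hom_closed[OF i(1)] in \<open>auto simp: k_def fw_def compose_eq\<close>)
  also have "trace A P (compose (carrier A) h f) = compose (carrier A) (trace P P h) f"
    by (rule trace_compose[OF A P P h(1) f, symmetric])
  also have "\<dots> = f" using h(2) compose_id_left[OF f] by simp
  finally show ?thesis using trace_hom[OF B P k] by blast
qed

lemma trace_split_retract:
  assumes X: "module R X" and P: "module R P" and "trace_split P"
    and s: "s \<in> module_homs R X P" and q: "q \<in> module_homs R P X"
    and qs: "\<And>x. x \<in> carrier X \<Longrightarrow> q (s x) = x"
  shows "trace_split X"
proof -
  obtain h where h: "h \<in> module_homs K (lin P) (lin P)" "trace P P h = (\<lambda>x \<in> carrier P. x)"
    using assms(3) by (auto simp: trace_split_def)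
  define k where "k = compose (carrier X) h s"
  have k: "k \<in> module_homs K (lin X) (lin P)"
    using hom_compose[OF lin_module[OF X] lin_hom[OF s] h(1)] by (simp add: k_def)
  have qk: "compose (carrier X) q k \<in> module_homs K (lin X) (lin X)"
    using hom_compose[OF lin_module[OF X] k lin_hom[OF q]] by simp
  have "trace X X (compose (carrier X) q k) = compose (carrier X) q (trace X P k)"
    by (rule compose_trace[OF X P X k q, symmetric])
  also have "trace X P k = compose (carrier X) (trace P P h) s"
    unfolding k_def by (rule trace_compose[OF X P P h(1) s, symmetric])
  also have "\<dots> = s" using h(2) compose_id_left[OF s] by simp
  also have "compose (carrier X) q s = (\<lambda>x \<in> carrier X. x)"
    by (auto simp: compose_def qs)
  finally show ?thesis using qk by (auto simp: trace_split_def)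
qed

abbreviation cofree :: "('r, 'u) module \<Rightarrow> ('r, 'u) module"
  where "cofree X \<equiv> T.coind (lin X)"

lemma cofree_module: "module R X \<Longrightarrow> module R (cofree X)"
  by (rule T.coind_module[OF lin_module])

text \<open>
  The identity of \<open>Hom_K(R, X)\<close> is the trace of \<open>u \<mapsto> (a \<mapsto> \<theta>(a) u(1))\<close>. This is the expansion
  of \<open>a\<close> in the basis \<open>b'\<close>, with \<open>u\<close> applied to it.
\<close>

lemma trace_split_cofree:
  assumes X: "module R X"
  shows "trace_split (cofree X)"
proof -
  interpret X: module R X by fact
  interpret C: module R "cofree X" using cofree_module[OF X] .
  note [simp] = b_closed b'_closed finite_I T.dec_linear[of _ "lin X", simplified]
  have \<iota>_mult: "\<iota> (k \<otimes>\<^bsub>K\<^esub> k') = \<iota> k \<otimes>\<^bsub>R\<^esub> \<iota> k'" if "k \<in> carrier K" "k' \<in> carrier K" for k k'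
    using ring_hom_mult[OF T.ring_hom] that by blast
  have \<iota>_add: "\<iota> (k \<oplus>\<^bsub>K\<^esub> k') = \<iota> k \<oplus>\<^bsub>R\<^esub> \<iota> k'" if "k \<in> carrier K" "k' \<in> carrier K" for k k'
    using ring_hom_add[OF T.ring_hom] that by blast
  define h where "h = (\<lambda>u \<in> carrier (cofree X). enc (\<lambda>a \<in> carrier R. \<iota> (\<theta> a) \<odot>\<^bsub>X\<^esub> dec u \<one>\<^bsub>R\<^esub>))"
  have hc: "h u \<in> carrier (cofree X)" if "u \<in> carrier (cofree X)" for u
  proof -
    have [simp]: "dec u \<one>\<^bsub>R\<^esub> \<in> carrier X" using T.dec_closed[OF that] by simp
    have "enc (\<lambda>a \<in> carrier R. \<iota> (\<theta> a) \<odot>\<^bsub>X\<^esub> dec u \<one>\<^bsub>R\<^esub>) \<in> carrier (cofree X)"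
      by (rule T.enc_restrict_closed)
        (use that in \<open>simp_all add: \<theta>_add \<theta>_smult \<iota>_add \<iota>_mult X.smult_l_distr X.smult_assoc1\<close>)
    then show ?thesis using that by (simp add: h_def)
  qed
  have dec_h: "dec (h u) a = \<iota> (\<theta> a) \<odot>\<^bsub>X\<^esub> dec u \<one>\<^bsub>R\<^esub>" if "u \<in> carrier (cofree X)" "a \<in> carrier R" for u a
    using that by (simp add: h_def)
  have dc: "dec u a \<in> carrier X" if "u \<in> carrier (cofree X)" "a \<in> carrier R" for u a
    using T.dec_closed[OF that] by simp
  have h: "h \<in> module_homs K (lin (cofree X)) (lin (cofree X))"
  proof (rule module_homsI)
    fix u v assume uv: "u \<in> carrier (lin (cofree X))" "v \<in> carrier (lin (cofree X))"
    show "h (u \<oplus>\<^bsub>lin (cofree X)\<^esub> v) = h u \<oplus>\<^bsub>lin (cofree X)\<^esub> h v"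
    proof (rule T.coind_eqI[of _ "lin X"])
      fix a assume a: "a \<in> carrier R"
      show "dec (h (u \<oplus>\<^bsub>lin (cofree X)\<^esub> v)) a = dec (h u \<oplus>\<^bsub>lin (cofree X)\<^esub> h v) a"
        using uv a by (simp add: dec_h dc X.smult_r_distr)
    qed (use uv hc in \<open>simp_all\<close>)
  next
    fix k u assume k: "k \<in> carrier K" and u: "u \<in> carrier (lin (cofree X))"
    show "h (k \<odot>\<^bsub>lin (cofree X)\<^esub> u) = k \<odot>\<^bsub>lin (cofree X)\<^esub> h u"
    proof (rule T.coind_eqI[of _ "lin X"])
      fix a assume a: "a \<in> carrier R"
      have "dec u (\<iota> k) = dec u (\<iota> k \<otimes>\<^bsub>R\<^esub> \<one>\<^bsub>R\<^esub>)" using k by simp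
      also have "\<dots> = \<iota> k \<odot>\<^bsub>X\<^esub> dec u \<one>\<^bsub>R\<^esub>"
        using T.dec_linear(2)[of u "lin X" "\<one>\<^bsub>R\<^esub>" k] u k by simp
      finally have "dec (h (k \<odot>\<^bsub>lin (cofree X)\<^esub> u)) a = (\<iota> (\<theta> a) \<otimes>\<^bsub>R\<^esub> \<iota> k) \<odot>\<^bsub>X\<^esub> dec u \<one>\<^bsub>R\<^esub>"
        using u k a by (simp add: dec_h dc X.smult_assoc1)
      also have "\<iota> (\<theta> a) \<otimes>\<^bsub>R\<^esub> \<iota> k = \<iota> (\<theta> (a \<otimes>\<^bsub>R\<^esub> \<iota> k))"
        using a k by (simp add: \<theta>_smult R.m_comm[of a] R.m_comm[of "\<iota> (\<theta> a)"] \<iota>_mult)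
      finally show "dec (h (k \<odot>\<^bsub>lin (cofree X)\<^esub> u)) a = dec (k \<odot>\<^bsub>lin (cofree X)\<^esub> h u) a"
        using u k a by (simp add: dec_h)
    qed (use k u hc in auto)
  qed (use hc in \<open>auto simp: h_def\<close>)
  have "trace (cofree X) (cofree X) h = (\<lambda>u \<in> carrier (cofree X). u)"
  proof (rule extensionalityI[of _ "carrier (cofree X)"])
    fix u assume u: "u \<in> carrier (cofree X)"
    have cl: "(\<lambda>i. b i \<odot>\<^bsub>cofree X\<^esub> h (b' i \<odot>\<^bsub>cofree X\<^esub> u)) \<in> I \<rightarrow> carrier (cofree X)"
      using u hc by auto
    have "(\<Oplus>\<^bsub>cofree X\<^esub> i \<in> I. b i \<odot>\<^bsub>cofree X\<^esub> h (b' i \<odot>\<^bsub>cofree X\<^esub> u)) = u"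
    proof (rule T.coind_eqI[of _ "lin X"])
      fix a assume a: "a \<in> carrier R"
      have "dec (\<Oplus>\<^bsub>cofree X\<^esub> i \<in> I. b i \<odot>\<^bsub>cofree X\<^esub> h (b' i \<odot>\<^bsub>cofree X\<^esub> u)) a
          = (\<Oplus>\<^bsub>X\<^esub> i \<in> I. dec (b i \<odot>\<^bsub>cofree X\<^esub> h (b' i \<odot>\<^bsub>cofree X\<^esub> u)) a)"
        using T.dec_finsum[OF lin_module[OF X] a finite_I cl] by simp
      also have "\<dots> = (\<Oplus>\<^bsub>X\<^esub> i \<in> I. dec u (\<iota> (\<theta> (a \<otimes>\<^bsub>R\<^esub> b i)) \<otimes>\<^bsub>R\<^esub> b' i))"
        by (rule X.M.finsum_cong') (use u a in \<open>auto simp: dec_h dc\<close>)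
      also have "\<dots> = dec u (\<Oplus>\<^bsub>R\<^esub> i \<in> I. \<iota> (\<theta> (a \<otimes>\<^bsub>R\<^esub> b i)) \<otimes>\<^bsub>R\<^esub> b' i)"
        by (rule additive_finsum[OF R.abelian_group_axioms X.M.abelian_group_axioms finite_I, symmetric])
          (use u a in \<open>auto simp: dc\<close>)
      also have "\<dots> = dec u a" using expand_b'[OF a] by simp
      finally show "dec (\<Oplus>\<^bsub>cofree X\<^esub> i \<in> I. b i \<odot>\<^bsub>cofree X\<^esub> h (b' i \<odot>\<^bsub>cofree X\<^esub> u)) a = dec u a" .
    qed (use u cl in \<open>auto intro!: C.M.finsum_closed\<close>)
    then show "trace (cofree X) (cofree X) h u = (\<lambda>u \<in> carrier (cofree X). u) u"
      using u by (simp add: trace_apply)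
  qed (auto simp: trace_def)
  then show ?thesis using h by (auto simp: trace_split_def)
qed

definition cofree_cover :: "('r, 'u) module \<Rightarrow> 'u \<Rightarrow> 'u"
  where "cofree_cover X = (\<lambda>u \<in> carrier (cofree X). \<Oplus>\<^bsub>X\<^esub> i \<in> I. b i \<odot>\<^bsub>X\<^esub> dec u (b' i))"

lemma cofree_cover_hom:
  assumes X: "module R X"
  shows "cofree_cover X \<in> module_homs R (cofree X) X"
proof -
  interpret X: module R X by fact
  have dc: "dec u a \<in> carrier X" if "u \<in> carrier (cofree X)" "a \<in> carrier R" for u a
    using T.dec_closed[OF that] by simp
  note [simp] = b_closed b'_closed finite_I T.dec_linear[of _ "lin X", simplified] dc
  show ?thesis unfolding cofree_cover_def
  proof (rule restrict_module_homsI[OF cofree_module[OF X]])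
    fix u assume u: "u \<in> carrier (cofree X)"
    show "(\<Oplus>\<^bsub>X\<^esub> i \<in> I. b i \<odot>\<^bsub>X\<^esub> dec u (b' i)) \<in> carrier X"
      using u by (intro X.M.finsum_closed) auto
    { fix r assume r: "r \<in> carrier R"
      have "(\<Oplus>\<^bsub>X\<^esub> i \<in> I. b i \<odot>\<^bsub>X\<^esub> dec (r \<odot>\<^bsub>cofree X\<^esub> u) (b' i)) = (\<Oplus>\<^bsub>X\<^esub> i \<in> I. b i \<odot>\<^bsub>X\<^esub> dec u (b' i \<otimes>\<^bsub>R\<^esub> r))"
        using u r by (intro X.M.finsum_cong') auto
      also have "\<dots> = r \<odot>\<^bsub>X\<^esub> (\<Oplus>\<^bsub>X\<^esub> i \<in> I. b i \<odot>\<^bsub>X\<^esub> dec u (b' i))"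
        by (rule casimir[OF X r]) (use u in auto)
      finally show "(\<Oplus>\<^bsub>X\<^esub> i \<in> I. b i \<odot>\<^bsub>X\<^esub> dec (r \<odot>\<^bsub>cofree X\<^esub> u) (b' i)) = \<dots>" . }
    fix v assume v: "v \<in> carrier (cofree X)"
    have "(\<Oplus>\<^bsub>X\<^esub> i \<in> I. b i \<odot>\<^bsub>X\<^esub> dec (u \<oplus>\<^bsub>cofree X\<^esub> v) (b' i))
      = (\<Oplus>\<^bsub>X\<^esub> i \<in> I. b i \<odot>\<^bsub>X\<^esub> dec u (b' i) \<oplus>\<^bsub>X\<^esub> b i \<odot>\<^bsub>X\<^esub> dec v (b' i))"
      using u v by (intro X.M.finsum_cong') (auto simp: X.smult_r_distr)
    also have "\<dots> = (\<Oplus>\<^bsub>X\<^esub> i \<in> I. b i \<odot>\<^bsub>X\<^esub> dec u (b' i)) \<oplus>\<^bsub>X\<^esub> (\<Oplus>\<^bsub>X\<^esub> i \<in> I. b i \<odot>\<^bsub>X\<^esub> dec v (b' i))"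
      using u v by (intro X.M.finsum_addf) auto
    finally show "(\<Oplus>\<^bsub>X\<^esub> i \<in> I. b i \<odot>\<^bsub>X\<^esub> dec (u \<oplus>\<^bsub>cofree X\<^esub> v) (b' i)) = \<dots>" .
  qed
qed

text \<open>
  Every trace factors through a cofree module.
\<close>

lemma cofree_cover_transpose:
  assumes M: "module R M" and N: "module R N" and h: "h \<in> module_homs K (lin M) (lin N)"
  shows "compose (carrier M) (cofree_cover N) (T.transpose M h) = trace M N h"
proof (rule extensionalityI[of _ "carrier M"])
  interpret M: module R M by fact
  interpret N: module R N by fact
  fix x assume x: "x \<in> carrier M"
  have "T.transpose M h x \<in> carrier (cofree N)"
    using hom_closed[OF T.transpose_hom[OF M lin_module[OF N] h] x] .
  moreover have "(\<Oplus>\<^bsub>N\<^esub> i \<in> I. b i \<odot>\<^bsub>N\<^esub> dec (T.transpose M h x) (b' i)) = (\<Oplus>\<^bsub>N\<^esub> i \<in> I. b i \<odot>\<^bsub>N\<^esub> h (b' i \<odot>\<^bsub>M\<^esub> x))"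
    by (rule N.M.finsum_cong')
      (use x b'_closed trace_summand_closed[OF M N h] in auto)
  ultimately show "compose (carrier M) (cofree_cover N) (T.transpose M h) x = trace M N h x"
    using x by (simp add: compose_eq cofree_cover_def trace_apply)
qed (auto simp: trace_def)

text \<open>
  The preimage of \<open>x\<close> is \<open>a \<mapsto> \<theta>(a) x\<close>, by the expansion of \<open>1\<close> in the basis \<open>b\<close>.
\<close>

lemma cofree_cover_surj:
  assumes X: "module R X"
  shows "cofree_cover X ` carrier (cofree X) = carrier X"
proof (intro equalityI subsetI)
  interpret X: module R X by fact
  note [simp] = b_closed b'_closed finite_I
  have \<iota>_mult: "\<iota> (k \<otimes>\<^bsub>K\<^esub> k') = \<iota> k \<otimes>\<^bsub>R\<^esub> \<iota> k'" if "k \<in> carrier K" "k' \<in> carrier K" for k k'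
    using ring_hom_mult[OF T.ring_hom] that by blast
  have \<iota>_add: "\<iota> (k \<oplus>\<^bsub>K\<^esub> k') = \<iota> k \<oplus>\<^bsub>R\<^esub> \<iota> k'" if "k \<in> carrier K" "k' \<in> carrier K" for k k'
    using ring_hom_add[OF T.ring_hom] that by blast
  fix x assume x: "x \<in> carrier X"
  define u where "u = enc (\<lambda>a \<in> carrier R. \<iota> (\<theta> a) \<odot>\<^bsub>X\<^esub> x)"
  have u: "u \<in> carrier (cofree X)" unfolding u_def
    by (rule T.enc_restrict_closed)
      (use x in \<open>simp_all add: \<theta>_add \<theta>_smult \<iota>_add \<iota>_mult X.smult_l_distr X.smult_assoc1\<close>)
  have "(\<Oplus>\<^bsub>X\<^esub> i \<in> I. b i \<odot>\<^bsub>X\<^esub> dec u (b' i))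
    = (\<Oplus>\<^bsub>X\<^esub> i \<in> I. (\<iota> (\<theta> (\<one>\<^bsub>R\<^esub> \<otimes>\<^bsub>R\<^esub> b' i)) \<otimes>\<^bsub>R\<^esub> b i) \<odot>\<^bsub>X\<^esub> x)"
    by (rule X.M.finsum_cong') (use x in \<open>auto simp: u_def R.m_comm simp flip: X.smult_assoc1\<close>)
  also have "\<dots> = (\<Oplus>\<^bsub>R\<^esub> i \<in> I. \<iota> (\<theta> (\<one>\<^bsub>R\<^esub> \<otimes>\<^bsub>R\<^esub> b' i)) \<otimes>\<^bsub>R\<^esub> b i) \<odot>\<^bsub>X\<^esub> x"
    by (rule X.finsum_smult_rdistr[symmetric]) (use x in auto)
  also have "\<dots> = x" using x expand_b[OF R.one_closed] by simp
  finally show "x \<in> cofree_cover X ` carrier (cofree X)"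
    using u by (intro image_eqI[of _ _ u]) (simp_all add: cofree_cover_def)
qed (use hom_closed[OF cofree_cover_hom[OF X]] in auto)

text \<open>
  Higman's criterion. A projective module is a retract of its cofree cover, whose identity is a trace.
\<close>

lemma projective_iff_trace_split:
  fixes P :: "('r, 'u) module"
  assumes P: "module R P"
  shows "projective_module R P \<longleftrightarrow> trace_split P"
proof
  assume "projective_module R P"
  then obtain g where g: "g \<in> module_homs R P (cofree P)"
    "compose (carrier P) (cofree_cover P) g = (\<lambda>x \<in> carrier P. x)"
    using cofree_cover_hom[OF P] cofree_cover_surj[OF P] cofree_module[OF P] P hom_id[OF P]
    unfolding projective_module_def by blast
  have "cofree_cover P (g x) = x" if "x \<in> carrier P" for x
    using fun_cong[OF g(2), of x] that by (simp add: compose_eq)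
  then show "trace_split P"
    using trace_split_retract[OF P cofree_module[OF P] trace_split_cofree[OF P] g(1) cofree_cover_hom[OF P]]
    by blast
next
  assume "trace_split P"
  then show "projective_module R P"
    using trace_split_lift[OF P] P unfolding projective_module_def by blast
qed

text \<open>
  A module with the extension property of an injective one is a retract of its cofree hull.
\<close>

lemma extension_property_imp_trace_split:
  assumes X: "module R X"
    and ext: "\<And>i. i \<in> module_homs R X (cofree X) \<Longrightarrow> inj_on i (carrier X)
      \<Longrightarrow> \<exists>g \<in> module_homs R (cofree X) X. compose (carrier X) g i = (\<lambda>x \<in> carrier X. x)"
  shows "trace_split X"
proof -
  interpret X: module R X by fact
  let ?i = "T.transpose X (\<lambda>x \<in> carrier X. x)"
  have i: "?i \<in> module_homs R X (cofree X)"
    by (rule T.transpose_hom[OF X lin_module[OF X] lin_hom[OF hom_id[OF X]]])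
  have "dec (?i x) \<one>\<^bsub>R\<^esub> = x" if "x \<in> carrier X" for x
    using that by simp
  then have "inj_on ?i (carrier X)" by (metis inj_onI)
  then obtain g where g: "g \<in> module_homs R (cofree X) X" "compose (carrier X) g ?i = (\<lambda>x \<in> carrier X. x)"
    using ext i by blast
  have "g (?i x) = x" if "x \<in> carrier X" for x
    using fun_cong[OF g(2), of x] that by (simp add: compose_eq)
  then show ?thesis
    using trace_split_retract[OF X cofree_module[OF X] trace_split_cofree[OF X] i g(1)] by blast
qed

text \<open>
  A map \<open>q \<circ> i\<close> through a projective \<open>P\<close> is the trace of \<open>q h i\<close>, when the identity of \<open>P\<close> is the trace
  of \<open>h\<close>; a trace factors through a cofree module, which is projective. As traces are additive in the
  linear map, the maps of this kind form a subgroup.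
\<close>

lemma factors_through_projective_iff_trace:
  fixes M N :: "('r, 'u) module"
  assumes M: "module R M" and N: "module R N"
  shows "factors_through_projective R M N f \<longleftrightarrow> (\<exists>h \<in> module_homs K (lin M) (lin N). f = trace M N h)"
proof
  assume "factors_through_projective R M N f"
  then obtain P :: "('r, 'u) module" and i q where P: "projective_module R P" and i: "i \<in> module_homs R M P"
    and q: "q \<in> module_homs R P N" and f: "f = compose (carrier M) q i"
    unfolding factors_through_projective_def by blast
  have PM: "module R P" using P by (simp add: projective_module_def)
  obtain h where h: "h \<in> module_homs K (lin P) (lin P)" "trace P P h = (\<lambda>x \<in> carrier P. x)"
    using P projective_iff_trace_split[OF PM] by (auto simp: trace_split_def)
  define k where "k = compose (carrier M) h i"
  have k: "k \<in> module_homs K (lin M) (lin P)"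
    using hom_compose[OF lin_module[OF M] lin_hom[OF i] h(1)] by (simp add: k_def)
  have "trace M P k = i"
    using trace_compose[OF M PM PM h(1) i] h(2) compose_id_left[OF i] by (simp add: k_def)
  then have "f = trace M N (compose (carrier M) q k)"
    using compose_trace[OF M PM N k q] f by simp
  moreover have "compose (carrier M) q k \<in> module_homs K (lin M) (lin N)"
    using hom_compose[OF lin_module[OF M] k lin_hom[OF q]] by simp
  ultimately show "\<exists>h \<in> module_homs K (lin M) (lin N). f = trace M N h" by blast
next
  assume "\<exists>h \<in> module_homs K (lin M) (lin N). f = trace M N h"
  then obtain h where h: "h \<in> module_homs K (lin M) (lin N)" "f = trace M N h" by blast
  have "projective_module R (cofree N)"
    using projective_iff_trace_split[OF cofree_module[OF N]] trace_split_cofree[OF N] by blast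
  then show "factors_through_projective R M N f"
    using T.transpose_hom[OF M lin_module[OF N] h(1)] cofree_cover_hom[OF N]
      cofree_cover_transpose[OF M N h(1)] h(2)
    unfolding factors_through_projective_def by metis
qed

lemma factors_through_projective_zero:
  fixes M N :: "('r, 'u) module"
  assumes M: "module R M" and N: "module R N"
  shows "factors_through_projective R M N (\<lambda>x \<in> carrier M. \<zero>\<^bsub>N\<^esub>)"
proof -
  interpret M: module R M by fact
  interpret N: module R N by fact
  have "trace M N (\<lambda>x \<in> carrier M. \<zero>\<^bsub>N\<^esub>) = (\<lambda>x \<in> carrier M. \<zero>\<^bsub>N\<^esub>)"
    unfolding trace_def
    by (rule restrict_ext) (use b_closed b'_closed in \<open>auto intro!: N.M.add.finprod_one_eqI\<close>)
  moreover have "(\<lambda>x \<in> carrier M. \<zero>\<^bsub>N\<^esub>) \<in> module_homs K (lin M) (lin N)"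
    using hom_zero_map[OF lin_module[OF M] lin_module[OF N]] by simp
  ultimately show ?thesis using factors_through_projective_iff_trace[OF M N] by metis
qed

lemma factors_through_projective_diff:
  fixes M N :: "('r, 'u) module"
  assumes M: "module R M" and N: "module R N"
    and "factors_through_projective R M N f" "factors_through_projective R M N g"
  shows "factors_through_projective R M N (\<lambda>x \<in> carrier M. f x \<ominus>\<^bsub>N\<^esub> g x)"
proof -
  obtain h k where h: "h \<in> module_homs K (lin M) (lin N)" "f = trace M N h"
    and k: "k \<in> module_homs K (lin M) (lin N)" "g = trace M N k"
    using assms(3,4) unfolding factors_through_projective_iff_trace[OF M N] by blast
  have "(\<lambda>x \<in> carrier M. h x \<ominus>\<^bsub>N\<^esub> k x) \<in> module_homs K (lin M) (lin N)"
    using hom_diff_map[OF lin_module[OF M] lin_module[OF N] h(1) k(1)] by simp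
  then show ?thesis
    using trace_diff[OF M N h(1) k(1)] h(2) k(2) factors_through_projective_iff_trace[OF M N] by metis
qed

end

section \<open>Stable module categories\<close>

text \<open>
  The two assumptions make the maps that factor through a projective an ideal. They concern the
  element type \<open>'u\<close>, which has to contain the projectives needed to add two such maps.
\<close>

locale stable_module_category = R: cring R
  for R :: "('r, 'z) ring_scheme" and U :: "'u itself" +
  assumes null_zero: "\<And>M N :: ('r, 'u) module. module R M \<Longrightarrow> module R N
      \<Longrightarrow> factors_through_projective R M N (\<lambda>x \<in> carrier M. \<zero>\<^bsub>N\<^esub>)"
    and null_diff: "\<And>(M :: ('r, 'u) module) (N :: ('r, 'u) module) f g. module R M \<Longrightarrow> module R N
      \<Longrightarrow> factors_through_projective R M N f \<Longrightarrow> factors_through_projective R M N g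
      \<Longrightarrow> factors_through_projective R M N (\<lambda>x \<in> carrier M. f x \<ominus>\<^bsub>N\<^esub> g x)"
begin

definition stably_equal :: "('r, 'u) module \<Rightarrow> ('r, 'u) module \<Rightarrow> ('u \<Rightarrow> 'u) \<Rightarrow> ('u \<Rightarrow> 'u) \<Rightarrow> bool"
  where "stably_equal M N f g \<longleftrightarrow> factors_through_projective R M N (\<lambda>x \<in> carrier M. f x \<ominus>\<^bsub>N\<^esub> g x)"

lemma null_compose_left:
  fixes M N :: "('r, 'u) module"
  assumes "factors_through_projective R M N f" "g \<in> module_homs R N L"
  shows "factors_through_projective R M L (compose (carrier M) g f)"
proof -
  obtain P :: "('r, 'u) module" and i q where P: "projective_module R P" and i: "i \<in> module_homs R M P"
    and q: "q \<in> module_homs R P N" and f: "f = compose (carrier M) q i"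
    using assms(1) unfolding factors_through_projective_def by blast
  have "compose (carrier P) g q \<in> module_homs R P L"
    using P q assms(2) by (intro hom_compose) (auto simp: projective_module_def)
  moreover have "compose (carrier M) g f = compose (carrier M) (compose (carrier P) g q) i"
    unfolding f by (rule module_compose_assoc[OF i])
  ultimately show ?thesis using P i unfolding factors_through_projective_def by blast
qed

lemma null_compose_right:
  fixes M N :: "('r, 'u) module"
  assumes "module R L" "factors_through_projective R M N f" "g \<in> module_homs R L M"
  shows "factors_through_projective R L N (compose (carrier L) f g)"
proof -
  obtain P :: "('r, 'u) module" and i q where P: "projective_module R P" and i: "i \<in> module_homs R M P"
    and q: "q \<in> module_homs R P N" and f: "f = compose (carrier M) q i"
    using assms(2) unfolding factors_through_projective_def by blast
  have "compose (carrier L) i g \<in> module_homs R L P"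
    using i assms by (intro hom_compose) auto
  moreover have "compose (carrier L) f g = compose (carrier L) q (compose (carrier L) i g)"
    unfolding f by (rule module_compose_assoc[OF assms(3), symmetric])
  ultimately show ?thesis using P q unfolding factors_through_projective_def by blast
qed

lemma stably_equal_refl:
  assumes "module R M" "module R N" "f \<in> module_homs R M N"
  shows "stably_equal M N f f"
proof -
  interpret N: module R N by fact
  have "(\<lambda>x \<in> carrier M. f x \<ominus>\<^bsub>N\<^esub> f x) = (\<lambda>x \<in> carrier M. \<zero>\<^bsub>N\<^esub>)"
    using hom_closed[OF assms(3)] by (auto simp: N.M.minus_eq_zero_iff intro!: restrict_ext)
  then show ?thesis using null_zero[OF assms(1,2)] by (simp add: stably_equal_def)
qed

lemma stably_equal_euclid:
  assumes "module R M" "module R N" "f \<in> module_homs R M N" "g \<in> module_homs R M N" "h \<in> module_homs R M N"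
    and "stably_equal M N f h" "stably_equal M N g h"
  shows "stably_equal M N f g"
proof -
  interpret N: module R N by fact
  have "(\<lambda>x \<in> carrier M. (\<lambda>x \<in> carrier M. f x \<ominus>\<^bsub>N\<^esub> h x) x \<ominus>\<^bsub>N\<^esub> (\<lambda>x \<in> carrier M. g x \<ominus>\<^bsub>N\<^esub> h x) x)
    = (\<lambda>x \<in> carrier M. f x \<ominus>\<^bsub>N\<^esub> g x)"
  proof (rule restrict_ext)
    fix x assume x: "x \<in> carrier M"
    have "f x \<in> carrier N" "g x \<in> carrier N" "h x \<in> carrier N"
      using assms(3-5) x by (simp_all add: hom_closed)
    then have "(f x \<ominus>\<^bsub>N\<^esub> h x) \<ominus>\<^bsub>N\<^esub> (g x \<ominus>\<^bsub>N\<^esub> h x) = f x \<ominus>\<^bsub>N\<^esub> g x" by algebra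
    then show "(\<lambda>x \<in> carrier M. f x \<ominus>\<^bsub>N\<^esub> h x) x \<ominus>\<^bsub>N\<^esub> (\<lambda>x \<in> carrier M. g x \<ominus>\<^bsub>N\<^esub> h x) x = f x \<ominus>\<^bsub>N\<^esub> g x"
      using x by simp
  qed
  then show ?thesis
    using null_diff[OF assms(1,2) assms(6,7)[unfolded stably_equal_def]] by (simp add: stably_equal_def)
qed

lemma stably_equal_sym:
  assumes "module R M" "module R N" "f \<in> module_homs R M N" "g \<in> module_homs R M N"
    and "stably_equal M N f g"
  shows "stably_equal M N g f"
  using stably_equal_euclid[OF assms(1,2,4,3,4) stably_equal_refl[OF assms(1,2,4)] assms(5)] .

lemma stable_class_eq_iff:
  assumes "module R M" "module R N" "f \<in> module_homs R M N" "g \<in> module_homs R M N"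
  shows "stable_class R M N f = stable_class R M N g \<longleftrightarrow> stably_equal M N f g"
proof
  assume "stable_class R M N f = stable_class R M N g"
  moreover have "g \<in> stable_class R M N g"
    using stably_equal_refl[OF assms(1,2,4)] assms(4) by (simp add: stable_class_def stably_equal_def)
  ultimately have "g \<in> stable_class R M N f" by simp
  then show "stably_equal M N f g" by (simp add: stable_class_def stably_equal_def)
next
  assume fg: "stably_equal M N f g"
  note gf = stably_equal_sym[OF assms fg]
  have "stably_equal M N f h \<longleftrightarrow> stably_equal M N g h" if h: "h \<in> module_homs R M N" for h
  proof
    assume "stably_equal M N f h"
    then have hf: "stably_equal M N h f" using stably_equal_sym assms h by blast
    show "stably_equal M N g h" using stably_equal_euclid[OF assms(1,2,4) h assms(3) gf hf] .
  next
    assume "stably_equal M N g h"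
    then have hg: "stably_equal M N h g" using stably_equal_sym assms h by blast
    show "stably_equal M N f h" using stably_equal_euclid[OF assms(1,2,3) h assms(4) fg hg] .
  qed
  then show "stable_class R M N f = stable_class R M N g"
    by (auto simp: stable_class_def stably_equal_def)
qed

text \<open>
  Compositions and functors on stable categories are defined as unions over representatives; this
  evaluates them.
\<close>

lemma UN_stable_class:
  assumes "module R M" "module R N" "f \<in> module_homs R M N"
    and "\<And>g. g \<in> module_homs R M N \<Longrightarrow> stably_equal M N f g \<Longrightarrow> F g = F f"
  shows "(\<Union>g \<in> stable_class R M N f. F g) = F f"
proof -
  have "f \<in> stable_class R M N f"
    using stably_equal_refl[OF assms(1-3)] assms(3) by (simp add: stable_class_def stably_equal_def)
  moreover have "F g = F f" if "g \<in> stable_class R M N f" for g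
    using assms(4) that by (simp add: stable_class_def stably_equal_def)
  ultimately show ?thesis by blast
qed

lemma stably_equal_compose:
  assumes M: "module R M" and N: "module R N" and P: "module R P"
    and f: "f \<in> module_homs R M N" "f' \<in> module_homs R M N" "stably_equal M N f f'"
    and g: "g \<in> module_homs R N P" "g' \<in> module_homs R N P" "stably_equal N P g g'"
  shows "stably_equal M P (compose (carrier M) g f) (compose (carrier M) g' f')"
proof -
  interpret P: module R P by fact
  note c = hom_compose[OF M]
  have "compose (carrier M) (\<lambda>x \<in> carrier N. g x \<ominus>\<^bsub>P\<^esub> g' x) f
    = (\<lambda>x \<in> carrier M. compose (carrier M) g f x \<ominus>\<^bsub>P\<^esub> compose (carrier M) g' f x)"
    using hom_closed[OF f(1)] by (auto simp: compose_def intro!: restrict_ext)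
  then have 1: "stably_equal M P (compose (carrier M) g f) (compose (carrier M) g' f)"
    using null_compose_right[OF M g(3)[unfolded stably_equal_def] f(1)] by (simp add: stably_equal_def)
  have "compose (carrier M) g' (\<lambda>x \<in> carrier M. f x \<ominus>\<^bsub>N\<^esub> f' x)
    = (\<lambda>x \<in> carrier M. compose (carrier M) g' f x \<ominus>\<^bsub>P\<^esub> compose (carrier M) g' f' x)"
    using hom_closed[OF f(1)] hom_closed[OF f(2)]
    by (auto simp: compose_def hom_diff[OF N P g(2)] intro!: restrict_ext)
  then have "stably_equal M P (compose (carrier M) g' f) (compose (carrier M) g' f')"
    using null_compose_left[OF f(3)[unfolded stably_equal_def] g(2)] by (simp add: stably_equal_def)
  then have 2: "stably_equal M P (compose (carrier M) g' f') (compose (carrier M) g' f)"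
    by (rule stably_equal_sym[OF M P c[OF f(1) g(2)] c[OF f(2) g(2)]])
  show ?thesis
    by (rule stably_equal_euclid[OF M P c[OF f(1) g(1)] c[OF f(2) g(2)] c[OF f(1) g(2)] 1 2])
qed

lemma Ob_Stab [simp]: "M \<in> Ob (Stab R) \<longleftrightarrow> module R M"
  and Hom_Stab: "Hom (Stab R) M N = stable_class R M N ` module_homs R M N"
  and Idn_Stab: "Idn (Stab R) M = stable_class R M M (\<lambda>x \<in> carrier M. x)"
  by (simp_all add: Stab_def)

lemma stable_class_Hom: "f \<in> module_homs R M N \<Longrightarrow> stable_class R M N f \<in> Hom (Stab R) M N"
  by (simp add: Hom_Stab)

lemma Cmp_stable_class:
  fixes M N P :: "('r, 'u) module"
  assumes M: "module R M" and N: "module R N" and P: "module R P"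
    and f: "f \<in> module_homs R M N" and g: "g \<in> module_homs R N P"
  shows "Cmp (Stab R) M N P (stable_class R N P g) (stable_class R M N f)
    = stable_class R M P (compose (carrier M) g f)"
proof -
  have *: "stable_class R M P (compose (carrier M) g' f') = stable_class R M P (compose (carrier M) g f)"
    if "g' \<in> module_homs R N P" "stably_equal N P g g'" "f' \<in> module_homs R M N" "stably_equal M N f f'" for f' g'
  proof -
    have "stably_equal M P (compose (carrier M) g f) (compose (carrier M) g' f')"
      using stably_equal_compose[OF M N P f _ _ g] that by blast
    then show ?thesis
      using stable_class_eq_iff[OF M P hom_compose[OF M f g] hom_compose[OF M that(3,1)]] by simp
  qed
  have "(\<Union>f' \<in> stable_class R M N f. stable_class R M P (compose (carrier M) g' f'))
      = stable_class R M P (compose (carrier M) g f)"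
    if "g' \<in> module_homs R N P" "stably_equal N P g g'" for g'
    using UN_stable_class[OF M N f, of "\<lambda>f'. stable_class R M P (compose (carrier M) g' f')"]
      *[OF that] *[OF that f stably_equal_refl[OF M N f]] by simp
  then show ?thesis
    using UN_stable_class[OF N P g,
        of "\<lambda>g'. \<Union>f' \<in> stable_class R M N f. stable_class R M P (compose (carrier M) g' f')"]
      stably_equal_refl[OF N P g] g by (simp add: Stab_def)
qed

lemma category_Stab: "category (Stab R :: (('r, 'u) module, ('u \<Rightarrow> 'u) set) cat)"
proof
  fix X Y Z W :: "('r, 'u) module" and f g h
  assume X: "X \<in> Ob (Stab R)"
  then have X': "module R X" by simp
  show "Idn (Stab R) X \<in> Hom (Stab R) X X"
    using hom_id[OF X'] by (simp add: Idn_Stab stable_class_Hom)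
  assume Y: "Y \<in> Ob (Stab R)"
  then have Y': "module R Y" by simp
  { assume "f \<in> Hom (Stab R) X Y"
    then obtain f' where f': "f' \<in> module_homs R X Y" "f = stable_class R X Y f'" by (auto simp: Hom_Stab)
    show "Cmp (Stab R) X Y Y (Idn (Stab R) Y) f = f" "Cmp (Stab R) X X Y f (Idn (Stab R) X) = f"
      using X' Y' f' hom_id[OF X'] hom_id[OF Y'] compose_id_left[OF f'(1)] compose_id_right[OF f'(1)]
      by (simp_all add: Idn_Stab Cmp_stable_class)
    assume Z: "Z \<in> Ob (Stab R)"
    then have Z': "module R Z" by simp
    assume "g \<in> Hom (Stab R) Y Z"
    then obtain g' where g': "g' \<in> module_homs R Y Z" "g = stable_class R Y Z g'" by (auto simp: Hom_Stab)
    show "Cmp (Stab R) X Y Z g f \<in> Hom (Stab R) X Z"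
      using X' Y' Z' f' g' by (simp add: Cmp_stable_class stable_class_Hom hom_compose) }
  assume Z: "Z \<in> Ob (Stab R)" and W: "W \<in> Ob (Stab R)" and "f \<in> Hom (Stab R) W X"
    "g \<in> Hom (Stab R) X Y" "h \<in> Hom (Stab R) Y Z"
  then obtain f' g' h' where f': "f' \<in> module_homs R W X" "f = stable_class R W X f'"
    and g': "g' \<in> module_homs R X Y" "g = stable_class R X Y g'"
    and h': "h' \<in> module_homs R Y Z" "h = stable_class R Y Z h'"
    by (auto simp: Hom_Stab)
  then show "Cmp (Stab R) W X Z (Cmp (Stab R) X Y Z h g) f = Cmp (Stab R) W Y Z h (Cmp (Stab R) W X Y g f)"
    using X' Y' Z W by (simp add: Cmp_stable_class hom_compose module_compose_assoc[OF f'(1)])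
qed

end

text \<open>
  An additive functor on modules that preserves projectives descends to stable categories.
\<close>

locale stable_functor_data =
  dom: stable_module_category R U + cod: stable_module_category S V
  for R :: "('r, 'z) ring_scheme" and U :: "'u itself"
    and S :: "('s, 'w) ring_scheme" and V :: "'v itself" +
  fixes obj :: "('r, 'u) module \<Rightarrow> ('s, 'v) module"
    and map :: "('r, 'u) module \<Rightarrow> ('r, 'u) module \<Rightarrow> ('u \<Rightarrow> 'u) \<Rightarrow> 'v \<Rightarrow> 'v"
  assumes obj_module: "module R M \<Longrightarrow> module S (obj M)"
    and map_hom: "module R M \<Longrightarrow> module R N \<Longrightarrow> f \<in> module_homs R M N
      \<Longrightarrow> map M N f \<in> module_homs S (obj M) (obj N)"
    and map_id: "module R M \<Longrightarrow> map M M (\<lambda>x \<in> carrier M. x) = (\<lambda>x \<in> carrier (obj M). x)"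
    and map_compose: "module R L \<Longrightarrow> module R M \<Longrightarrow> module R N \<Longrightarrow>
      f \<in> module_homs R L M \<Longrightarrow> g \<in> module_homs R M N \<Longrightarrow>
      map L N (compose (carrier L) g f) = compose (carrier (obj L)) (map M N g) (map L M f)"
    and map_diff: "module R M \<Longrightarrow> module R N \<Longrightarrow> f \<in> module_homs R M N \<Longrightarrow> g \<in> module_homs R M N \<Longrightarrow>
      map M N (\<lambda>x \<in> carrier M. f x \<ominus>\<^bsub>N\<^esub> g x)
        = (\<lambda>x \<in> carrier (obj M). map M N f x \<ominus>\<^bsub>obj N\<^esub> map M N g x)"
    and obj_projective: "projective_module R P \<Longrightarrow> projective_module S (obj P)"
begin

definition stable_functor ::
  "(('r, 'u) module, ('u \<Rightarrow> 'u) set, ('s, 'v) module, ('v \<Rightarrow> 'v) set) cfun"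
  where "stable_functor =
    \<lparr>FOb = obj, FMap = (\<lambda>M N \<alpha>. \<Union>f \<in> \<alpha>. stable_class S (obj M) (obj N) (map M N f))\<rparr>"

lemma map_null:
  assumes M: "module R M" and N: "module R N" and "factors_through_projective R M N f"
  shows "factors_through_projective S (obj M) (obj N) (map M N f)"
proof -
  obtain P :: "('r, 'u) module" and i q where P: "projective_module R P" and i: "i \<in> module_homs R M P"
    and q: "q \<in> module_homs R P N" and f: "f = compose (carrier M) q i"
    using assms(3) unfolding factors_through_projective_def by blast
  have PM: "module R P" using P by (simp add: projective_module_def)
  show ?thesis
    using obj_projective[OF P] map_hom[OF M PM i] map_hom[OF PM N q] map_compose[OF M PM N i q] f
    unfolding factors_through_projective_def by blast
qed

lemma FMap_stable_class:
  assumes M: "module R M" and N: "module R N" and f: "f \<in> module_homs R M N"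
  shows "FMap stable_functor M N (stable_class R M N f) = stable_class S (obj M) (obj N) (map M N f)"
proof -
  have "stable_class S (obj M) (obj N) (map M N g) = stable_class S (obj M) (obj N) (map M N f)"
    if g: "g \<in> module_homs R M N" and "dom.stably_equal M N f g" for g
  proof -
    have "cod.stably_equal (obj M) (obj N) (map M N f) (map M N g)"
      using map_null[OF M N that(2)[unfolded dom.stably_equal_def]] map_diff[OF M N f g]
      by (simp add: cod.stably_equal_def)
    then show ?thesis
      using cod.stable_class_eq_iff[OF obj_module[OF M] obj_module[OF N] map_hom[OF M N f] map_hom[OF M N g]]
      by simp
  qed
  then show ?thesis
    using dom.UN_stable_class[OF M N f, of "\<lambda>f. stable_class S (obj M) (obj N) (map M N f)"]
    by (simp add: stable_functor_def)
qed

lemma FOb_stable_functor [simp]: "FOb stable_functor M = obj M"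
  by (simp add: stable_functor_def)

lemma cat_functor_stable: "cat_functor (Stab R) (Stab S) stable_functor"
proof (intro cat_functor.intro cat_functor_axioms.intro)
  show "category (Stab R :: (('r, 'u) module, ('u \<Rightarrow> 'u) set) cat)" by (rule dom.category_Stab)
  show "category (Stab S :: (('s, 'v) module, ('v \<Rightarrow> 'v) set) cat)" by (rule cod.category_Stab)
  fix X :: "('r, 'u) module" assume "X \<in> Ob (Stab R)"
  then have X: "module R X" by simp
  show "FOb stable_functor X \<in> Ob (Stab S)" using obj_module[OF X] by simp
  show "FMap stable_functor X X (Idn (Stab R) X) = Idn (Stab S) (FOb stable_functor X)"
    using FMap_stable_class[OF X X hom_id[OF X]] map_id[OF X]
    by (simp add: dom.Idn_Stab cod.Idn_Stab)
  fix Y :: "('r, 'u) module" and f assume "Y \<in> Ob (Stab R)" "f \<in> Hom (Stab R) X Y"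
  then obtain f' where Y: "module R Y" and f': "f' \<in> module_homs R X Y" "f = stable_class R X Y f'"
    by (auto simp: dom.Hom_Stab)
  show "FMap stable_functor X Y f \<in> Hom (Stab S) (FOb stable_functor X) (FOb stable_functor Y)"
    using FMap_stable_class[OF X Y f'(1)] map_hom[OF X Y f'(1)] f'(2) by (simp add: cod.stable_class_Hom)
  fix Z :: "('r, 'u) module" and g assume "Z \<in> Ob (Stab R)" "g \<in> Hom (Stab R) Y Z"
  then obtain g' where Z: "module R Z" and g': "g' \<in> module_homs R Y Z" "g = stable_class R Y Z g'"
    by (auto simp: dom.Hom_Stab)
  show "FMap stable_functor X Z (Cmp (Stab R) X Y Z g f)
      = Cmp (Stab S) (FOb stable_functor X) (FOb stable_functor Y) (FOb stable_functor Z)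
          (FMap stable_functor Y Z g) (FMap stable_functor X Y f)"
    using X Y Z f' g' obj_module map_hom
    by (simp add: dom.Cmp_stable_class cod.Cmp_stable_class FMap_stable_class map_compose hom_compose)
qed

end

sublocale frobenius_algebra \<subseteq> stable_module_category R "TYPE('u)"
  by unfold_locales (auto intro: factors_through_projective_zero factors_through_projective_diff)

section \<open>Equivalences of categories\<close>

lemmas (in category) category_simps = Idn_in_Hom Cmp_in_Hom Cmp_Idn_left Cmp_Idn_right Cmp_assoc

lemma (in category) Cmp_cong_right:
  assumes "Cmp C X Y Z g f = h" "W \<in> Ob C" "X \<in> Ob C" "Y \<in> Ob C" "Z \<in> Ob C"
    and "f \<in> Hom C X Y" "g \<in> Hom C Y Z" "k \<in> Hom C W X"
  shows "Cmp C W Y Z g (Cmp C W X Y f k) = Cmp C W X Z h k"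
  using Cmp_assoc[of W X Y Z k f g] assms by simp

text \<open>
  A fully faithful and essentially surjective functor is an equivalence. Choose for each \<open>Y\<close> an object
  \<open>G0 Y\<close> and an isomorphism \<open>u Y\<close> from its image to \<open>Y\<close>; by faithfulness, the equations that make \<open>G\<close>
  a functor and the two families natural need only be verified after applying \<open>F\<close>, where they are
  cancellations of \<open>u\<close> against its inverse \<open>v\<close>.
\<close>

theorem equivalence_of_categoriesI:
  fixes C :: "('o, 'm) cat" and D :: "('o2, 'm2) cat" and F :: "('o, 'm, 'o2, 'm2) cfun"
  assumes F: "cat_functor C D F"
    and faithful: "\<And>X Y f g. \<lbrakk>X \<in> Ob C; Y \<in> Ob C; f \<in> Hom C X Y; g \<in> Hom C X Y; FMap F X Y f = FMap F X Y g\<rbrakk> \<Longrightarrow> f = g"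
    and full: "\<And>X Y h. \<lbrakk>X \<in> Ob C; Y \<in> Ob C; h \<in> Hom D (FOb F X) (FOb F Y)\<rbrakk> \<Longrightarrow> \<exists>f \<in> Hom C X Y. FMap F X Y f = h"
    and surj: "\<And>Y. Y \<in> Ob D \<Longrightarrow> \<exists>X \<in> Ob C. \<exists>u. is_isomorphism D (FOb F X) Y u"
  shows "equivalence_of_categories C D F"
proof -
  interpret F: cat_functor C D F by fact
  have "\<forall>Y. \<exists>X u v. Y \<in> Ob D \<longrightarrow> X \<in> Ob C \<and> u \<in> Hom D (FOb F X) Y \<and> v \<in> Hom D Y (FOb F X) \<and>
      Cmp D (FOb F X) Y (FOb F X) v u = Idn D (FOb F X) \<and> Cmp D Y (FOb F X) Y u v = Idn D Y"
    using surj unfolding is_isomorphism_def by blast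
  then obtain G0 u v where "\<forall>Y. Y \<in> Ob D \<longrightarrow> G0 Y \<in> Ob C \<and> u Y \<in> Hom D (FOb F (G0 Y)) Y \<and> v Y \<in> Hom D Y (FOb F (G0 Y)) \<and>
      Cmp D (FOb F (G0 Y)) Y (FOb F (G0 Y)) (v Y) (u Y) = Idn D (FOb F (G0 Y)) \<and> Cmp D Y (FOb F (G0 Y)) Y (u Y) (v Y) = Idn D Y"
    by metis
  then have G0: "\<And>Y. Y \<in> Ob D \<Longrightarrow> G0 Y \<in> Ob C"
    and u: "\<And>Y. Y \<in> Ob D \<Longrightarrow> u Y \<in> Hom D (FOb F (G0 Y)) Y"
    and v: "\<And>Y. Y \<in> Ob D \<Longrightarrow> v Y \<in> Hom D Y (FOb F (G0 Y))"
    and vu: "\<And>Y. Y \<in> Ob D \<Longrightarrow> Cmp D (FOb F (G0 Y)) Y (FOb F (G0 Y)) (v Y) (u Y) = Idn D (FOb F (G0 Y))"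
    and uv: "\<And>Y. Y \<in> Ob D \<Longrightarrow> Cmp D Y (FOb F (G0 Y)) Y (u Y) (v Y) = Idn D Y"
    by blast+
  note [simp] = G0 u v vu uv F.FOb_in_Ob F.FMap_in_Hom F.FMap_Idn F.FMap_Cmp
    F.dom.category_simps F.cod.category_simps
  have vu' [simp]: "Cmp D W Y (FOb F (G0 Y)) (v Y) (Cmp D W (FOb F (G0 Y)) Y (u Y) k) = k"
    if "W \<in> Ob D" "Y \<in> Ob D" "k \<in> Hom D W (FOb F (G0 Y))" for W Y k
    using F.cod.Cmp_cong_right[OF vu, of Y W k] that by simp
  have uv' [simp]: "Cmp D W (FOb F (G0 Y)) Y (u Y) (Cmp D W Y (FOb F (G0 Y)) (v Y) k) = k"
    if "W \<in> Ob D" "Y \<in> Ob D" "k \<in> Hom D W Y" for W Y k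
    using F.cod.Cmp_cong_right[OF uv, of Y W k] that by simp
  define G1 where "G1 Y Z g = (SOME f. f \<in> Hom C (G0 Y) (G0 Z) \<and> FMap F (G0 Y) (G0 Z) f =
      Cmp D (FOb F (G0 Y)) Z (FOb F (G0 Z)) (v Z) (Cmp D (FOb F (G0 Y)) Y Z g (u Y)))" for Y Z g
  have G1: "G1 Y Z g \<in> Hom C (G0 Y) (G0 Z)"
    "FMap F (G0 Y) (G0 Z) (G1 Y Z g) = Cmp D (FOb F (G0 Y)) Z (FOb F (G0 Z)) (v Z) (Cmp D (FOb F (G0 Y)) Y Z g (u Y))"
    if "Y \<in> Ob D" "Z \<in> Ob D" "g \<in> Hom D Y Z" for Y Z g
    using someI_ex[OF full[unfolded Bex_def, of "G0 Y" "G0 Z"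
        "Cmp D (FOb F (G0 Y)) Z (FOb F (G0 Z)) (v Z) (Cmp D (FOb F (G0 Y)) Y Z g (u Y))"]] that
    unfolding G1_def by simp_all
  define G where "G = \<lparr>FOb = G0, FMap = G1\<rparr>"
  have G: "cat_functor D C G"
  proof (intro cat_functor.intro cat_functor_axioms.intro F.dom.category_axioms F.cod.category_axioms)
    fix X assume X: "X \<in> Ob D"
    then show "FOb G X \<in> Ob C" by (simp add: G_def)
    show "FMap G X X (Idn D X) = Idn C (FOb G X)"
      using X G1[of X X "Idn D X"] by (intro faithful[of "G0 X" "G0 X"]) (simp_all add: G_def)
    fix Y f assume Y: "Y \<in> Ob D" and f: "f \<in> Hom D X Y"
    show "FMap G X Y f \<in> Hom C (FOb G X) (FOb G Y)"
      using X Y f by (simp add: G_def G1)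
    fix Z g assume Z: "Z \<in> Ob D" and g: "g \<in> Hom D Y Z"
    show "FMap G X Z (Cmp D X Y Z g f) = Cmp C (FOb G X) (FOb G Y) (FOb G Z) (FMap G Y Z g) (FMap G X Y f)"
      using X Y Z f g G1 by (intro faithful[of "G0 X" "G0 Z"]) (simp_all add: G_def)
  qed
  have GF: "cat_functor C C (comp_cfun G F)"
    using G unfolding cat_functor_def cat_functor_axioms_def comp_cfun_def by simp
  have FG: "cat_functor D D (comp_cfun F G)"
    using G unfolding cat_functor_def cat_functor_axioms_def comp_cfun_def by simp
  have idC: "cat_functor C C id_cfun" and idD: "cat_functor D D id_cfun"
    by (auto intro!: cat_functor.intro cat_functor_axioms.intro F.dom.category_axioms F.cod.category_axioms simp: id_cfun_def)
  have "naturally_isomorphic D D (comp_cfun F G) id_cfun"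
    unfolding naturally_isomorphic_def natural_transformation_def
  proof (intro exI[of _ u] conjI ballI FG idD)
    fix X assume X: "X \<in> Ob D"
    then show "u X \<in> Hom D (FOb (comp_cfun F G) X) (FOb id_cfun X)"
      by (simp add: comp_cfun_def id_cfun_def G_def)
    show "is_isomorphism D (FOb (comp_cfun F G) X) (FOb id_cfun X) (u X)"
      unfolding is_isomorphism_def using X
      by (auto simp: comp_cfun_def id_cfun_def G_def intro!: bexI[of _ "v X"])
    fix Y f assume "Y \<in> Ob D" "f \<in> Hom D X Y"
    then show "Cmp D (FOb (comp_cfun F G) X) (FOb (comp_cfun F G) Y) (FOb id_cfun Y) (u Y) (FMap (comp_cfun F G) X Y f)
      = Cmp D (FOb (comp_cfun F G) X) (FOb id_cfun X) (FOb id_cfun Y) (FMap id_cfun X Y f) (u X)"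
      using X by (simp add: comp_cfun_def id_cfun_def G_def G1)
  qed
  moreover have "naturally_isomorphic C C id_cfun (comp_cfun G F)"
  proof -
    have "\<forall>X. \<exists>t s. X \<in> Ob C \<longrightarrow> t \<in> Hom C X (G0 (FOb F X)) \<and> FMap F X (G0 (FOb F X)) t = v (FOb F X) \<and>
        s \<in> Hom C (G0 (FOb F X)) X \<and> FMap F (G0 (FOb F X)) X s = u (FOb F X)"
    proof
      fix X show "\<exists>t s. X \<in> Ob C \<longrightarrow> t \<in> Hom C X (G0 (FOb F X)) \<and> FMap F X (G0 (FOb F X)) t = v (FOb F X) \<and>
        s \<in> Hom C (G0 (FOb F X)) X \<and> FMap F (G0 (FOb F X)) X s = u (FOb F X)"
        using full[of X "G0 (FOb F X)" "v (FOb F X)"] full[of "G0 (FOb F X)" X "u (FOb F X)"]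
        by (cases "X \<in> Ob C") auto
    qed
    then obtain t s where "\<forall>X. X \<in> Ob C \<longrightarrow> t X \<in> Hom C X (G0 (FOb F X)) \<and> FMap F X (G0 (FOb F X)) (t X) = v (FOb F X) \<and>
        s X \<in> Hom C (G0 (FOb F X)) X \<and> FMap F (G0 (FOb F X)) X (s X) = u (FOb F X)"
      by metis
    then have ts [simp]: "\<And>X. X \<in> Ob C \<Longrightarrow> t X \<in> Hom C X (G0 (FOb F X))"
      "\<And>X. X \<in> Ob C \<Longrightarrow> FMap F X (G0 (FOb F X)) (t X) = v (FOb F X)"
      "\<And>X. X \<in> Ob C \<Longrightarrow> s X \<in> Hom C (G0 (FOb F X)) X"
      "\<And>X. X \<in> Ob C \<Longrightarrow> FMap F (G0 (FOb F X)) X (s X) = u (FOb F X)"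
      by blast+
    show ?thesis
      unfolding naturally_isomorphic_def natural_transformation_def
    proof (intro exI[of _ t] conjI ballI GF idC)
      fix X assume X: "X \<in> Ob C"
      then show "t X \<in> Hom C (FOb id_cfun X) (FOb (comp_cfun G F) X)"
        by (simp add: comp_cfun_def id_cfun_def G_def)
      have "Cmp C X (G0 (FOb F X)) X (s X) (t X) = Idn C X"
        using X by (intro faithful[of X X]) simp_all
      moreover have "Cmp C (G0 (FOb F X)) X (G0 (FOb F X)) (t X) (s X) = Idn C (G0 (FOb F X))"
        using X by (intro faithful[of "G0 (FOb F X)" "G0 (FOb F X)"]) simp_all
      ultimately show "is_isomorphism C (FOb id_cfun X) (FOb (comp_cfun G F) X) (t X)"
        unfolding is_isomorphism_def using X
        by (auto simp: comp_cfun_def id_cfun_def G_def intro!: bexI[of _ "s X"])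
      fix Y f assume Y: "Y \<in> Ob C" and f: "f \<in> Hom C X Y"
      have "Cmp C X Y (G0 (FOb F Y)) (t Y) f
        = Cmp C X (G0 (FOb F X)) (G0 (FOb F Y)) (G1 (FOb F X) (FOb F Y) (FMap F X Y f)) (t X)"
        using X Y f G1 by (intro faithful[of X "G0 (FOb F Y)"]) simp_all
      then show "Cmp C (FOb id_cfun X) (FOb id_cfun Y) (FOb (comp_cfun G F) Y) (t Y) (FMap id_cfun X Y f)
        = Cmp C (FOb id_cfun X) (FOb (comp_cfun G F) X) (FOb (comp_cfun G F) Y) (FMap (comp_cfun G F) X Y f) (t X)"
        by (simp add: comp_cfun_def id_cfun_def G_def)
    qed
  qed
  ultimately show ?thesis unfolding equivalence_of_categories_def using F G by blast
qed

section \<open>Monadicity of separable adjunctions\<close>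

text \<open>
  A natural section \<open>\<xi>\<close> of the counit makes the monad separable: \<open>R \<xi> L\<close> is a section of its
  multiplication.
\<close>

locale separable_adjunction =
  fixes C :: "('o, 'm) cat" and D :: "('o2, 'm2) cat" and \<Phi> :: "('o, 'm, 'o2, 'm2) adj" and \<xi> :: "'o2 \<Rightarrow> 'm2"
  assumes adj: "adjunction C D \<Phi>"
    and \<xi>_nat: "natural_transformation D D id_cfun (comp_cfun (Lft \<Phi>) (Rgt \<Phi>)) \<xi>"
    and \<xi>_section: "Z \<in> Ob D \<Longrightarrow>
      Cmp D Z (FOb (Lft \<Phi>) (FOb (Rgt \<Phi>) Z)) Z (cnt \<Phi> Z) (\<xi> Z) = Idn D Z"
    and idempotents_split: "\<lbrakk>Z \<in> Ob D; e \<in> Hom D Z Z; Cmp D Z Z Z e e = e\<rbrakk> \<Longrightarrow>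
      \<exists>N \<in> Ob D. \<exists>r \<in> Hom D Z N. \<exists>i \<in> Hom D N Z. Cmp D Z N Z i r = e \<and> Cmp D N Z N r i = Idn D N"
begin

abbreviation "L0 \<equiv> FOb (Lft \<Phi>)"
abbreviation "L1 \<equiv> FMap (Lft \<Phi>)"
abbreviation "R0 \<equiv> FOb (Rgt \<Phi>)"
abbreviation "R1 \<equiv> FMap (Rgt \<Phi>)"
abbreviation "\<eta> \<equiv> unt \<Phi>"
abbreviation "\<epsilon> \<equiv> cnt \<Phi>"
abbreviation "monad \<equiv> induced_monad \<Phi>"
abbreviation "EM \<equiv> EM_category C monad"

lemma functors: "cat_functor C D (Lft \<Phi>)" "cat_functor D C (Rgt \<Phi>)"
  using adj by (auto simp: adjunction_def Let_def)

sublocale L: cat_functor C D "Lft \<Phi>" by (rule functors)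
sublocale R: cat_functor D C "Rgt \<Phi>" by (rule functors)

lemmas functor_simps =
  L.FOb_in_Ob R.FOb_in_Ob L.FMap_in_Hom R.FMap_in_Hom L.FMap_Idn R.FMap_Idn
  L.dom.category_simps L.cod.category_simps

lemma unit_hom: "X \<in> Ob C \<Longrightarrow> \<eta> X \<in> Hom C X (R0 (L0 X))"
  and unit_natural: "\<lbrakk>X \<in> Ob C; Y \<in> Ob C; f \<in> Hom C X Y\<rbrakk> \<Longrightarrow>
    Cmp C X Y (R0 (L0 Y)) (\<eta> Y) f
      = Cmp C X (R0 (L0 X)) (R0 (L0 Y)) (R1 (L0 X) (L0 Y) (L1 X Y f)) (\<eta> X)"
  and counit_hom: "Z \<in> Ob D \<Longrightarrow> \<epsilon> Z \<in> Hom D (L0 (R0 Z)) Z"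
  and counit_natural: "\<lbrakk>Z \<in> Ob D; W \<in> Ob D; g \<in> Hom D Z W\<rbrakk> \<Longrightarrow>
    Cmp D (L0 (R0 Z)) (L0 (R0 W)) W (\<epsilon> W) (L1 (R0 Z) (R0 W) (R1 Z W g))
      = Cmp D (L0 (R0 Z)) Z W g (\<epsilon> Z)"
  and triangle_L: "X \<in> Ob C \<Longrightarrow>
    Cmp D (L0 X) (L0 (R0 (L0 X))) (L0 X) (\<epsilon> (L0 X)) (L1 X (R0 (L0 X)) (\<eta> X)) = Idn D (L0 X)"
  and triangle_R: "Z \<in> Ob D \<Longrightarrow>
    Cmp C (R0 Z) (R0 (L0 (R0 Z))) (R0 Z) (R1 (L0 (R0 Z)) Z (\<epsilon> Z)) (\<eta> (R0 Z)) = Idn C (R0 Z)"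
  and \<xi>_hom: "Z \<in> Ob D \<Longrightarrow> \<xi> Z \<in> Hom D Z (L0 (R0 Z))"
  and \<xi>_natural: "\<lbrakk>Z \<in> Ob D; W \<in> Ob D; g \<in> Hom D Z W\<rbrakk> \<Longrightarrow>
    Cmp D Z W (L0 (R0 W)) (\<xi> W) g
      = Cmp D Z (L0 (R0 Z)) (L0 (R0 W)) (L1 (R0 Z) (R0 W) (R1 Z W g)) (\<xi> Z)"
  using adj \<xi>_nat
  by (simp_all add: adjunction_def Let_def natural_transformation_def id_cfun_def comp_cfun_def)

lemma monad_simps [simp]:
  "FOb (Endo monad) X = R0 (L0 X)"
  "FMap (Endo monad) X Y f = R1 (L0 X) (L0 Y) (L1 X Y f)"
  "munit monad = \<eta>"
  "mmult monad X = R1 (L0 (R0 (L0 X))) (L0 X) (\<epsilon> (L0 X))"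
  by (simp_all add: induced_monad_def Let_def comp_cfun_def)

lemma EM_simps:
  "U \<in> Ob EM \<longleftrightarrow> fst U \<in> Ob C \<and> snd U \<in> Hom C (R0 (L0 (fst U))) (fst U) \<and>
    Cmp C (R0 (L0 (R0 (L0 (fst U))))) (R0 (L0 (fst U))) (fst U) (snd U)
        (R1 (L0 (R0 (L0 (fst U)))) (L0 (fst U)) (L1 (R0 (L0 (fst U))) (fst U) (snd U)))
      = Cmp C (R0 (L0 (R0 (L0 (fst U))))) (R0 (L0 (fst U))) (fst U) (snd U)
          (R1 (L0 (R0 (L0 (fst U)))) (L0 (fst U)) (\<epsilon> (L0 (fst U)))) \<and>
    Cmp C (fst U) (R0 (L0 (fst U))) (fst U) (snd U) (\<eta> (fst U)) = Idn C (fst U)"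
  "f \<in> Hom EM U V \<longleftrightarrow> f \<in> Hom C (fst U) (fst V) \<and>
    Cmp C (R0 (L0 (fst U))) (fst U) (fst V) f (snd U)
      = Cmp C (R0 (L0 (fst U))) (R0 (L0 (fst V))) (fst V) (snd V)
          (R1 (L0 (fst U)) (L0 (fst V)) (L1 (fst U) (fst V) f))"
  "Idn EM U = Idn C (fst U)"
  "Cmp EM U V W g f = Cmp C (fst U) (fst V) (fst W) g f"
  by (auto simp: EM_category_def monad_modules_def monad_module_homs_def Let_def split: prod.splits)

lemma EM_is_category: "category EM"
proof
  fix U V W X f g h
  assume U: "U \<in> Ob EM"
  then show "Idn EM U \<in> Hom EM U U"
    by (simp add: EM_simps functor_simps)
  assume V: "V \<in> Ob EM"
  { assume f: "f \<in> Hom EM U V"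
    show "Cmp EM U V V (Idn EM V) f = f" "Cmp EM U U V f (Idn EM U) = f"
      using U V f by (simp_all add: EM_simps functor_simps)
    assume W: "W \<in> Ob EM" and g: "g \<in> Hom EM V W"
    have "Cmp C (R0 (L0 (fst U))) (fst U) (fst W) (Cmp C (fst U) (fst V) (fst W) g f) (snd U)
      = Cmp C (R0 (L0 (fst U))) (fst V) (fst W) g
          (Cmp C (R0 (L0 (fst U))) (R0 (L0 (fst V))) (fst V) (snd V)
          (R1 (L0 (fst U)) (L0 (fst V)) (L1 (fst U) (fst V) f)))"
      using U V W f g by (simp add: EM_simps functor_simps)
    also have "\<dots> = Cmp C (R0 (L0 (fst U))) (R0 (L0 (fst V))) (fst W)
       (Cmp C (R0 (L0 (fst V))) (R0 (L0 (fst W))) (fst W) (snd W)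
          (R1 (L0 (fst V)) (L0 (fst W)) (L1 (fst V) (fst W) g)))
          (R1 (L0 (fst U)) (L0 (fst V)) (L1 (fst U) (fst V) f))"
      using U V W f g by (intro L.dom.Cmp_cong_right) (simp_all add: EM_simps functor_simps)
    also have "\<dots> = Cmp C (R0 (L0 (fst U))) (R0 (L0 (fst W))) (fst W) (snd W)
          (R1 (L0 (fst U)) (L0 (fst W)) (L1 (fst U) (fst W) (Cmp C (fst U) (fst V) (fst W) g f)))"
      using U V W f g by (simp add: EM_simps functor_simps L.FMap_Cmp R.FMap_Cmp)
    finally show "Cmp EM U V W g f \<in> Hom EM U W"
      using U V W f g by (simp add: EM_simps functor_simps) }
  assume "W \<in> Ob EM" "X \<in> Ob EM" "f \<in> Hom EM X U" "g \<in> Hom EM U V" "h \<in> Hom EM V W"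
  then show "Cmp EM X U W (Cmp EM U V W h g) f = Cmp EM X V W h (Cmp EM X U V g f)"
    using U V by (simp add: EM_simps functor_simps)
qed

lemma EM_functor_simps:
  "FOb (EM_functor \<Phi>) Z = (R0 Z, R1 (L0 (R0 Z)) Z (\<epsilon> Z))"
  "FMap (EM_functor \<Phi>) = R1"
  by (simp_all add: EM_functor_def Let_def)

lemma EM_functor_is_functor: "cat_functor D EM (EM_functor \<Phi>)"
proof (intro cat_functor.intro cat_functor_axioms.intro EM_is_category L.cod.category_axioms)
  fix Z assume Z: "Z \<in> Ob D"
  have "Cmp C (R0 (L0 (R0 (L0 (R0 Z))))) (R0 (L0 (R0 Z))) (R0 Z) (R1 (L0 (R0 Z)) Z (\<epsilon> Z))
      (R1 (L0 (R0 (L0 (R0 Z)))) (L0 (R0 Z)) (L1 (R0 (L0 (R0 Z))) (R0 Z) (R1 (L0 (R0 Z)) Z (\<epsilon> Z))))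
    = R1 (L0 (R0 (L0 (R0 Z)))) Z (Cmp D (L0 (R0 (L0 (R0 Z)))) (L0 (R0 Z)) Z (\<epsilon> Z)
        (L1 (R0 (L0 (R0 Z))) (R0 Z) (R1 (L0 (R0 Z)) Z (\<epsilon> Z))))"
    using Z by (simp add: R.FMap_Cmp functor_simps counit_hom)
  also have "\<dots> = Cmp C (R0 (L0 (R0 (L0 (R0 Z))))) (R0 (L0 (R0 Z))) (R0 Z) (R1 (L0 (R0 Z)) Z (\<epsilon> Z))
      (R1 (L0 (R0 (L0 (R0 Z)))) (L0 (R0 Z)) (\<epsilon> (L0 (R0 Z))))"
    using Z by (simp add: counit_natural R.FMap_Cmp functor_simps counit_hom)
  finally show "FOb (EM_functor \<Phi>) Z \<in> Ob EM"
    using Z by (simp add: EM_simps EM_functor_simps functor_simps counit_hom triangle_R)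
  show "FMap (EM_functor \<Phi>) Z Z (Idn D Z) = Idn EM (FOb (EM_functor \<Phi>) Z)"
    using Z by (simp add: EM_simps EM_functor_simps functor_simps)
  fix W f assume W: "W \<in> Ob D" and f: "f \<in> Hom D Z W"
  have "Cmp C (R0 (L0 (R0 Z))) (R0 Z) (R0 W) (R1 Z W f) (R1 (L0 (R0 Z)) Z (\<epsilon> Z))
    = R1 (L0 (R0 Z)) W (Cmp D (L0 (R0 Z)) Z W f (\<epsilon> Z))"
    using Z W f by (simp add: R.FMap_Cmp functor_simps counit_hom)
  also have "\<dots> = Cmp C (R0 (L0 (R0 Z))) (R0 (L0 (R0 W))) (R0 W) (R1 (L0 (R0 W)) W (\<epsilon> W))
      (R1 (L0 (R0 Z)) (L0 (R0 W)) (L1 (R0 Z) (R0 W) (R1 Z W f)))"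
    using Z W f by (simp add: counit_natural[symmetric] R.FMap_Cmp functor_simps counit_hom)
  finally show "FMap (EM_functor \<Phi>) Z W f \<in> Hom EM (FOb (EM_functor \<Phi>) Z) (FOb (EM_functor \<Phi>) W)"
    using Z W f by (simp add: EM_simps EM_functor_simps functor_simps)
  fix V g assume "V \<in> Ob D" "g \<in> Hom D W V"
  then show "FMap (EM_functor \<Phi>) Z V (Cmp D Z W V g f)
    = Cmp EM (FOb (EM_functor \<Phi>) Z) (FOb (EM_functor \<Phi>) W) (FOb (EM_functor \<Phi>) V)
        (FMap (EM_functor \<Phi>) W V g) (FMap (EM_functor \<Phi>) Z W f)"
    using Z W f by (simp add: EM_simps EM_functor_simps R.FMap_Cmp)
qed

text \<open>
  A morphism is recovered from its image under \<open>R\<close> as \<open>\<epsilon> \<circ> L R h \<circ> \<xi> = h \<circ> \<epsilon> \<circ> \<xi> = h\<close>.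
\<close>

lemma EM_functor_faithful:
  assumes Z: "Z \<in> Ob D" and W: "W \<in> Ob D" and f: "f \<in> Hom D Z W" and g: "g \<in> Hom D Z W"
    and "R1 Z W f = R1 Z W g"
  shows "f = g"
proof -
  have "h = Cmp D Z (L0 (R0 W)) W (\<epsilon> W)
      (Cmp D Z (L0 (R0 Z)) (L0 (R0 W)) (L1 (R0 Z) (R0 W) (R1 Z W h)) (\<xi> Z))"
    if h: "h \<in> Hom D Z W" for h
    using L.cod.Cmp_cong_right[OF \<xi>_section[OF W], of Z h] Z W h \<xi>_natural[OF Z W h]
    by (simp add: functor_simps counit_hom \<xi>_hom)
  from this[OF f] this[OF g] show ?thesis using assms(5) by simp
qed

text \<open>
  The same formula \<open>\<epsilon> \<circ> L h \<circ> \<xi>\<close> gives a preimage of a module homomorphism \<open>h\<close>, since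
  \<open>R \<epsilon> \<circ> R L h = h \<circ> R \<epsilon>\<close>.
\<close>

lemma EM_functor_full:
  assumes Z: "Z \<in> Ob D" and W: "W \<in> Ob D"
    and h: "h \<in> Hom EM (FOb (EM_functor \<Phi>) Z) (FOb (EM_functor \<Phi>) W)"
  shows "\<exists>f \<in> Hom D Z W. R1 Z W f = h"
proof
  note [simp] = functor_simps counit_hom \<xi>_hom Z W
  have hC [simp]: "h \<in> Hom C (R0 Z) (R0 W)"
    and h_eq: "Cmp C (R0 (L0 (R0 Z))) (R0 (L0 (R0 W))) (R0 W) (R1 (L0 (R0 W)) W (\<epsilon> W))
       (R1 (L0 (R0 Z)) (L0 (R0 W)) (L1 (R0 Z) (R0 W) h))
     = Cmp C (R0 (L0 (R0 Z))) (R0 Z) (R0 W) h (R1 (L0 (R0 Z)) Z (\<epsilon> Z))"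
    using h by (simp_all add: EM_simps EM_functor_simps)
  let ?f = "Cmp D Z (L0 (R0 W)) W (\<epsilon> W) (Cmp D Z (L0 (R0 Z)) (L0 (R0 W)) (L1 (R0 Z) (R0 W) h) (\<xi> Z))"
  show "?f \<in> Hom D Z W" by simp
  have "R1 Z W ?f = Cmp C (R0 Z) (R0 (L0 (R0 W))) (R0 W) (R1 (L0 (R0 W)) W (\<epsilon> W))
     (Cmp C (R0 Z) (R0 (L0 (R0 Z))) (R0 (L0 (R0 W)))
       (R1 (L0 (R0 Z)) (L0 (R0 W)) (L1 (R0 Z) (R0 W) h)) (R1 Z (L0 (R0 Z)) (\<xi> Z)))"
    by (simp add: R.FMap_Cmp)
  also have "\<dots> = Cmp C (R0 Z) (R0 (L0 (R0 Z))) (R0 W)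
     (Cmp C (R0 (L0 (R0 Z))) (R0 Z) (R0 W) h (R1 (L0 (R0 Z)) Z (\<epsilon> Z))) (R1 Z (L0 (R0 Z)) (\<xi> Z))"
    by (rule L.dom.Cmp_cong_right[OF h_eq]) simp_all
  also have "\<dots> = Cmp C (R0 Z) (R0 Z) (R0 W) h
      (R1 Z Z (Cmp D Z (L0 (R0 Z)) Z (\<epsilon> Z) (\<xi> Z)))"
    by (simp add: R.FMap_Cmp)
  also have "\<dots> = h" by (simp add: \<xi>_section)
  finally show "R1 Z W ?f = h" .
qed

text \<open>
  For a module \<open>(X, \<rho>)\<close> put \<open>e = L \<rho> \<circ> \<xi>\<close>, an endomorphism of \<open>Y = L X\<close>. Naturality of \<open>\<xi>\<close> and
  associativity of \<open>\<rho>\<close> give \<open>e \<circ> L \<rho> = e \<circ> \<epsilon>\<close>, from which \<open>e\<close> is idempotent. If \<open>e = i \<circ> r\<close>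
  splits through \<open>N\<close>, then \<open>u = R r \<circ> \<eta>\<close> and \<open>v = \<rho> \<circ> R i\<close> are mutually inverse module homomorphisms
  between \<open>(X, \<rho>)\<close> and the image of \<open>N\<close>.
\<close>

lemma EM_functor_essentially_surjective:
  assumes U: "U \<in> Ob EM"
  shows "\<exists>N \<in> Ob D. \<exists>v. is_isomorphism EM (FOb (EM_functor \<Phi>) N) U v"
proof -
  obtain X \<rho> where U_eq: "U = (X, \<rho>)" by (cases U)
  define Y where "Y = L0 X"
  define T where "T = R0 Y"
  define TT where "TT = R0 (L0 T)"
  have X: "X \<in> Ob C" and \<rho>: "\<rho> \<in> Hom C T X"
    and \<rho>_assoc: "Cmp C TT T X \<rho> (R1 (L0 T) Y (L1 T X \<rho>)) = Cmp C TT T X \<rho> (R1 (L0 T) Y (\<epsilon> Y))"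
    and \<rho>_unit: "Cmp C X T X \<rho> (\<eta> X) = Idn C X"
    using U by (simp_all add: EM_simps U_eq Y_def T_def TT_def)
  note [simp] = X \<rho> functor_simps
  have Y [simp]: "Y \<in> Ob D" and T [simp]: "T \<in> Ob C" and TT [simp]: "TT \<in> Ob C"
    by (simp_all add: Y_def T_def TT_def)
  have homs [simp]: "\<eta> X \<in> Hom C X T" "\<epsilon> Y \<in> Hom D (L0 T) Y" "\<xi> Y \<in> Hom D Y (L0 T)"
    "L1 T X \<rho> \<in> Hom D (L0 T) Y" "L1 X T (\<eta> X) \<in> Hom D Y (L0 T)"
    "\<xi> (L0 T) \<in> Hom D (L0 T) (L0 TT)" "\<epsilon> (L0 T) \<in> Hom D (L0 TT) (L0 T)"
    "R1 (L0 T) Y (L1 T X \<rho>) \<in> Hom C TT T" "R1 (L0 T) Y (\<epsilon> Y) \<in> Hom C TT T"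
    "\<eta> T \<in> Hom C T TT" "R1 Y (L0 T) (\<xi> Y) \<in> Hom C T TT"
    using \<rho> unit_hom[OF X] counit_hom[OF Y] \<xi>_hom[OF Y] L.FMap_in_Hom[of T X \<rho>] L.FMap_in_Hom[of X T "\<eta> X"]
      \<xi>_hom[of "L0 T"] counit_hom[of "L0 T"] unit_hom[OF T]
      R.FMap_in_Hom[of "L0 T" Y "L1 T X \<rho>"] R.FMap_in_Hom[of "L0 T" Y "\<epsilon> Y"] R.FMap_in_Hom[of Y "L0 T" "\<xi> Y"]
    by (simp_all add: T_def TT_def Y_def)
  have R0Y [simp]: "R0 Y = T" "R0 (L0 T) = TT" "L0 X = Y" by (simp_all add: T_def TT_def Y_def)
  define e where "e = Cmp D Y (L0 T) Y (L1 T X \<rho>) (\<xi> Y)"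
  have e [simp]: "e \<in> Hom D Y Y" by (simp add: e_def)
  \<comment> \<open>\<open>e\<close> coequalises the two maps \<open>L \<rho>\<close> and \<open>\<epsilon>\<close> from \<open>L R L X\<close> to \<open>L X\<close>, and so will \<open>r\<close>\<close>
  have e_act: "Cmp D (L0 T) Y Y e (L1 T X \<rho>) = Cmp D (L0 T) Y Y e (\<epsilon> Y)"
  proof -
    have *: "Cmp D (L0 T) Y (L0 T) (\<xi> Y) g = Cmp D (L0 T) (L0 TT) (L0 T) (L1 TT T (R1 (L0 T) Y g)) (\<xi> (L0 T))"
      if "g \<in> Hom D (L0 T) Y" for g
      using \<xi>_natural[of "L0 T" Y g] that by simp
    have L\<rho>: "Cmp D (L0 TT) (L0 T) Y (L1 T X \<rho>) (L1 TT T (R1 (L0 T) Y (L1 T X \<rho>)))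
      = Cmp D (L0 TT) (L0 T) Y (L1 T X \<rho>) (L1 TT T (R1 (L0 T) Y (\<epsilon> Y)))"
      using arg_cong[OF \<rho>_assoc, of "L1 TT X"] by (simp add: L.FMap_Cmp)
    have "Cmp D (L0 T) Y Y e (L1 T X \<rho>) = Cmp D (L0 T) (L0 T) Y (L1 T X \<rho>)
        (Cmp D (L0 T) (L0 TT) (L0 T) (L1 TT T (R1 (L0 T) Y (L1 T X \<rho>))) (\<xi> (L0 T)))"
      by (simp add: e_def *)
    also have "\<dots> = Cmp D (L0 T) (L0 TT) Y (Cmp D (L0 TT) (L0 T) Y (L1 T X \<rho>) (L1 TT T (R1 (L0 T) Y (\<epsilon> Y)))) (\<xi> (L0 T))"
      by (rule L.cod.Cmp_cong_right[OF L\<rho>]) simp_all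
    also have "\<dots> = Cmp D (L0 T) Y Y e (\<epsilon> Y)"
      by (simp add: e_def *)
    finally show ?thesis .
  qed
  have "Cmp D Y Y Y e e = Cmp D Y (L0 T) Y (Cmp D (L0 T) Y Y e (L1 T X \<rho>)) (\<xi> Y)"
    by (simp add: e_def)
  also have "\<dots> = Cmp D Y Y Y e (Cmp D Y (L0 T) Y (\<epsilon> Y) (\<xi> Y))"
    unfolding e_act by simp
  also have "\<dots> = e" using \<xi>_section[OF Y] by simp
  finally have ee: "Cmp D Y Y Y e e = e" .
  obtain N r i where N [simp]: "N \<in> Ob D" and r [simp]: "r \<in> Hom D Y N" and i [simp]: "i \<in> Hom D N Y"
    and ir: "Cmp D Y N Y i r = e" and ri: "Cmp D N Y N r i = Idn D N"
    using idempotents_split[OF Y e ee] by blast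
  have re: "Cmp D Y Y N r e = r"
    using L.cod.Cmp_cong_right[OF ri, of Y r] ir by simp
  have r_act: "Cmp D (L0 T) Y N r (L1 T X \<rho>) = Cmp D (L0 T) Y N r (\<epsilon> Y)"
  proof -
    have "Cmp D (L0 T) Y N r k = Cmp D (L0 T) Y N r (Cmp D (L0 T) Y Y e k)" if "k \<in> Hom D (L0 T) Y" for k
      using L.cod.Cmp_cong_right[OF re, of "L0 T" k] that by simp
    from this[of "L1 T X \<rho>"] this[of "\<epsilon> Y"] show ?thesis using e_act by simp
  qed
  have Rr [simp]: "R1 Y N r \<in> Hom C T (R0 N)" and Ri [simp]: "R1 N Y i \<in> Hom C (R0 N) T"
    using R.FMap_in_Hom[of Y N r] R.FMap_in_Hom[of N Y i] by simp_all
  define u where "u = Cmp C X T (R0 N) (R1 Y N r) (\<eta> X)"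
  define v where "v = Cmp C (R0 N) T X \<rho> (R1 N Y i)"
  have u [simp]: "u \<in> Hom C X (R0 N)" and v [simp]: "v \<in> Hom C (R0 N) X"
    by (simp_all add: u_def v_def)
  have Rr_act: "Cmp C TT T (R0 N) (R1 Y N r) (R1 (L0 T) Y (L1 T X \<rho>)) = Cmp C TT T (R0 N) (R1 Y N r) (R1 (L0 T) Y (\<epsilon> Y))"
    using arg_cong[OF r_act, of "R1 (L0 T) N"] by (simp add: R.FMap_Cmp)
  \<comment> \<open>by naturality of \<open>\<eta>\<close> the action is pushed to the place where \<open>r\<close> replaces it by \<open>\<epsilon>\<close>\<close>
  have u\<rho>: "Cmp C T X (R0 N) u \<rho> = R1 Y N r"
  proof -
    have "Cmp C T X (R0 N) u \<rho> = Cmp C T T (R0 N) (R1 Y N r) (Cmp C T TT T (R1 (L0 T) Y (L1 T X \<rho>)) (\<eta> T))"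
      using unit_natural[OF T X \<rho>] by (simp add: u_def)
    also have "\<dots> = Cmp C T TT (R0 N) (Cmp C TT T (R0 N) (R1 Y N r) (R1 (L0 T) Y (\<epsilon> Y))) (\<eta> T)"
      by (rule L.dom.Cmp_cong_right[OF Rr_act]) simp_all
    also have "\<dots> = R1 Y N r" using triangle_R[OF Y] by simp
    finally show ?thesis .
  qed
  have uv: "Cmp C (R0 N) X (R0 N) u v = Idn C (R0 N)"
  proof -
    have "Cmp C (R0 N) X (R0 N) u v = Cmp C (R0 N) T (R0 N) (R1 Y N r) (R1 N Y i)"
      using L.dom.Cmp_cong_right[OF u\<rho>, of "R0 N" "R1 N Y i"] by (simp add: v_def)
    also have "\<dots> = R1 N N (Cmp D N Y N r i)" by (simp add: R.FMap_Cmp)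
    also have "\<dots> = Idn C (R0 N)" by (simp add: ri)
    finally show ?thesis .
  qed
  have vu: "Cmp C X (R0 N) X v u = Idn C X"
  proof -
    have Re: "Cmp C T (R0 N) T (R1 N Y i) (R1 Y N r) = Cmp C T TT T (R1 (L0 T) Y (L1 T X \<rho>)) (R1 Y (L0 T) (\<xi> Y))"
      using arg_cong[OF ir, of "R1 Y Y"] by (simp add: R.FMap_Cmp e_def)
    have "Cmp C X (R0 N) X v u = Cmp C X T X \<rho> (Cmp C X (R0 N) T (R1 N Y i) (Cmp C X T (R0 N) (R1 Y N r) (\<eta> X)))"
      by (simp add: u_def v_def)
    also have "Cmp C X (R0 N) T (R1 N Y i) (Cmp C X T (R0 N) (R1 Y N r) (\<eta> X))
      = Cmp C X T T (Cmp C T TT T (R1 (L0 T) Y (L1 T X \<rho>)) (R1 Y (L0 T) (\<xi> Y))) (\<eta> X)"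
      by (rule L.dom.Cmp_cong_right[OF Re]) simp_all
    also have "Cmp C X T X \<rho> \<dots> = Cmp C X TT X \<rho>' k"
      if "\<rho>' = Cmp C TT T X \<rho> (R1 (L0 T) Y (L1 T X \<rho>))" "k = Cmp C X T TT (R1 Y (L0 T) (\<xi> Y)) (\<eta> X)" for \<rho>' k
      by (simp add: that)
    also have "Cmp C X TT X (Cmp C TT T X \<rho> (R1 (L0 T) Y (L1 T X \<rho>))) (Cmp C X T TT (R1 Y (L0 T) (\<xi> Y)) (\<eta> X))
      = Cmp C X T X \<rho> (Cmp C X T T (Cmp C T TT T (R1 (L0 T) Y (\<epsilon> Y)) (R1 Y (L0 T) (\<xi> Y))) (\<eta> X))"
      unfolding \<rho>_assoc by simp
    also have "Cmp C T TT T (R1 (L0 T) Y (\<epsilon> Y)) (R1 Y (L0 T) (\<xi> Y)) = Idn C T"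
      using arg_cong[OF \<xi>_section[OF Y], of "R1 Y Y"] by (simp add: R.FMap_Cmp)
    also have "Cmp C X T X \<rho> (Cmp C X T T (Idn C T) (\<eta> X)) = Idn C X" using \<rho>_unit by simp
    finally show ?thesis by simp
  qed
  \<comment> \<open>compatibility of \<open>u\<close> with the actions; that of \<open>v\<close> follows as \<open>v\<close> is inverse to \<open>u\<close>\<close>
  have Lu [simp]: "L1 X (R0 N) u \<in> Hom D Y (L0 (R0 N))" and Lv [simp]: "L1 (R0 N) X v \<in> Hom D (L0 (R0 N)) Y"
    and \<epsilon>N [simp]: "\<epsilon> N \<in> Hom D (L0 (R0 N)) N"
    using L.FMap_in_Hom[of X "R0 N" u] L.FMap_in_Hom[of "R0 N" X v] counit_hom[OF N] by simp_all
  have \<epsilon>Lu: "Cmp D Y (L0 (R0 N)) N (\<epsilon> N) (L1 X (R0 N) u) = r"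
  proof -
    have "Cmp D Y (L0 (R0 N)) N (\<epsilon> N) (L1 X (R0 N) u)
      = Cmp D Y (L0 (R0 N)) N (\<epsilon> N) (Cmp D Y (L0 T) (L0 (R0 N)) (L1 T (R0 N) (R1 Y N r)) (L1 X T (\<eta> X)))"
      by (simp add: u_def L.FMap_Cmp)
    also have "\<dots> = Cmp D Y (L0 T) N (Cmp D (L0 T) Y N r (\<epsilon> Y)) (L1 X T (\<eta> X))"
    proof (rule L.cod.Cmp_cong_right)
      show "Cmp D (L0 T) (L0 (R0 N)) N (\<epsilon> N) (L1 T (R0 N) (R1 Y N r)) = Cmp D (L0 T) Y N r (\<epsilon> Y)"
        using counit_natural[OF Y N r] by simp
    qed simp_all
    also have "\<dots> = r" using triangle_L[OF X] by simp
    finally show ?thesis .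
  qed
  have E_in: "FOb (EM_functor \<Phi>) N = (R0 N, R1 (L0 (R0 N)) N (\<epsilon> N))" by (simp add: EM_functor_simps)
  have R_\<epsilon>N [simp]: "R1 (L0 (R0 N)) N (\<epsilon> N) \<in> Hom C (R0 (L0 (R0 N))) (R0 N)"
    and RLu [simp]: "R1 Y (L0 (R0 N)) (L1 X (R0 N) u) \<in> Hom C T (R0 (L0 (R0 N)))"
    and RLv [simp]: "R1 (L0 (R0 N)) Y (L1 (R0 N) X v) \<in> Hom C (R0 (L0 (R0 N))) T"
    using R.FMap_in_Hom[of Y "L0 (R0 N)" "L1 X (R0 N) u"] R.FMap_in_Hom[of "L0 (R0 N)" Y "L1 (R0 N) X v"] by simp_all
  have u_lin: "Cmp C T X (R0 N) u \<rho>
    = Cmp C T (R0 (L0 (R0 N))) (R0 N) (R1 (L0 (R0 N)) N (\<epsilon> N)) (R1 Y (L0 (R0 N)) (L1 X (R0 N) u))"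
    using arg_cong[OF \<epsilon>Lu, of "R1 Y N"] u\<rho> by (simp add: R.FMap_Cmp)
  have RLuv: "Cmp C (R0 (L0 (R0 N))) T (R0 (L0 (R0 N))) (R1 Y (L0 (R0 N)) (L1 X (R0 N) u)) (R1 (L0 (R0 N)) Y (L1 (R0 N) X v))
    = Idn C (R0 (L0 (R0 N)))"
  proof -
    have "Cmp D (L0 (R0 N)) Y (L0 (R0 N)) (L1 X (R0 N) u) (L1 (R0 N) X v) = Idn D (L0 (R0 N))"
      using arg_cong[OF uv, of "L1 (R0 N) (R0 N)"] by (simp add: L.FMap_Cmp)
    from arg_cong[OF this, of "R1 (L0 (R0 N)) (L0 (R0 N))"] show ?thesis by (simp add: R.FMap_Cmp)
  qed
  have v_lin: "Cmp C (R0 (L0 (R0 N))) (R0 N) X v (R1 (L0 (R0 N)) N (\<epsilon> N))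
    = Cmp C (R0 (L0 (R0 N))) T X \<rho> (R1 (L0 (R0 N)) Y (L1 (R0 N) X v))"
  proof -
    have "R1 (L0 (R0 N)) N (\<epsilon> N) = Cmp C (R0 (L0 (R0 N))) T (R0 N)
       (Cmp C T (R0 (L0 (R0 N))) (R0 N) (R1 (L0 (R0 N)) N (\<epsilon> N)) (R1 Y (L0 (R0 N)) (L1 X (R0 N) u)))
       (R1 (L0 (R0 N)) Y (L1 (R0 N) X v))"
      by (simp add: RLuv)
    also have "\<dots> = Cmp C (R0 (L0 (R0 N))) X (R0 N) u (Cmp C (R0 (L0 (R0 N))) T X \<rho> (R1 (L0 (R0 N)) Y (L1 (R0 N) X v)))"
      unfolding u_lin[symmetric] by simp
    finally have "Cmp C (R0 (L0 (R0 N))) (R0 N) X v (R1 (L0 (R0 N)) N (\<epsilon> N))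
      = Cmp C (R0 (L0 (R0 N))) (R0 N) X v \<dots>" by simp
    also have "\<dots> = Cmp C (R0 (L0 (R0 N))) X X (Idn C X)
       (Cmp C (R0 (L0 (R0 N))) T X \<rho> (R1 (L0 (R0 N)) Y (L1 (R0 N) X v)))"
      by (rule L.dom.Cmp_cong_right[OF vu]) simp_all
    finally show ?thesis by simp
  qed
  have "is_isomorphism EM (FOb (EM_functor \<Phi>) N) U v"
    unfolding is_isomorphism_def E_in U_eq
    using u_lin v_lin uv vu by (auto simp: EM_simps intro!: bexI[of _ u])
  then show ?thesis using N by blast
qed

theorem EM_functor_equivalence: "equivalence_of_categories D EM (EM_functor \<Phi>)"
  by (rule equivalence_of_categoriesI[OF EM_functor_is_functor])
    (use EM_functor_faithful EM_functor_full EM_functor_essentially_surjective in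
      \<open>auto simp: EM_functor_simps(2)\<close>)

end

section \<open>Free modules\<close>

text \<open>
  The coordinates are linear because they are unique. Sums over the varying supports are compared by
  enlarging both to a common finite set.
\<close>

lemma free_module_coordinates:
  fixes F :: "('r, 'a, 't) module_scheme"
  assumes "free_module R F"
  obtains B coord where "B \<subseteq> carrier F"
    and "\<And>x b. x \<in> carrier F \<Longrightarrow> b \<in> B \<Longrightarrow> coord x b \<in> carrier R"
    and "\<And>x. x \<in> carrier F \<Longrightarrow> finite {b \<in> B. coord x b \<noteq> \<zero>\<^bsub>R\<^esub>}"
    and "\<And>x. x \<in> carrier F \<Longrightarrow>
      x = (\<Oplus>\<^bsub>F\<^esub> b \<in> {b \<in> B. coord x b \<noteq> \<zero>\<^bsub>R\<^esub>}. coord x b \<odot>\<^bsub>F\<^esub> b)"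
    and "\<And>x y b. x \<in> carrier F \<Longrightarrow> y \<in> carrier F \<Longrightarrow> b \<in> B \<Longrightarrow>
      coord (x \<oplus>\<^bsub>F\<^esub> y) b = coord x b \<oplus>\<^bsub>R\<^esub> coord y b"
    and "\<And>r x b. r \<in> carrier R \<Longrightarrow> x \<in> carrier F \<Longrightarrow> b \<in> B \<Longrightarrow> coord (r \<odot>\<^bsub>F\<^esub> x) b = r \<otimes>\<^bsub>R\<^esub> coord x b"
proof -
  have FM: "module R F" using assms by (simp add: free_module_def)
  interpret F: module R F by fact
  obtain B where B: "B \<subseteq> carrier F" and
    basis: "\<forall>x \<in> carrier F. \<exists>!c. c \<in> B \<rightarrow>\<^sub>E carrier R \<and> finite {b \<in> B. c b \<noteq> \<zero>\<^bsub>R\<^esub>} \<and>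
        x = (\<Oplus>\<^bsub>F\<^esub> b \<in> {b \<in> B. c b \<noteq> \<zero>\<^bsub>R\<^esub>}. c b \<odot>\<^bsub>F\<^esub> b)"
    using assms unfolding free_module_def by (elim conjE exE)
  note uniq = bspec[OF basis]
  have Bc [simp]: "\<And>b. b \<in> B \<Longrightarrow> b \<in> carrier F" using B by auto
  define coord where "coord x = (THE c. c \<in> B \<rightarrow>\<^sub>E carrier R \<and> finite {b \<in> B. c b \<noteq> \<zero>\<^bsub>R\<^esub>} \<and>
        x = (\<Oplus>\<^bsub>F\<^esub> b \<in> {b \<in> B. c b \<noteq> \<zero>\<^bsub>R\<^esub>}. c b \<odot>\<^bsub>F\<^esub> b))" for x
  have coord: "coord x \<in> B \<rightarrow>\<^sub>E carrier R \<and> finite {b \<in> B. coord x b \<noteq> \<zero>\<^bsub>R\<^esub>} \<and>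
        x = (\<Oplus>\<^bsub>F\<^esub> b \<in> {b \<in> B. coord x b \<noteq> \<zero>\<^bsub>R\<^esub>}. coord x b \<odot>\<^bsub>F\<^esub> b)" if "x \<in> carrier F" for x
    unfolding coord_def by (rule theI'[OF uniq[OF that]])
  have closed [simp]: "coord x b \<in> carrier R" if "x \<in> carrier F" "b \<in> B" for x b
    using coord[OF that(1)] that(2) by auto
  have extend: "(\<Oplus>\<^bsub>F\<^esub> b \<in> {b \<in> B. c b \<noteq> \<zero>\<^bsub>R\<^esub>}. c b \<odot>\<^bsub>F\<^esub> b) = (\<Oplus>\<^bsub>F\<^esub> b \<in> S. c b \<odot>\<^bsub>F\<^esub> b)"
    if "finite S" "{b \<in> B. c b \<noteq> \<zero>\<^bsub>R\<^esub>} \<subseteq> S" "S \<subseteq> B" "\<And>b. b \<in> B \<Longrightarrow> c b \<in> carrier R" for c S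
  proof (rule F.M.add.finprod_mono_neutral_cong_left)
    show "c b \<odot>\<^bsub>F\<^esub> b = \<zero>\<^bsub>F\<^esub>" if "b \<in> S - {b \<in> B. c b \<noteq> \<zero>\<^bsub>R\<^esub>}" for b
    proof -
      have "b \<in> B" "c b = \<zero>\<^bsub>R\<^esub>" using that \<open>S \<subseteq> B\<close> by auto
      then show ?thesis by simp
    qed
  qed (use that in \<open>auto simp: subset_iff\<close>)
  have coord_eq: "coord x b = c b"
    if x: "x \<in> carrier F" and b: "b \<in> B" and c: "\<And>b. b \<in> B \<Longrightarrow> c b \<in> carrier R"
      and S: "finite S" "{b \<in> B. c b \<noteq> \<zero>\<^bsub>R\<^esub>} \<subseteq> S" "S \<subseteq> B"
      and sum: "x = (\<Oplus>\<^bsub>F\<^esub> b \<in> S. c b \<odot>\<^bsub>F\<^esub> b)" for x c S b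
  proof -
    let ?c = "restrict c B"
    have eq: "{b \<in> B. ?c b \<noteq> \<zero>\<^bsub>R\<^esub>} = {b \<in> B. c b \<noteq> \<zero>\<^bsub>R\<^esub>}" by auto
    have "(\<Oplus>\<^bsub>F\<^esub> b \<in> {b \<in> B. ?c b \<noteq> \<zero>\<^bsub>R\<^esub>}. ?c b \<odot>\<^bsub>F\<^esub> b) = (\<Oplus>\<^bsub>F\<^esub> b \<in> S. ?c b \<odot>\<^bsub>F\<^esub> b)"
      by (rule extend) (use S c eq in auto)
    also have "\<dots> = x" unfolding sum
      by (rule F.M.finsum_cong') (use S c in \<open>auto simp: subset_iff\<close>)
    finally have c': "?c \<in> B \<rightarrow>\<^sub>E carrier R \<and> finite {b \<in> B. ?c b \<noteq> \<zero>\<^bsub>R\<^esub>} \<and>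
        x = (\<Oplus>\<^bsub>F\<^esub> b \<in> {b \<in> B. ?c b \<noteq> \<zero>\<^bsub>R\<^esub>}. ?c b \<odot>\<^bsub>F\<^esub> b)"
      using c S(1,2) eq by (simp add: finite_subset)
    have "coord x = ?c" unfolding coord_def
      by (rule the1_equality) (fact uniq[OF x], fact c')
    then show ?thesis using b by (metis restrict_apply')
  qed
  have coord_add: "coord (x \<oplus>\<^bsub>F\<^esub> y) b = coord x b \<oplus>\<^bsub>R\<^esub> coord y b"
    if x: "x \<in> carrier F" and y: "y \<in> carrier F" and b: "b \<in> B" for x y b
  proof (rule coord_eq[OF _ b])
    let ?S = "{b \<in> B. coord x b \<noteq> \<zero>\<^bsub>R\<^esub>} \<union> {b \<in> B. coord y b \<noteq> \<zero>\<^bsub>R\<^esub>}"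
    show S: "finite ?S" using coord[OF x] coord[OF y] by simp
    have "x = (\<Oplus>\<^bsub>F\<^esub> b \<in> ?S. coord x b \<odot>\<^bsub>F\<^esub> b)" "y = (\<Oplus>\<^bsub>F\<^esub> b \<in> ?S. coord y b \<odot>\<^bsub>F\<^esub> b)"
      using coord[OF x] coord[OF y] extend[of ?S "coord x"] extend[of ?S "coord y"] S x y by auto
    then have "x \<oplus>\<^bsub>F\<^esub> y = (\<Oplus>\<^bsub>F\<^esub> b \<in> ?S. coord x b \<odot>\<^bsub>F\<^esub> b) \<oplus>\<^bsub>F\<^esub> (\<Oplus>\<^bsub>F\<^esub> b \<in> ?S. coord y b \<odot>\<^bsub>F\<^esub> b)" by simp
    also have "\<dots> = (\<Oplus>\<^bsub>F\<^esub> b \<in> ?S. coord x b \<odot>\<^bsub>F\<^esub> b \<oplus>\<^bsub>F\<^esub> coord y b \<odot>\<^bsub>F\<^esub> b)"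
      by (rule F.M.finsum_addf[symmetric]) (use x y in auto)
    also have "\<dots> = (\<Oplus>\<^bsub>F\<^esub> b \<in> ?S. (coord x b \<oplus>\<^bsub>R\<^esub> coord y b) \<odot>\<^bsub>F\<^esub> b)"
      by (rule F.M.finsum_cong') (use x y in \<open>auto simp: F.smult_l_distr\<close>)
    finally show "x \<oplus>\<^bsub>F\<^esub> y = (\<Oplus>\<^bsub>F\<^esub> b \<in> ?S. (coord x b \<oplus>\<^bsub>R\<^esub> coord y b) \<odot>\<^bsub>F\<^esub> b)" .
  qed (use x y in auto)
  have coord_smult: "coord (r \<odot>\<^bsub>F\<^esub> x) b = r \<otimes>\<^bsub>R\<^esub> coord x b"
    if r: "r \<in> carrier R" and x: "x \<in> carrier F" and b: "b \<in> B" for r x b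
  proof (rule coord_eq[OF _ b])
    let ?S = "{b \<in> B. coord x b \<noteq> \<zero>\<^bsub>R\<^esub>}"
    show S: "finite ?S" using coord[OF x] by simp
    have "r \<odot>\<^bsub>F\<^esub> x = r \<odot>\<^bsub>F\<^esub> (\<Oplus>\<^bsub>F\<^esub> b \<in> ?S. coord x b \<odot>\<^bsub>F\<^esub> b)" using coord[OF x] by simp
    also have "\<dots> = (\<Oplus>\<^bsub>F\<^esub> b \<in> ?S. r \<odot>\<^bsub>F\<^esub> (coord x b \<odot>\<^bsub>F\<^esub> b))"
      by (rule F.finsum_smult_ldistr[OF S r]) (use x in auto)
    also have "\<dots> = (\<Oplus>\<^bsub>F\<^esub> b \<in> ?S. (r \<otimes>\<^bsub>R\<^esub> coord x b) \<odot>\<^bsub>F\<^esub> b)"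
      by (rule F.M.finsum_cong') (use x r in \<open>auto simp: F.smult_assoc1\<close>)
    finally show "r \<odot>\<^bsub>F\<^esub> x = (\<Oplus>\<^bsub>F\<^esub> b \<in> ?S. (r \<otimes>\<^bsub>R\<^esub> coord x b) \<odot>\<^bsub>F\<^esub> b)" .
  qed (use x r in auto)
  have fin: "finite {b \<in> B. coord x b \<noteq> \<zero>\<^bsub>R\<^esub>}"
    and sum: "x = (\<Oplus>\<^bsub>F\<^esub> b \<in> {b \<in> B. coord x b \<noteq> \<zero>\<^bsub>R\<^esub>}. coord x b \<odot>\<^bsub>F\<^esub> b)"
    if "x \<in> carrier F" for x
    by (fact conjunct1[OF conjunct2[OF coord[OF that]]], fact conjunct2[OF conjunct2[OF coord[OF that]]])
  show ?thesis by (rule that[of B coord]) (fact B closed fin sum coord_add coord_smult)+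
qed

lemma free_module_lift:
  assumes F: "free_module R F" and M: "module R M" and N: "module R N"
    and q: "q \<in> module_homs R M N" "q ` carrier M = carrier N" and f: "f \<in> module_homs R F N"
  obtains g where "g \<in> module_homs R F M" "\<And>x. x \<in> carrier F \<Longrightarrow> q (g x) = f x"
proof -
  have FM: "module R F" using F by (simp add: free_module_def)
  interpret F: module R F by fact
  interpret M: module R M by fact
  interpret N: module R N by fact
  obtain B coord where B: "B \<subseteq> carrier F"
    and closed [simp]: "\<And>x b. x \<in> carrier F \<Longrightarrow> b \<in> B \<Longrightarrow> coord x b \<in> carrier R"
    and fin: "\<And>x. x \<in> carrier F \<Longrightarrow> finite {b \<in> B. coord x b \<noteq> \<zero>\<^bsub>R\<^esub>}"
    and sum: "\<And>x. x \<in> carrier F \<Longrightarrow>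
      x = (\<Oplus>\<^bsub>F\<^esub> b \<in> {b \<in> B. coord x b \<noteq> \<zero>\<^bsub>R\<^esub>}. coord x b \<odot>\<^bsub>F\<^esub> b)"
    and add: "\<And>x y b. x \<in> carrier F \<Longrightarrow> y \<in> carrier F \<Longrightarrow> b \<in> B \<Longrightarrow>
      coord (x \<oplus>\<^bsub>F\<^esub> y) b = coord x b \<oplus>\<^bsub>R\<^esub> coord y b"
    and smult: "\<And>r x b. r \<in> carrier R \<Longrightarrow> x \<in> carrier F \<Longrightarrow> b \<in> B \<Longrightarrow> coord (r \<odot>\<^bsub>F\<^esub> x) b = r \<otimes>\<^bsub>R\<^esub> coord x b"
    by (rule free_module_coordinates[OF F]) (rule that)
  have Bc [simp]: "\<And>b. b \<in> B \<Longrightarrow> b \<in> carrier F" using B by auto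
  have "\<forall>b. \<exists>m. b \<in> B \<longrightarrow> m \<in> carrier M \<and> q m = f b"
    using q(2) hom_closed[OF f] B by (metis Bc imageE)
  then obtain m where m: "\<And>b. b \<in> B \<Longrightarrow> m b \<in> carrier M" "\<And>b. b \<in> B \<Longrightarrow> q (m b) = f b" by metis
  let ?supp = "\<lambda>x. {b \<in> B. coord x b \<noteq> \<zero>\<^bsub>R\<^esub>}"
  define g where "g x = (\<Oplus>\<^bsub>M\<^esub> b \<in> ?supp x. coord x b \<odot>\<^bsub>M\<^esub> m b)" for x
  have g_eq: "g x = (\<Oplus>\<^bsub>M\<^esub> b \<in> S. coord x b \<odot>\<^bsub>M\<^esub> m b)"
    if "x \<in> carrier F" "finite S" "?supp x \<subseteq> S" "S \<subseteq> B" for x S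
    unfolding g_def
  proof (rule M.M.add.finprod_mono_neutral_cong_left)
    show "coord x b \<odot>\<^bsub>M\<^esub> m b = \<zero>\<^bsub>M\<^esub>" if "b \<in> S - ?supp x" for b
    proof -
      have "b \<in> B" "coord x b = \<zero>\<^bsub>R\<^esub>" using that \<open>S \<subseteq> B\<close> by auto
      then show ?thesis using m by simp
    qed
  qed (use that m in \<open>auto simp: subset_iff\<close>)
  have gc: "g x \<in> carrier M" if "x \<in> carrier F" for x
    unfolding g_def using that m by (intro M.M.finsum_closed) auto
  have "restrict g (carrier F) \<in> module_homs R F M"
  proof (rule restrict_module_homsI[OF FM])
    fix x assume x: "x \<in> carrier F"
    show "g x \<in> carrier M" by (rule gc[OF x])
    { fix r assume r: "r \<in> carrier R"
      have "g (r \<odot>\<^bsub>F\<^esub> x) = (\<Oplus>\<^bsub>M\<^esub> b \<in> ?supp x. coord (r \<odot>\<^bsub>F\<^esub> x) b \<odot>\<^bsub>M\<^esub> m b)"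
        by (rule g_eq) (use r x fin in \<open>auto simp: smult\<close>)
      also have "\<dots> = (\<Oplus>\<^bsub>M\<^esub> b \<in> ?supp x. r \<odot>\<^bsub>M\<^esub> (coord x b \<odot>\<^bsub>M\<^esub> m b))"
        by (rule M.M.finsum_cong') (use r x m in \<open>auto simp: smult M.smult_assoc1\<close>)
      also have "\<dots> = r \<odot>\<^bsub>M\<^esub> g x" unfolding g_def
        by (rule M.finsum_smult_ldistr[symmetric]) (use r x m fin in auto)
      finally show "g (r \<odot>\<^bsub>F\<^esub> x) = r \<odot>\<^bsub>M\<^esub> g x" . }
    fix y assume y: "y \<in> carrier F"
    let ?S = "?supp x \<union> ?supp y"
    have S: "finite ?S" using fin x y by simp
    have "g (x \<oplus>\<^bsub>F\<^esub> y) = (\<Oplus>\<^bsub>M\<^esub> b \<in> ?S. coord (x \<oplus>\<^bsub>F\<^esub> y) b \<odot>\<^bsub>M\<^esub> m b)"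
      by (rule g_eq) (use x y fin in \<open>auto simp: add\<close>)
    also have "\<dots> = (\<Oplus>\<^bsub>M\<^esub> b \<in> ?S. coord x b \<odot>\<^bsub>M\<^esub> m b \<oplus>\<^bsub>M\<^esub> coord y b \<odot>\<^bsub>M\<^esub> m b)"
      by (rule M.M.finsum_cong') (use x y m in \<open>auto simp: add M.smult_l_distr\<close>)
    also have "\<dots> = (\<Oplus>\<^bsub>M\<^esub> b \<in> ?S. coord x b \<odot>\<^bsub>M\<^esub> m b) \<oplus>\<^bsub>M\<^esub> (\<Oplus>\<^bsub>M\<^esub> b \<in> ?S. coord y b \<odot>\<^bsub>M\<^esub> m b)"
      by (rule M.M.finsum_addf) (use x y m in auto)
    also have "\<dots> = g x \<oplus>\<^bsub>M\<^esub> g y"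
      using g_eq[OF x S] g_eq[OF y S] by simp
    finally show "g (x \<oplus>\<^bsub>F\<^esub> y) = g x \<oplus>\<^bsub>M\<^esub> g y" .
  qed
  moreover have "q (restrict g (carrier F) x) = f x" if x: "x \<in> carrier F" for x
  proof -
    have "q (g x) = (\<Oplus>\<^bsub>N\<^esub> b \<in> ?supp x. q (coord x b \<odot>\<^bsub>M\<^esub> m b))"
      unfolding g_def by (rule hom_finsum[OF M N q(1) fin[OF x]]) (use x m in auto)
    also have "\<dots> = (\<Oplus>\<^bsub>N\<^esub> b \<in> ?supp x. f (coord x b \<odot>\<^bsub>F\<^esub> b))"
      by (rule N.M.finsum_cong') (use x m hom_closed[OF f] in \<open>auto simp: hom_smult[OF q(1)] hom_smult[OF f]\<close>)
    also have "\<dots> = f (\<Oplus>\<^bsub>F\<^esub> b \<in> ?supp x. coord x b \<odot>\<^bsub>F\<^esub> b)"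
      by (rule hom_finsum[OF FM N f fin[OF x], symmetric]) (use x in auto)
    also have "\<dots> = f x" using sum[OF x] by simp
    finally show ?thesis using x by simp
  qed
  ultimately show ?thesis using that by blast
qed

text \<open>
  If no coordinate of \<open>1\<close> were a unit, all of them would be multiples of the nilpotent \<open>t\<close>, so
  \<open>1 = \<phi>(t) y\<close> and \<open>1 = \<phi>(t\<^sup>n) y\<^sup>n = 0\<close>. Otherwise rescale a coordinate function that is a unit
  at \<open>1\<close>.
\<close>

lemma (in coinduction) linear_retraction:
  assumes free: "free_module R scalars" and one: "\<one>\<^bsub>S\<^esub> \<noteq> \<zero>\<^bsub>S\<^esub>"
    and t: "t \<in> carrier R" "t [^]\<^bsub>R\<^esub> (n :: nat) = \<zero>\<^bsub>R\<^esub>"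
    and local: "\<And>r. r \<in> carrier R \<Longrightarrow> r \<in> Units R \<or> (\<exists>d \<in> carrier R. r = t \<otimes>\<^bsub>R\<^esub> d)"
  obtains \<pi> where "\<pi> \<in> module_homs R scalars (regular_module R)" "\<pi> \<one>\<^bsub>S\<^esub> = \<one>\<^bsub>R\<^esub>"
proof -
  interpret F: module R scalars using scalars_module .
  obtain B coord where B: "B \<subseteq> carrier scalars"
    and closed [simp]: "\<And>x b. x \<in> carrier scalars \<Longrightarrow> b \<in> B \<Longrightarrow> coord x b \<in> carrier R"
    and fin: "\<And>x. x \<in> carrier scalars \<Longrightarrow> finite {b \<in> B. coord x b \<noteq> \<zero>\<^bsub>R\<^esub>}"
    and sum: "\<And>x. x \<in> carrier scalars \<Longrightarrow>
      x = (\<Oplus>\<^bsub>scalars\<^esub> b \<in> {b \<in> B. coord x b \<noteq> \<zero>\<^bsub>R\<^esub>}. coord x b \<odot>\<^bsub>scalars\<^esub> b)"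
    and add: "\<And>x y b. x \<in> carrier scalars \<Longrightarrow> y \<in> carrier scalars \<Longrightarrow> b \<in> B \<Longrightarrow>
      coord (x \<oplus>\<^bsub>scalars\<^esub> y) b = coord x b \<oplus>\<^bsub>R\<^esub> coord y b"
    and smult: "\<And>r x b. r \<in> carrier R \<Longrightarrow> x \<in> carrier scalars \<Longrightarrow> b \<in> B \<Longrightarrow>
      coord (r \<odot>\<^bsub>scalars\<^esub> x) b = r \<otimes>\<^bsub>R\<^esub> coord x b"
    by (rule free_module_coordinates[OF free]) (rule that)
  let ?supp = "{b \<in> B. coord \<one>\<^bsub>S\<^esub> b \<noteq> \<zero>\<^bsub>R\<^esub>}"
  have "\<exists>b \<in> B. coord \<one>\<^bsub>S\<^esub> b \<in> Units R"
  proof (rule ccontr)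
    assume "\<not> (\<exists>b \<in> B. coord \<one>\<^bsub>S\<^esub> b \<in> Units R)"
    then have "\<forall>b. \<exists>d. b \<in> B \<longrightarrow> d \<in> carrier R \<and> coord \<one>\<^bsub>S\<^esub> b = t \<otimes>\<^bsub>R\<^esub> d"
      using local closed[of "\<one>\<^bsub>S\<^esub>"] by (metis S.one_closed regular_module_simps(1) restrict_scalars_simps(1))
    then obtain d where d: "\<And>b. b \<in> B \<Longrightarrow> d b \<in> carrier R" "\<And>b. b \<in> B \<Longrightarrow> coord \<one>\<^bsub>S\<^esub> b = t \<otimes>\<^bsub>R\<^esub> d b"
      by metis
    define y where "y = (\<Oplus>\<^bsub>scalars\<^esub> b \<in> ?supp. d b \<odot>\<^bsub>scalars\<^esub> b)"
    have dB: "(\<lambda>b. d b \<odot>\<^bsub>scalars\<^esub> b) \<in> ?supp \<rightarrow> carrier scalars"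
      using d B by auto
    have y: "y \<in> carrier scalars" unfolding y_def by (rule F.M.finsum_closed[OF dB])
    have "\<one>\<^bsub>S\<^esub> = (\<Oplus>\<^bsub>scalars\<^esub> b \<in> ?supp. coord \<one>\<^bsub>S\<^esub> b \<odot>\<^bsub>scalars\<^esub> b)" using sum[of "\<one>\<^bsub>S\<^esub>"] by simp
    also have "\<dots> = (\<Oplus>\<^bsub>scalars\<^esub> b \<in> ?supp. t \<odot>\<^bsub>scalars\<^esub> (d b \<odot>\<^bsub>scalars\<^esub> b))"
    proof (rule F.M.finsum_cong')
      fix b assume "b \<in> ?supp"
      then have b: "b \<in> B" "b \<in> carrier scalars" using B by auto
      show "coord \<one>\<^bsub>S\<^esub> b \<odot>\<^bsub>scalars\<^esub> b = t \<odot>\<^bsub>scalars\<^esub> (d b \<odot>\<^bsub>scalars\<^esub> b)"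
        unfolding d(2)[OF b(1)] by (rule F.smult_assoc1[OF t(1) d(1)[OF b(1)] b(2)])
    qed (use dB t in auto)
    also have "\<dots> = t \<odot>\<^bsub>scalars\<^esub> y"
      unfolding y_def by (rule F.finsum_smult_ldistr[OF fin t(1) dB, symmetric]) simp
    finally have 1: "\<one>\<^bsub>S\<^esub> = \<phi> t \<otimes>\<^bsub>S\<^esub> y" by simp
    have "\<one>\<^bsub>S\<^esub> = \<phi> (t [^]\<^bsub>R\<^esub> k) \<otimes>\<^bsub>S\<^esub> y [^]\<^bsub>S\<^esub> k" for k :: nat
    proof (induction k)
      case 0 then show ?case using ring_hom_one[OF ring_hom] by simp
    next
      case (Suc k)
      have c: "\<phi> t \<in> carrier S" "\<phi> (t [^]\<^bsub>R\<^esub> k) \<in> carrier S" "y \<in> carrier S" "y [^]\<^bsub>S\<^esub> k \<in> carrier S"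
        using t y by auto
      have "\<one>\<^bsub>S\<^esub> = (\<phi> (t [^]\<^bsub>R\<^esub> k) \<otimes>\<^bsub>S\<^esub> y [^]\<^bsub>S\<^esub> k) \<otimes>\<^bsub>S\<^esub> (\<phi> t \<otimes>\<^bsub>S\<^esub> y)"
        using Suc 1 by (metis S.r_one S.one_closed)
      also have "\<dots> = (\<phi> (t [^]\<^bsub>R\<^esub> k) \<otimes>\<^bsub>S\<^esub> \<phi> t) \<otimes>\<^bsub>S\<^esub> (y [^]\<^bsub>S\<^esub> k \<otimes>\<^bsub>S\<^esub> y)"
        using c by (simp add: S.m_ac)
      finally show ?case using t by (simp add: ring_hom_mult[OF ring_hom])
    qed
    from this[of n] have "\<one>\<^bsub>S\<^esub> = \<phi> \<zero>\<^bsub>R\<^esub> \<otimes>\<^bsub>S\<^esub> y [^]\<^bsub>S\<^esub> n" using t by simp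
    moreover have "\<phi> \<zero>\<^bsub>R\<^esub> = \<zero>\<^bsub>S\<^esub>"
      using ring_hom_zero[OF ring_hom R.ring_axioms S.ring_axioms] .
    ultimately show False using one y by simp
  qed
  then obtain b where b: "b \<in> B" "coord \<one>\<^bsub>S\<^esub> b \<in> Units R" by blast
  define c where "c = inv\<^bsub>R\<^esub> (coord \<one>\<^bsub>S\<^esub> b)"
  have c: "c \<in> carrier R" "c \<otimes>\<^bsub>R\<^esub> coord \<one>\<^bsub>S\<^esub> b = \<one>\<^bsub>R\<^esub>" using b by (auto simp: c_def)
  let ?p = "\<lambda>x \<in> carrier scalars. c \<otimes>\<^bsub>R\<^esub> coord x b"
  have "?p \<in> module_homs R scalars (regular_module R)"
  proof (rule restrict_module_homsI[OF scalars_module])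
    fix x assume x: "x \<in> carrier scalars"
    show "c \<otimes>\<^bsub>R\<^esub> coord x b \<in> carrier (regular_module R)" using x b c closed[of x b] by simp
    { fix r assume r: "r \<in> carrier R"
      show "c \<otimes>\<^bsub>R\<^esub> coord (r \<odot>\<^bsub>scalars\<^esub> x) b = r \<odot>\<^bsub>regular_module R\<^esub> (c \<otimes>\<^bsub>R\<^esub> coord x b)"
        unfolding smult[OF r x b(1)] using closed[OF x b(1)] c r by (simp add: R.m_lcomm) }
    fix y assume y: "y \<in> carrier scalars"
    show "c \<otimes>\<^bsub>R\<^esub> coord (x \<oplus>\<^bsub>scalars\<^esub> y) b = c \<otimes>\<^bsub>R\<^esub> coord x b \<oplus>\<^bsub>regular_module R\<^esub> c \<otimes>\<^bsub>R\<^esub> coord y b"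
      unfolding add[OF x y b(1)] using closed[OF x b(1)] closed[OF y b(1)] c by (simp add: R.r_distr)
  qed
  then show ?thesis using that[of ?p] c by simp
qed

section \<open>Restriction and coinduction on stable categories\<close>

text \<open>
  The encoding of functions on \<open>R\<close> is a parameter, while functions on \<open>S\<close> are encoded by \<open>Fun\<close>. In this
  way modules over \<open>R\<close> and over \<open>S\<close> have their elements in one universe, as the two functors require.
\<close>

locale res_coind =
  A: frobenius_algebra K R \<iota>\<^sub>R encR decR \<theta>\<^sub>R I\<^sub>R b\<^sub>R b'\<^sub>R +
  B: frobenius_algebra K S \<iota>\<^sub>S "Fun :: ('s \<Rightarrow> ('s, 'v) univ) \<Rightarrow> ('s, 'v) univ" app \<theta>\<^sub>S I\<^sub>S b\<^sub>S b'\<^sub>S +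
  F: coinduction R S \<phi> "Fun :: ('s \<Rightarrow> ('s, 'v) univ) \<Rightarrow> ('s, 'v) univ" app
  for K :: "('k, 'x) ring_scheme" and R :: "('r, 'z) ring_scheme" and S :: "('s, 'w) ring_scheme"
    and \<iota>\<^sub>R and encR :: "('r \<Rightarrow> ('s, 'v) univ) \<Rightarrow> ('s, 'v) univ" and decR
    and \<theta>\<^sub>R and I\<^sub>R :: "'i set" and b\<^sub>R b'\<^sub>R
    and \<iota>\<^sub>S and \<theta>\<^sub>S and I\<^sub>S :: "'j set" and b\<^sub>S b'\<^sub>S and \<phi> +
  assumes free: "free_module R (restrict_scalars \<phi> (regular_module S))"
begin

abbreviation res :: "('s, 'c) module \<Rightarrow> ('r, 'c) module"
  where "res \<equiv> restrict_scalars \<phi>"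

lemma res_module: "module S M \<Longrightarrow> module R (res M)"
  by (rule restrict_scalars_module[OF F.ring_hom A.R.cring_axioms])

lemma res_hom: "f \<in> module_homs S M N \<Longrightarrow> f \<in> module_homs R (res M) (res N)"
  by (rule restrict_scalars_hom[OF F.ring_hom])

lemma coinduced_map_apply:
  "u \<in> carrier (F.coind M) \<Longrightarrow> coinduced_map R S \<phi> M f u = Fun (compose (carrier S) f (app u))"
  by (simp add: coinduced_map_def coinduced_module_eq_hom_module)

lemma app_coinduced_map [simp]:
  "u \<in> carrier (F.coind M) \<Longrightarrow> a \<in> carrier S \<Longrightarrow> app (coinduced_map R S \<phi> M f u) a = f (app u a)"
  by (simp add: coinduced_map_apply compose_eq)

lemma coinduced_map_hom:
  assumes M: "module R M" and N: "module R N" and f: "f \<in> module_homs R M N"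
  shows "coinduced_map R S \<phi> M f \<in> module_homs S (F.coind M) (F.coind N)"
proof -
  interpret CM: module S "F.coind M" using F.coind_module[OF M] .
  interpret CN: module S "F.coind N" using F.coind_module[OF N] .
  have cl: "coinduced_map R S \<phi> M f u \<in> carrier (F.coind N)" if "u \<in> carrier (F.coind M)" for u
    using hom_compose[OF F.scalars_module F.dec_hom[OF that] f] that
    by (simp add: coinduced_map_apply F.coind_closed)
  show ?thesis
  proof (rule module_homsI)
    fix u v assume uv: "u \<in> carrier (F.coind M)" "v \<in> carrier (F.coind M)"
    show "coinduced_map R S \<phi> M f (u \<oplus>\<^bsub>F.coind M\<^esub> v)
      = coinduced_map R S \<phi> M f u \<oplus>\<^bsub>F.coind N\<^esub> coinduced_map R S \<phi> M f v"
      by (rule F.coind_eqI[of _ N]) (use uv cl in \<open>simp_all add: hom_add[OF f]\<close>)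
  next
    fix a u assume au: "a \<in> carrier S" "u \<in> carrier (F.coind M)"
    show "coinduced_map R S \<phi> M f (a \<odot>\<^bsub>F.coind M\<^esub> u) = a \<odot>\<^bsub>F.coind N\<^esub> coinduced_map R S \<phi> M f u"
      by (rule F.coind_eqI[of _ N]) (use au cl in simp_all)
  qed (use cl in \<open>simp_all add: coinduced_map_def coinduced_module_eq_hom_module\<close>)
qed

text \<open>
  By adjunction, a lifting problem for the restriction of \<open>P\<close> becomes one for \<open>P\<close> against a coinduced
  map, which is surjective because \<open>S\<close> is free over \<open>R\<close>.
\<close>

lemma res_projective:
  fixes P :: "('s, ('s, 'v) univ) module"
  assumes "projective_module S P"
  shows "projective_module R (res P)"
proof -
  have P: "module S P" using assms by (simp add: projective_module_def)
  interpret P: module S P by fact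
  have "\<exists>g \<in> module_homs R (res P) M. compose (carrier (res P)) q g = f"
    if M: "module R M" and N: "module R N" and q: "q \<in> module_homs R M N" "q ` carrier M = carrier N"
      and f: "f \<in> module_homs R (res P) N"
    for M N :: "('r, ('s, 'v) univ) module" and q f
  proof -
    let ?cq = "coinduced_map R S \<phi> M q"
    have cq: "?cq \<in> module_homs S (F.coind M) (F.coind N)" by (rule coinduced_map_hom[OF M N q(1)])
    have "?cq ` carrier (F.coind M) = carrier (F.coind N)"
    proof (intro equalityI subsetI)
      fix u assume u: "u \<in> carrier (F.coind N)"
      obtain g where g: "g \<in> module_homs R F.scalars M" "\<And>a. a \<in> carrier F.scalars \<Longrightarrow> q (g a) = app u a"
        by (rule free_module_lift[OF free M N q F.dec_hom[OF u]]) (rule that)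
      have gM: "Fun g \<in> carrier (F.coind M)" by (rule F.coind_closed[OF g(1)])
      have "?cq (Fun g) = u"
        by (rule F.coind_eqI[of _ N]) (use u gM g(2) hom_closed[OF cq gM] in simp_all)
      then show "u \<in> ?cq ` carrier (F.coind M)" using gM by blast
    qed (use hom_closed[OF cq] in auto)
    moreover have "F.transpose P f \<in> module_homs S P (F.coind N)"
      by (rule F.transpose_hom[OF P N f])
    ultimately obtain g where g: "g \<in> module_homs S P (F.coind M)" "compose (carrier P) ?cq g = F.transpose P f"
      using assms F.coind_module[OF M] F.coind_module[OF N] cq unfolding projective_module_def by blast
    let ?ev = "\<lambda>u \<in> carrier (F.coind M). app u \<one>\<^bsub>S\<^esub>"
    have h: "compose (carrier (res P)) ?ev g \<in> module_homs R (res P) M"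
      by (rule hom_compose[OF res_module[OF P] res_hom[OF g(1)] F.evaluation_hom[OF M B.R.one_closed]])
    have "q (app (g x) \<one>\<^bsub>S\<^esub>) = f x" if x: "x \<in> carrier P" for x
      using arg_cong[OF fun_cong[OF g(2), of x], of "\<lambda>u. app u \<one>\<^bsub>S\<^esub>"] x hom_closed[OF g(1) x]
      by (simp add: compose_eq)
    then have "compose (carrier (res P)) q (compose (carrier (res P)) ?ev g) = f"
      using hom_closed[OF g(1)] hom_extensional[OF f]
      by (intro extensionalityI[of _ "carrier P"]) (auto simp: compose_eq compose_def)
    then show ?thesis using h by blast
  qed
  then show ?thesis using res_module[OF P] unfolding projective_module_def by blast
qed

text \<open>
  By adjunction, the coinduced module inherits from \<open>P\<close> the extension property along injections, and
  over a Frobenius algebra this property and projectivity agree.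
\<close>

lemma coind_projective:
  fixes P :: "('r, ('s, 'v) univ) module"
  assumes "projective_module R P"
  shows "projective_module S (F.coind P)"
proof -
  have P: "module R P" using assms by (simp add: projective_module_def)
  have C: "module S (F.coind P)" by (rule F.coind_module[OF P])
  interpret C: module S "F.coind P" by fact
  have "B.trace_split (F.coind P)"
  proof (rule B.extension_property_imp_trace_split[OF C])
    fix i assume i: "i \<in> module_homs S (F.coind P) (B.cofree (F.coind P))" "inj_on i (carrier (F.coind P))"
    let ?J = "B.cofree (F.coind P)"
    have J: "module S ?J" by (rule B.cofree_module[OF C])
    let ?ev = "\<lambda>u \<in> carrier (F.coind P). app u \<one>\<^bsub>S\<^esub>"
    have "\<exists>g \<in> module_homs R (res ?J) P. compose (carrier (res (F.coind P))) g i = ?ev"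
    proof (rule A.trace_split_extend[OF P res_module[OF C] res_module[OF J] _ res_hom[OF i(1)]])
      show "A.trace_split P" using A.projective_iff_trace_split[OF P] assms by blast
    qed (use i(2) F.evaluation_hom[OF P B.R.one_closed] in simp_all)
    then obtain g where g: "g \<in> module_homs R (res ?J) P" "compose (carrier (F.coind P)) g i = ?ev" by auto
    have gi: "g (i u) = app u \<one>\<^bsub>S\<^esub>" if "u \<in> carrier (F.coind P)" for u
      using fun_cong[OF g(2), of u] that by (simp add: compose_eq)
    have gt: "F.transpose ?J g \<in> module_homs S ?J (F.coind P)" by (rule F.transpose_hom[OF J P g(1)])
    have "F.transpose ?J g (i u) = u" if u: "u \<in> carrier (F.coind P)" for u
    proof (rule F.coind_eqI[of _ P])
      fix a assume a: "a \<in> carrier S"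
      have "app (F.transpose ?J g (i u)) a = g (a \<odot>\<^bsub>?J\<^esub> i u)"
        using F.dec_transpose[OF hom_closed[OF i(1) u] a] .
      also have "\<dots> = g (i (a \<odot>\<^bsub>F.coind P\<^esub> u))" using hom_smult[OF i(1) a u] by simp
      also have "\<dots> = app u a" using gi[OF C.smult_closed[OF a u]] a by simp
      finally show "app (F.transpose ?J g (i u)) a = app u a" .
    qed (use u hom_closed[OF gt hom_closed[OF i(1) u]] in simp_all)
    then have "compose (carrier (F.coind P)) (F.transpose ?J g) i = (\<lambda>u \<in> carrier (F.coind P). u)"
      by (auto simp: compose_def)
    then show "\<exists>g \<in> module_homs S ?J (F.coind P).
        compose (carrier (F.coind P)) g i = (\<lambda>u \<in> carrier (F.coind P). u)"
      using gt by blast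
  qed
  then show ?thesis using B.projective_iff_trace_split[OF C] by blast
qed

sublocale Res: stable_functor_data S "TYPE(('s, 'v) univ)" R "TYPE(('s, 'v) univ)" res "\<lambda>M N f. f"
  by (intro stable_functor_data.intro stable_functor_data_axioms.intro
      A.stable_module_category_axioms B.stable_module_category_axioms)
    (simp_all add: res_module res_hom res_projective)

lemma coinduced_map_id:
  assumes M: "module R M"
  shows "coinduced_map R S \<phi> M (\<lambda>x \<in> carrier M. x) = (\<lambda>u \<in> carrier (F.coind M). u)"
proof (rule hom_eqI[OF coinduced_map_hom[OF M M hom_id[OF M]] hom_id[OF F.coind_module[OF M]]])
  fix u assume u: "u \<in> carrier (F.coind M)"
  show "coinduced_map R S \<phi> M (\<lambda>x \<in> carrier M. x) u = (\<lambda>u \<in> carrier (F.coind M). u) u"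
    by (rule F.coind_eqI[of _ M])
      (use u hom_closed[OF coinduced_map_hom[OF M M hom_id[OF M]] u] in simp_all)
qed

lemma coinduced_map_compose:
  fixes M N :: "('r, ('s, 'v) univ) module"
  assumes L: "module R L" and M: "module R M" and N: "module R N"
    and f: "f \<in> module_homs R L M" and g: "g \<in> module_homs R M N"
  shows "coinduced_map R S \<phi> L (compose (carrier L) g f)
    = compose (carrier (F.coind L)) (coinduced_map R S \<phi> M g) (coinduced_map R S \<phi> L f)"
proof -
  note gf = hom_compose[OF L f g]
  note cgf = hom_compose[OF F.coind_module[OF L] coinduced_map_hom[OF L M f] coinduced_map_hom[OF M N g]]
  show ?thesis
  proof (rule hom_eqI[OF coinduced_map_hom[OF L N gf] cgf])
    fix u assume u: "u \<in> carrier (F.coind L)"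
    show "coinduced_map R S \<phi> L (compose (carrier L) g f) u
      = compose (carrier (F.coind L)) (coinduced_map R S \<phi> M g) (coinduced_map R S \<phi> L f) u"
      by (rule F.coind_eqI[of _ N])
        (use u hom_closed[OF coinduced_map_hom[OF L N gf] u] hom_closed[OF cgf u]
          hom_closed[OF coinduced_map_hom[OF L M f] u] in \<open>simp_all add: compose_eq\<close>)
  qed
qed

lemma coinduced_map_diff:
  fixes M N :: "('r, ('s, 'v) univ) module"
  assumes M: "module R M" and N: "module R N"
    and f: "f \<in> module_homs R M N" and g: "g \<in> module_homs R M N"
  shows "coinduced_map R S \<phi> M (\<lambda>x \<in> carrier M. f x \<ominus>\<^bsub>N\<^esub> g x)
    = (\<lambda>u \<in> carrier (F.coind M). coinduced_map R S \<phi> M f u \<ominus>\<^bsub>F.coind N\<^esub> coinduced_map R S \<phi> M g u)"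
proof -
  note cf = coinduced_map_hom[OF M N f] and cg = coinduced_map_hom[OF M N g]
  note d = hom_diff_map[OF M N f g]
  note d' = hom_diff_map[OF F.coind_module[OF M] F.coind_module[OF N] cf cg]
  show ?thesis
  proof (rule hom_eqI[OF coinduced_map_hom[OF M N d] d'])
    fix u assume u: "u \<in> carrier (F.coind M)"
    note cl = hom_closed[OF cf u] hom_closed[OF cg u]
    let ?ev = "\<lambda>a. \<lambda>u \<in> carrier (F.coind N). app u a"
    show "coinduced_map R S \<phi> M (\<lambda>x \<in> carrier M. f x \<ominus>\<^bsub>N\<^esub> g x) u
      = (\<lambda>u \<in> carrier (F.coind M). coinduced_map R S \<phi> M f u \<ominus>\<^bsub>F.coind N\<^esub> coinduced_map R S \<phi> M g u) u"
    proof (rule F.coind_eqI[of _ N])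
      fix a assume a: "a \<in> carrier S"
      have "?ev a (coinduced_map R S \<phi> M f u \<ominus>\<^bsub>res (F.coind N)\<^esub> coinduced_map R S \<phi> M g u)
        = ?ev a (coinduced_map R S \<phi> M f u) \<ominus>\<^bsub>N\<^esub> ?ev a (coinduced_map R S \<phi> M g u)"
        by (rule hom_diff[OF res_module[OF F.coind_module[OF N]] N F.evaluation_hom[OF N a]]) (simp_all add: cl)
      then show "app (coinduced_map R S \<phi> M (\<lambda>x \<in> carrier M. f x \<ominus>\<^bsub>N\<^esub> g x) u) a
        = app ((\<lambda>u \<in> carrier (F.coind M). coinduced_map R S \<phi> M f u \<ominus>\<^bsub>F.coind N\<^esub> coinduced_map R S \<phi> M g u) u) a"
        using u a cl hom_closed[OF d' u] by simp
    qed (use u hom_closed[OF coinduced_map_hom[OF M N d] u] hom_closed[OF d' u] in simp_all)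
  qed
qed

sublocale CoInd: stable_functor_data R "TYPE(('s, 'v) univ)" S "TYPE(('s, 'v) univ)"
  F.coind "\<lambda>M N. coinduced_map R S \<phi> M"
  by (intro stable_functor_data.intro stable_functor_data_axioms.intro
      A.stable_module_category_axioms B.stable_module_category_axioms)
    (fact F.coind_module coinduced_map_hom coinduced_map_id coinduced_map_compose
      coinduced_map_diff coind_projective)+

lemma Res_eq: "Res R \<phi> = Res.stable_functor"
  by (simp add: Res_def Res.stable_functor_def)

lemma CoInd_eq: "CoInd R S \<phi> = CoInd.stable_functor"
  by (simp add: CoInd_def CoInd.stable_functor_def coinduced_module_eq_hom_module fun_eq_iff)

definition unit_rep :: "('s, ('s, 'v) univ) module \<Rightarrow> ('s, 'v) univ \<Rightarrow> ('s, 'v) univ"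
  where "unit_rep M = (\<lambda>x \<in> carrier M. Fun (\<lambda>a \<in> carrier S. a \<odot>\<^bsub>M\<^esub> x))"

definition counit_rep :: "('r, ('s, 'v) univ) module \<Rightarrow> ('s, 'v) univ \<Rightarrow> ('s, 'v) univ"
  where "counit_rep N = (\<lambda>u \<in> carrier (F.coind N). app u \<one>\<^bsub>S\<^esub>)"

lemma unit_rep_hom:
  assumes M: "module S M"
  shows "unit_rep M \<in> module_homs S M (F.coind (res M))"
proof -
  interpret M: module S M by fact
  have "unit_rep M = F.transpose M (\<lambda>x \<in> carrier M. x)"
    unfolding unit_rep_def F.transpose_def by (intro restrict_ext arg_cong[of _ _ Fun]) simp
  then show ?thesis
    using F.transpose_hom[OF M res_module[OF M] res_hom[OF hom_id[OF M]]] by simp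
qed

lemma counit_rep_hom: "module R N \<Longrightarrow> counit_rep N \<in> module_homs R (res (F.coind N)) N"
  unfolding counit_rep_def by (rule F.evaluation_hom[OF _ B.R.one_closed])

abbreviation \<Phi> where "\<Phi> \<equiv> Res_CoInd R S \<phi>"

lemma Res_CoInd_simps [simp]:
  "Lft \<Phi> = Res.stable_functor"
  "Rgt \<Phi> = CoInd.stable_functor"
  "unt \<Phi> M = stable_class S M (F.coind (res M)) (unit_rep M)"
  "cnt \<Phi> N = stable_class R (res (F.coind N)) N (counit_rep N)"
  by (simp_all add: Res_CoInd_def Res_eq CoInd_eq coinduced_module_eq_hom_module unit_rep_def counit_rep_def)

lemmas stable_simps =
  Res.FMap_stable_class CoInd.FMap_stable_class A.Cmp_stable_class B.Cmp_stable_class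
  A.Idn_Stab B.Idn_Stab A.stable_class_Hom B.stable_class_Hom
  res_module res_hom F.coind_module coinduced_map_hom unit_rep_hom counit_rep_hom
  hom_compose hom_id

lemma counit_natural_rep:
  assumes M: "module R M" and N: "module R N" and f: "f \<in> module_homs R M N"
  shows "compose (carrier (F.coind M)) (counit_rep N) (coinduced_map R S \<phi> M f)
    = compose (carrier (F.coind M)) f (counit_rep M)"
  unfolding compose_def
  by (rule restrict_ext) (use hom_closed[OF coinduced_map_hom[OF M N f]] in \<open>simp add: counit_rep_def\<close>)

lemma adjunction_Res_CoInd:
  "adjunction (Stab S :: (('s, ('s, 'v) univ) module, _) cat) (Stab R :: (('r, ('s, 'v) univ) module, _) cat) \<Phi>"
proof -
  let ?C = "Stab S :: (('s, ('s, 'v) univ) module, (('s, 'v) univ \<Rightarrow> ('s, 'v) univ) set) cat"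
  let ?D = "Stab R :: (('r, ('s, 'v) univ) module, (('s, 'v) univ \<Rightarrow> ('s, 'v) univ) set) cat"
  have L: "cat_functor ?C ?D Res.stable_functor" by (rule Res.cat_functor_stable)
  have R: "cat_functor ?D ?C CoInd.stable_functor" by (rule CoInd.cat_functor_stable)
  have idC: "cat_functor ?C ?C id_cfun" and idD: "cat_functor ?D ?D id_cfun"
    by (auto intro!: cat_functor.intro cat_functor_axioms.intro A.category_Stab B.category_Stab simp: id_cfun_def)
  have RL: "cat_functor ?C ?C (comp_cfun CoInd.stable_functor Res.stable_functor)"
    and LR: "cat_functor ?D ?D (comp_cfun Res.stable_functor CoInd.stable_functor)"
    using L R unfolding cat_functor_def cat_functor_axioms_def comp_cfun_def by simp_all
  have "natural_transformation ?C ?C id_cfun (comp_cfun (Rgt \<Phi>) (Lft \<Phi>)) (unt \<Phi>)"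
    unfolding natural_transformation_def
  proof (intro conjI ballI)
    fix X assume "X \<in> Ob ?C"
    then have X: "module S X" by simp
    interpret X: module S X by fact
    show "unt \<Phi> X \<in> Hom ?C (FOb id_cfun X) (FOb (comp_cfun (Rgt \<Phi>) (Lft \<Phi>)) X)"
      using X by (simp add: id_cfun_def comp_cfun_def stable_simps)
    fix Y f assume "Y \<in> Ob ?C" "f \<in> Hom ?C X Y"
    then obtain f' where Y: "module S Y" and f': "f' \<in> module_homs S X Y" "f = stable_class S X Y f'"
      by (auto simp: B.Hom_Stab)
    interpret Y: module S Y by fact
    note cX = hom_closed[OF unit_rep_hom[OF X]] and cY = hom_closed[OF unit_rep_hom[OF Y]]
    have "compose (carrier X) (unit_rep Y) f'
      = compose (carrier X) (coinduced_map R S \<phi> (res X) f') (unit_rep X)"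
      unfolding compose_def
    proof (rule restrict_ext)
      fix x assume x: "x \<in> carrier X"
      note fx = hom_closed[OF f'(1) x]
      show "unit_rep Y (f' x) = coinduced_map R S \<phi> (res X) f' (unit_rep X x)"
        by (rule F.coind_eqI[OF cY[OF fx]
              hom_closed[OF coinduced_map_hom[OF res_module[OF X] res_module[OF Y] res_hom[OF f'(1)]] cX[OF x]]])
          (use x fx cX[OF x] in \<open>simp_all add: unit_rep_def hom_smult[OF f'(1)]\<close>)
    qed
    then show "Cmp ?C (FOb id_cfun X) (FOb id_cfun Y) (FOb (comp_cfun (Rgt \<Phi>) (Lft \<Phi>)) Y) (unt \<Phi> Y) (FMap id_cfun X Y f)
      = Cmp ?C (FOb id_cfun X) (FOb (comp_cfun (Rgt \<Phi>) (Lft \<Phi>)) X) (FOb (comp_cfun (Rgt \<Phi>) (Lft \<Phi>)) Y)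
          (FMap (comp_cfun (Rgt \<Phi>) (Lft \<Phi>)) X Y f) (unt \<Phi> X)"
      using X Y f' by (simp add: id_cfun_def comp_cfun_def stable_simps)
  qed (use idC RL in simp_all)
  moreover have "natural_transformation ?D ?D (comp_cfun (Lft \<Phi>) (Rgt \<Phi>)) id_cfun (cnt \<Phi>)"
    unfolding natural_transformation_def
  proof (intro conjI ballI)
    fix X assume "X \<in> Ob ?D"
    then have X: "module R X" by simp
    show "cnt \<Phi> X \<in> Hom ?D (FOb (comp_cfun (Lft \<Phi>) (Rgt \<Phi>)) X) (FOb id_cfun X)"
      using X by (simp add: id_cfun_def comp_cfun_def stable_simps)
    fix Y f assume "Y \<in> Ob ?D" "f \<in> Hom ?D X Y"
    then obtain f' where Y: "module R Y" and f': "f' \<in> module_homs R X Y" "f = stable_class R X Y f'"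
      by (auto simp: A.Hom_Stab)
    show "Cmp ?D (FOb (comp_cfun (Lft \<Phi>) (Rgt \<Phi>)) X) (FOb (comp_cfun (Lft \<Phi>) (Rgt \<Phi>)) Y) (FOb id_cfun Y)
        (cnt \<Phi> Y) (FMap (comp_cfun (Lft \<Phi>) (Rgt \<Phi>)) X Y f)
      = Cmp ?D (FOb (comp_cfun (Lft \<Phi>) (Rgt \<Phi>)) X) (FOb id_cfun X) (FOb id_cfun Y) (FMap id_cfun X Y f) (cnt \<Phi> X)"
      using X Y f' counit_natural_rep[OF X Y f'(1)]
      by (simp add: id_cfun_def comp_cfun_def stable_simps)
  qed (use idD LR in simp_all)
  moreover have "Cmp ?D (res X) (res (F.coind (res X))) (res X) (cnt \<Phi> (res X))
      (FMap (Lft \<Phi>) X (F.coind (res X)) (unt \<Phi> X)) = Idn ?D (res X)" if X: "module S X" for X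
  proof -
    interpret X: module S X by fact
    have "compose (carrier X) (counit_rep (res X)) (unit_rep X) = (\<lambda>x \<in> carrier X. x)"
      unfolding compose_def
    proof (rule restrict_ext)
      fix x assume x: "x \<in> carrier X"
      show "counit_rep (res X) (unit_rep X x) = x"
        using hom_closed[OF unit_rep_hom[OF X] x] x by (simp add: counit_rep_def) (simp add: unit_rep_def)
    qed
    then show ?thesis using X by (simp add: stable_simps)
  qed
  moreover have "Cmp ?C (F.coind Z) (F.coind (res (F.coind Z))) (F.coind Z)
      (FMap (Rgt \<Phi>) (res (F.coind Z)) Z (cnt \<Phi> Z)) (unt \<Phi> (F.coind Z)) = Idn ?C (F.coind Z)"
    if Z: "module R Z" for Z
  proof -
    have CZ: "module S (F.coind Z)" by (rule F.coind_module[OF Z])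
    interpret CZ: module S "F.coind Z" by fact
    note un = unit_rep_hom[OF CZ]
      and co = coinduced_map_hom[OF res_module[OF CZ] Z counit_rep_hom[OF Z]]
    have "compose (carrier (F.coind Z)) (coinduced_map R S \<phi> (res (F.coind Z)) (counit_rep Z)) (unit_rep (F.coind Z))
      = (\<lambda>x \<in> carrier (F.coind Z). x)"
      unfolding compose_def
    proof (rule restrict_ext)
      fix u assume u: "u \<in> carrier (F.coind Z)"
      show "coinduced_map R S \<phi> (res (F.coind Z)) (counit_rep Z) (unit_rep (F.coind Z) u) = u"
      proof (rule F.coind_eqI[OF hom_closed[OF co hom_closed[OF un u]] u])
        fix a assume a: "a \<in> carrier S"
        have "app (coinduced_map R S \<phi> (res (F.coind Z)) (counit_rep Z) (unit_rep (F.coind Z) u)) a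
          = counit_rep Z (app (unit_rep (F.coind Z) u) a)"
          by (rule app_coinduced_map[OF hom_closed[OF un u] a])
        also have "app (unit_rep (F.coind Z) u) a = a \<odot>\<^bsub>F.coind Z\<^esub> u"
          using u a by (simp add: unit_rep_def)
        also have "counit_rep Z \<dots> = app u a"
          using u a by (simp add: counit_rep_def)
        finally show "app (coinduced_map R S \<phi> (res (F.coind Z)) (counit_rep Z) (unit_rep (F.coind Z) u)) a = app u a" .
      qed
    qed
    then show ?thesis using Z CZ by (simp add: stable_simps)
  qed
  ultimately show ?thesis
    using L R unfolding adjunction_def Let_def by simp
qed

text \<open>
  As \<open>S\<close> is commutative, \<open>\<pi>\<close> is linear for both actions of \<open>R\<close> on \<open>S\<close>, so that \<open>x \<mapsto> (a \<mapsto> \<pi>(a) x)\<close>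
  lands in the coinduced module and is itself linear.
\<close>

definition section_rep ::
  "('s \<Rightarrow> 'r) \<Rightarrow> ('r, ('s, 'v) univ) module \<Rightarrow> ('s, 'v) univ \<Rightarrow> ('s, 'v) univ"
  where "section_rep \<pi> N = (\<lambda>x \<in> carrier N. Fun (\<lambda>a \<in> carrier S. \<pi> a \<odot>\<^bsub>N\<^esub> x))"

context
  fixes \<pi>
  assumes \<pi>: "\<pi> \<in> module_homs R F.scalars (regular_module R)" and \<pi>_one: "\<pi> \<one>\<^bsub>S\<^esub> = \<one>\<^bsub>R\<^esub>"
begin

lemma \<pi>_simps: "a \<in> carrier S \<Longrightarrow> \<pi> a \<in> carrier R"
  "a \<in> carrier S \<Longrightarrow> c \<in> carrier S \<Longrightarrow> \<pi> (a \<oplus>\<^bsub>S\<^esub> c) = \<pi> a \<oplus>\<^bsub>R\<^esub> \<pi> c"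
  "r \<in> carrier R \<Longrightarrow> a \<in> carrier S \<Longrightarrow> \<pi> (\<phi> r \<otimes>\<^bsub>S\<^esub> a) = r \<otimes>\<^bsub>R\<^esub> \<pi> a"
  using hom_closed[OF \<pi>, of a] hom_add[OF \<pi>, of a c] hom_smult[OF \<pi>, of r a] by simp_all

lemma section_rep_hom:
  assumes N: "module R N"
  shows "section_rep \<pi> N \<in> module_homs R N (res (F.coind N))"
proof -
  interpret N: module R N by fact
  interpret C: module S "F.coind N" using F.coind_module[OF N] .
  have cl: "section_rep \<pi> N x \<in> carrier (F.coind N)" if x: "x \<in> carrier N" for x
  proof -
    have "Fun (\<lambda>a \<in> carrier S. \<pi> a \<odot>\<^bsub>N\<^esub> x) \<in> carrier (F.coind N)"
      by (rule F.enc_restrict_closed) (use x in \<open>simp_all add: \<pi>_simps N.smult_l_distr N.smult_assoc1\<close>)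
    then show ?thesis using x by (simp add: section_rep_def)
  qed
  have ap: "app (section_rep \<pi> N x) a = \<pi> a \<odot>\<^bsub>N\<^esub> x" if "x \<in> carrier N" "a \<in> carrier S" for x a
    using that by (simp add: section_rep_def)
  show ?thesis
  proof (rule module_homsI)
    fix x y assume xy: "x \<in> carrier N" "y \<in> carrier N"
    show "section_rep \<pi> N (x \<oplus>\<^bsub>N\<^esub> y) = section_rep \<pi> N x \<oplus>\<^bsub>res (F.coind N)\<^esub> section_rep \<pi> N y"
      by (rule F.coind_eqI[of _ N]) (use xy cl in \<open>simp_all add: ap \<pi>_simps N.smult_r_distr\<close>)
  next
    fix r x assume r: "r \<in> carrier R" and x: "x \<in> carrier N"
    show "section_rep \<pi> N (r \<odot>\<^bsub>N\<^esub> x) = r \<odot>\<^bsub>res (F.coind N)\<^esub> section_rep \<pi> N x"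
    proof (rule F.coind_eqI[of _ N])
      fix a assume a: "a \<in> carrier S"
      have "app (section_rep \<pi> N (r \<odot>\<^bsub>N\<^esub> x)) a = (\<pi> a \<otimes>\<^bsub>R\<^esub> r) \<odot>\<^bsub>N\<^esub> x"
        using a r x by (simp add: ap \<pi>_simps N.smult_assoc1)
      also have "\<pi> a \<otimes>\<^bsub>R\<^esub> r = \<pi> (\<phi> r \<otimes>\<^bsub>S\<^esub> a)"
        using a r by (simp add: \<pi>_simps A.R.m_comm)
      also have "\<phi> r \<otimes>\<^bsub>S\<^esub> a = a \<otimes>\<^bsub>S\<^esub> \<phi> r"
        using a r by (simp add: B.R.m_comm)
      finally show "app (section_rep \<pi> N (r \<odot>\<^bsub>N\<^esub> x)) a = app (r \<odot>\<^bsub>res (F.coind N)\<^esub> section_rep \<pi> N x) a"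
        using a r x by (simp add: ap)
    qed (use r x cl in simp_all)
  qed (use cl in \<open>simp_all add: section_rep_def\<close>)
qed

lemma counit_section: 
  assumes "module R N"
  shows "compose (carrier N) (counit_rep N) (section_rep \<pi> N) = (\<lambda>x \<in> carrier N. x)"
  unfolding compose_def
proof (rule restrict_ext)
  interpret N: module R N by fact
  fix x assume x: "x \<in> carrier N"
  show "counit_rep N (section_rep \<pi> N x) = x"
    using hom_closed[OF section_rep_hom[OF assms] x] x
    by (simp add: counit_rep_def) (simp add: section_rep_def \<pi>_one)
qed

lemma section_natural:
  "natural_transformation (Stab R :: (('r, ('s, 'v) univ) module, _) cat) (Stab R) id_cfun
    (comp_cfun (Lft \<Phi>) (Rgt \<Phi>)) (\<lambda>N. stable_class R N (res (F.coind N)) (section_rep \<pi> N))"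
  unfolding natural_transformation_def
proof (intro conjI ballI)
  let ?D = "Stab R :: (('r, ('s, 'v) univ) module, (('s, 'v) univ \<Rightarrow> ('s, 'v) univ) set) cat"
  show "cat_functor ?D ?D id_cfun"
    by (auto intro!: cat_functor.intro cat_functor_axioms.intro A.category_Stab simp: id_cfun_def)
  show "cat_functor ?D ?D (comp_cfun (Lft \<Phi>) (Rgt \<Phi>))"
    using Res.cat_functor_stable CoInd.cat_functor_stable
    unfolding cat_functor_def cat_functor_axioms_def comp_cfun_def by simp
  fix X assume "X \<in> Ob ?D"
  then have X: "module R X" by simp
  interpret X: module R X by fact
  show "stable_class R X (res (F.coind X)) (section_rep \<pi> X)
      \<in> Hom ?D (FOb id_cfun X) (FOb (comp_cfun (Lft \<Phi>) (Rgt \<Phi>)) X)"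
    using X by (simp add: id_cfun_def comp_cfun_def stable_simps section_rep_hom)
  fix Y f assume "Y \<in> Ob ?D" "f \<in> Hom ?D X Y"
  then obtain f' where Y: "module R Y" and f': "f' \<in> module_homs R X Y" "f = stable_class R X Y f'"
    by (auto simp: A.Hom_Stab)
  interpret Y: module R Y by fact
  note cX = hom_closed[OF section_rep_hom[OF X], simplified] and cY = hom_closed[OF section_rep_hom[OF Y], simplified]
  have "compose (carrier X) (section_rep \<pi> Y) f'
    = compose (carrier X) (coinduced_map R S \<phi> X f') (section_rep \<pi> X)"
    unfolding compose_def
  proof (rule restrict_ext)
    fix x assume x: "x \<in> carrier X"
    note fx = hom_closed[OF f'(1) x]
    show "section_rep \<pi> Y (f' x) = coinduced_map R S \<phi> X f' (section_rep \<pi> X x)"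
      by (rule F.coind_eqI[OF cY[OF fx] hom_closed[OF coinduced_map_hom[OF X Y f'(1)] cX[OF x]]])
        (use x fx cX[OF x] in \<open>simp_all add: section_rep_def \<pi>_simps hom_smult[OF f'(1)]\<close>)
  qed
  then show "Cmp ?D (FOb id_cfun X) (FOb id_cfun Y) (FOb (comp_cfun (Lft \<Phi>) (Rgt \<Phi>)) Y)
      (stable_class R Y (res (F.coind Y)) (section_rep \<pi> Y)) (FMap id_cfun X Y f)
    = Cmp ?D (FOb id_cfun X) (FOb (comp_cfun (Lft \<Phi>) (Rgt \<Phi>)) X) (FOb (comp_cfun (Lft \<Phi>) (Rgt \<Phi>)) Y)
        (FMap (comp_cfun (Lft \<Phi>) (Rgt \<Phi>)) X Y f) (stable_class R X (res (F.coind X)) (section_rep \<pi> X))"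
    using X Y f' by (simp add: id_cfun_def comp_cfun_def stable_simps section_rep_hom)
qed

end

end

section \<open>Splitting idempotents\<close>

locale commuting_endomorphisms = abelian_group G
  for G :: "('a, 'b) ring_scheme" (structure) +
  fixes f g :: "'a \<Rightarrow> 'a"
  assumes f_closed: "x \<in> carrier G \<Longrightarrow> f x \<in> carrier G"
    and g_closed: "x \<in> carrier G \<Longrightarrow> g x \<in> carrier G"
    and f_add: "x \<in> carrier G \<Longrightarrow> y \<in> carrier G \<Longrightarrow> f (x \<oplus> y) = f x \<oplus> f y"
    and g_add: "x \<in> carrier G \<Longrightarrow> y \<in> carrier G \<Longrightarrow> g (x \<oplus> y) = g x \<oplus> g y"
    and commute: "x \<in> carrier G \<Longrightarrow> f (g x) = g (f x)"
begin

lemma f_pow_closed: "x \<in> carrier G \<Longrightarrow> (f ^^ n) x \<in> carrier G"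
  and g_pow_closed: "x \<in> carrier G \<Longrightarrow> (g ^^ n) x \<in> carrier G"
  by (induction n) (auto simp: f_closed g_closed)

lemma f_pow_add: "x \<in> carrier G \<Longrightarrow> y \<in> carrier G \<Longrightarrow> (f ^^ n) (x \<oplus> y) = (f ^^ n) x \<oplus> (f ^^ n) y"
  and g_pow_add: "x \<in> carrier G \<Longrightarrow> y \<in> carrier G \<Longrightarrow> (g ^^ n) (x \<oplus> y) = (g ^^ n) x \<oplus> (g ^^ n) y"
  by (induction n) (auto simp: f_pow_closed g_pow_closed f_add g_add)

lemma pow_commute_one: "x \<in> carrier G \<Longrightarrow> (f ^^ n) (g x) = g ((f ^^ n) x)"
  by (induction n) (auto simp: f_pow_closed commute)

lemma pow_commute: "x \<in> carrier G \<Longrightarrow> (f ^^ n) ((g ^^ m) x) = (g ^^ m) ((f ^^ n) x)"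
  by (induction m) (auto simp: g_pow_closed pow_commute_one)

lemma additive_add_pow:
  assumes "\<And>x. x \<in> carrier G \<Longrightarrow> h x \<in> carrier G"
    and "\<And>x y. x \<in> carrier G \<Longrightarrow> y \<in> carrier G \<Longrightarrow> h (x \<oplus> y) = h x \<oplus> h y"
    and x: "x \<in> carrier G"
  shows "h (add_pow G (k :: nat) x) = add_pow G k (h x)"
proof (induction k)
  case 0
  have "h \<zero> \<oplus> h \<zero> = h \<zero>" using assms(2)[of \<zero> \<zero>] by simp
  then have "h \<zero> = \<zero>" using assms(1)[of \<zero>] by (metis add.r_cancel_one zero_closed)
  then show ?case by simp
next
  case (Suc k)
  then show ?case using assms x by (simp add: add.nat_pow_Suc)
qed

text \<open>
  The binomial theorem in the ring of endomorphisms of an abelian group, written with iterates so that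
  it applies to maps given only on the carrier.
\<close>

lemma binomial_expansion:
  assumes x: "x \<in> carrier G"
  shows "((\<lambda>x. f x \<oplus> g x) ^^ n) x = (\<Oplus>i\<in>{..n}. add_pow G (n choose i) ((f ^^ i) ((g ^^ (n - i)) x)))"
proof (induction n)
  case 0
  then show ?case using x by simp
next
  case (Suc n)
  note [simp] = f_pow_closed g_pow_closed f_closed g_closed x
  define T where "T k i = add_pow G k ((f ^^ i) ((g ^^ (Suc n - i)) x))" for k i :: nat
  have T [simp]: "T k i \<in> carrier G" for k i by (simp add: T_def)
  have T_add: "T (k + l) i = T k i \<oplus> T l i" for k l i
    by (simp add: T_def add.nat_pow_mult)
  define s where "s = (\<Oplus>i\<in>{..n}. add_pow G (n choose i) ((f ^^ i) ((g ^^ (n - i)) x)))"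
  have s: "s \<in> carrier G" unfolding s_def by (rule finsum_closed) auto
  have fs: "f s = (\<Oplus>i\<in>{..n}. T (n choose i) (Suc i))"
  proof -
    have "f s = (\<Oplus>i\<in>{..n}. f (add_pow G (n choose i) ((f ^^ i) ((g ^^ (n - i)) x))))"
      unfolding s_def by (rule additive_finsum[OF abelian_group_axioms abelian_group_axioms]) (auto simp: f_add)
    also have "\<dots> = (\<Oplus>i\<in>{..n}. T (n choose i) (Suc i))"
      by (rule finsum_cong') (auto simp: T_def additive_add_pow[of f] f_add)
    finally show ?thesis .
  qed
  have gs: "g s = (\<Oplus>i\<in>{..n}. T (n choose i) i)"
  proof -
    have "g s = (\<Oplus>i\<in>{..n}. g (add_pow G (n choose i) ((f ^^ i) ((g ^^ (n - i)) x))))"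
      unfolding s_def by (rule additive_finsum[OF abelian_group_axioms abelian_group_axioms]) (auto simp: g_add)
    also have "\<dots> = (\<Oplus>i\<in>{..n}. T (n choose i) i)"
      by (rule finsum_cong') (auto simp: T_def additive_add_pow[of g] g_add Suc_diff_le pow_commute_one)
    finally show ?thesis .
  qed
  have "(\<Oplus>i\<in>{..n}. T (n choose i) i) = (\<Oplus>i\<in>{..Suc n}. T (n choose i) i)"
    by (subst finsum_Suc) (simp_all add: T_def[of 0] Pi_def finsum_closed binomial_eq_0)
  also have "\<dots> = (\<Oplus>i\<in>{..n}. T (n choose Suc i) (Suc i)) \<oplus> T 1 0"
    by (subst finsum_Suc2) simp_all
  finally have "f s \<oplus> g s = (\<Oplus>i\<in>{..n}. T (n choose i) (Suc i)) \<oplus> (\<Oplus>i\<in>{..n}. T (n choose Suc i) (Suc i)) \<oplus> T 1 0"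
    unfolding fs gs by (simp add: a_assoc finsum_closed)
  also have "\<dots> = (\<Oplus>i\<in>{..n}. T (Suc n choose Suc i) (Suc i)) \<oplus> T 1 0"
    by (simp add: T_add finsum_addf Pi_def)
  also have "\<dots> = (\<Oplus>i\<in>{..Suc n}. T (Suc n choose i) i)"
    by (subst finsum_Suc2) simp_all
  finally have "f s \<oplus> g s = (\<Oplus>i\<in>{..Suc n}. T (Suc n choose i) i)" .
  then show ?case using Suc by (simp add: s_def T_def)
qed

lemma freshmans_dream:
  assumes p: "prime p" and char: "\<And>x. x \<in> carrier G \<Longrightarrow> add_pow G p x = \<zero>" and x: "x \<in> carrier G"
  shows "((\<lambda>x. f x \<oplus> g x) ^^ p) x = (f ^^ p) x \<oplus> (g ^^ p) x"
proof -
  note [simp] = f_pow_closed g_pow_closed f_closed g_closed x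
  let ?T = "\<lambda>i. add_pow G (p choose i) ((f ^^ i) ((g ^^ (p - i)) x))"
  have p0: "p > 0" using p by (rule prime_gt_0_nat)
  have "?T i = \<zero>" if "i \<in> {..p} - {0, p}" for i
  proof -
    have "p dvd (p choose i)" using that by (intro dvd_choose_prime p) auto
    then obtain k where "p choose i = p * k" by (auto simp: dvd_def)
    then show ?thesis using char by (simp add: add.nat_pow_pow[symmetric])
  qed
  then have "(\<Oplus>i\<in>{..p}. ?T i) = (\<Oplus>i\<in>{0, p}. ?T i)"
    by (intro add.finprod_mono_neutral_cong_right) auto
  also have "\<dots> = (f ^^ p) x \<oplus> (g ^^ p) x"
    using p0 by (simp add: a_comm)
  finally show ?thesis using binomial_expansion[OF x, of p] by simp
qed

lemma freshmans_dream_power: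
  assumes p: "prime p" and char: "\<And>x. x \<in> carrier G \<Longrightarrow> add_pow G p x = \<zero>" and x: "x \<in> carrier G"
  shows "((\<lambda>x. f x \<oplus> g x) ^^ (p ^ k)) x = (f ^^ (p ^ k)) x \<oplus> (g ^^ (p ^ k)) x"
  using x
proof (induction k arbitrary: x)
  case (Suc k)
  let ?h = "(\<lambda>x. f x \<oplus> g x) ^^ (p ^ k)" and ?h' = "\<lambda>x. (f ^^ (p ^ k)) x \<oplus> (g ^^ (p ^ k)) x"
  interpret pow: commuting_endomorphisms G "f ^^ (p ^ k)" "g ^^ (p ^ k)"
    by unfold_locales (simp_all add: f_pow_closed g_pow_closed f_pow_add g_pow_add pow_commute)
  have "(?h ^^ m) x = (?h' ^^ m) x \<and> (?h' ^^ m) x \<in> carrier G" for m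
    by (induction m) (use Suc f_pow_closed g_pow_closed in auto)
  then have "((\<lambda>x. f x \<oplus> g x) ^^ (p ^ k * p)) x = (?h' ^^ p) x"
    unfolding funpow_mult[symmetric] by simp
  also have "\<dots> = ((f ^^ (p ^ k)) ^^ p) x \<oplus> ((g ^^ (p ^ k)) ^^ p) x"
    by (rule pow.freshmans_dream[OF p char Suc.prems])
  finally show ?case by (simp add: funpow_mult mult.commute)
qed simp

end

text \<open>
  The features of the group algebra of a cyclic group of order \<open>p\<close> in characteristic \<open>p\<close>: with
  \<open>t = \<sigma> - 1\<close>, which is nilpotent, every group element is congruent to \<open>1\<close> modulo \<open>t\<close>, and \<open>t\<close>
  annihilates the sum of all group elements.
\<close>

locale local_frobenius_algebra = frobenius_algebra K R \<iota> enc dec \<theta> I b b'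
  for K :: "('k, 'x) ring_scheme" and R :: "('r, 'z) ring_scheme" and \<iota>
    and enc :: "('r \<Rightarrow> 'u) \<Rightarrow> 'u" and dec and \<theta> and I :: "'i set" and b b' +
  fixes t :: 'r and n p :: nat
  assumes t_closed: "t \<in> carrier R" and t_nilpotent: "t [^]\<^bsub>R\<^esub> n = \<zero>\<^bsub>R\<^esub>"
    and b_unipotent: "i \<in> I \<Longrightarrow> \<exists>d \<in> carrier R. b i = \<one>\<^bsub>R\<^esub> \<oplus>\<^bsub>R\<^esub> t \<otimes>\<^bsub>R\<^esub> d"
    and b'_unipotent: "i \<in> I \<Longrightarrow> \<exists>d \<in> carrier R. b' i = \<one>\<^bsub>R\<^esub> \<oplus>\<^bsub>R\<^esub> t \<otimes>\<^bsub>R\<^esub> d"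
    and norm_sym: "(\<Oplus>\<^bsub>R\<^esub> i \<in> I. b i) = (\<Oplus>\<^bsub>R\<^esub> i \<in> I. b' i)"
    and t_norm: "t \<otimes>\<^bsub>R\<^esub> (\<Oplus>\<^bsub>R\<^esub> i \<in> I. b i) = \<zero>\<^bsub>R\<^esub>"
    and prime_p: "prime p" and char_p: "add_pow R p \<one>\<^bsub>R\<^esub> = \<zero>\<^bsub>R\<^esub>"
begin

definition norm_element where "norm_element = (\<Oplus>\<^bsub>R\<^esub> i \<in> I. b i)"

lemma norm_closed [simp]: "norm_element \<in> carrier R"
  unfolding norm_element_def using b_closed by (intro R.finsum_closed) auto

lemma norm_eq: "norm_element = (\<Oplus>\<^bsub>R\<^esub> i \<in> I. b' i)"
  unfolding norm_element_def by (rule norm_sym)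

lemma module_char_p:
  assumes "module R M" "x \<in> carrier M"
  shows "add_pow M p x = \<zero>\<^bsub>M\<^esub>"
proof -
  interpret M: module R M by fact
  have "add_pow R (k :: nat) \<one>\<^bsub>R\<^esub> \<odot>\<^bsub>M\<^esub> x = add_pow M k x" for k
    by (induction k) (use assms(2) in \<open>simp_all add: M.smult_l_distr R.add.nat_pow_Suc M.M.add.nat_pow_Suc\<close>)
  from this[of p] show ?thesis using char_p assms(2) by simp
qed

text \<open>
  The Tate cohomology of a projective module vanishes in degree \<open>-1\<close>: if the identity is the trace of
  \<open>h\<close>, then modulo \<open>t P\<close> one has \<open>x = (\<Sum>i. b i h(b' i x)) = (\<Sum>i. h(b' i x)) = h(N x)\<close>, where \<open>N\<close> is
  the norm element.
\<close>

lemma norm_kernel: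
  assumes P: "module R P" and "trace_split P" and x: "x \<in> carrier P" and \<nu>x: "norm_element \<odot>\<^bsub>P\<^esub> x = \<zero>\<^bsub>P\<^esub>"
  shows "\<exists>y \<in> carrier P. x = t \<odot>\<^bsub>P\<^esub> y"
proof -
  interpret P: module R P by fact
  note [simp] = b_closed b'_closed finite_I t_closed
  obtain h where h: "h \<in> module_homs K (lin P) (lin P)" "trace P P h = (\<lambda>x \<in> carrier P. x)"
    using assms(2) by (auto simp: trace_split_def)
  note hc [simp] = hom_closed[OF h(1), simplified]
  have "\<forall>i. \<exists>d. i \<in> I \<longrightarrow> d \<in> carrier R \<and> b i = \<one>\<^bsub>R\<^esub> \<oplus>\<^bsub>R\<^esub> t \<otimes>\<^bsub>R\<^esub> d"
    using b_unipotent by blast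
  then obtain d where d: "\<And>i. i \<in> I \<Longrightarrow> d i \<in> carrier R" "\<And>i. i \<in> I \<Longrightarrow> b i = \<one>\<^bsub>R\<^esub> \<oplus>\<^bsub>R\<^esub> t \<otimes>\<^bsub>R\<^esub> d i"
    by metis
  define y where "y = (\<Oplus>\<^bsub>P\<^esub> i \<in> I. d i \<odot>\<^bsub>P\<^esub> h (b' i \<odot>\<^bsub>P\<^esub> x))"
  have y: "y \<in> carrier P" unfolding y_def by (rule P.M.finsum_closed) (use x d in auto)
  have "(\<Oplus>\<^bsub>P\<^esub> i \<in> I. h (b' i \<odot>\<^bsub>P\<^esub> x)) = h (\<Oplus>\<^bsub>P\<^esub> i \<in> I. b' i \<odot>\<^bsub>P\<^esub> x)"
    using hom_finsum[OF lin_module[OF P] lin_module[OF P] h(1) finite_I, of "\<lambda>i. b' i \<odot>\<^bsub>P\<^esub> x"] x by simp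
  also have "(\<Oplus>\<^bsub>P\<^esub> i \<in> I. b' i \<odot>\<^bsub>P\<^esub> x) = norm_element \<odot>\<^bsub>P\<^esub> x"
    unfolding norm_eq by (rule P.finsum_smult_rdistr[symmetric]) (use x in auto)
  also have "h \<dots> = \<zero>\<^bsub>P\<^esub>" using \<nu>x hom_zero[OF lin_module[OF P] lin_module[OF P] h(1)] by simp
  finally have 0: "(\<Oplus>\<^bsub>P\<^esub> i \<in> I. h (b' i \<odot>\<^bsub>P\<^esub> x)) = \<zero>\<^bsub>P\<^esub>" .
  have "x = (\<Oplus>\<^bsub>P\<^esub> i \<in> I. b i \<odot>\<^bsub>P\<^esub> h (b' i \<odot>\<^bsub>P\<^esub> x))"
    using fun_cong[OF h(2), of x] x by (simp add: trace_apply)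
  also have "\<dots> = (\<Oplus>\<^bsub>P\<^esub> i \<in> I. h (b' i \<odot>\<^bsub>P\<^esub> x) \<oplus>\<^bsub>P\<^esub> t \<odot>\<^bsub>P\<^esub> (d i \<odot>\<^bsub>P\<^esub> h (b' i \<odot>\<^bsub>P\<^esub> x)))"
    by (rule P.M.finsum_cong') (use x d in \<open>auto simp: d(2) P.smult_l_distr P.smult_assoc1 simp del: b_closed\<close>)
  also have "\<dots> = (\<Oplus>\<^bsub>P\<^esub> i \<in> I. h (b' i \<odot>\<^bsub>P\<^esub> x)) \<oplus>\<^bsub>P\<^esub> (\<Oplus>\<^bsub>P\<^esub> i \<in> I. t \<odot>\<^bsub>P\<^esub> (d i \<odot>\<^bsub>P\<^esub> h (b' i \<odot>\<^bsub>P\<^esub> x)))"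
    by (rule P.M.finsum_addf) (use x d in auto)
  also have "(\<Oplus>\<^bsub>P\<^esub> i \<in> I. t \<odot>\<^bsub>P\<^esub> (d i \<odot>\<^bsub>P\<^esub> h (b' i \<odot>\<^bsub>P\<^esub> x))) = t \<odot>\<^bsub>P\<^esub> y"
    unfolding y_def by (rule P.finsum_smult_ldistr[symmetric]) (use x d in auto)
  finally show ?thesis using 0 y by auto
qed

text \<open>
  Take a linear \<open>w\<close> with \<open>N w N = N\<close> on \<open>M\<close>. Since \<open>b' i N = N\<close>, the trace of \<open>w\<close> sends \<open>N x\<close> to
  \<open>(\<Sum>i. b i w(N x)) = N w(N x) = N x\<close>.
\<close>

lemma norm_projection:
  fixes M :: "('r, 'u) module"
  assumes M: "module R M"
  obtains \<delta> where "\<delta> \<in> module_homs R M M" "factors_through_projective R M M \<delta>"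
    "\<And>x. x \<in> carrier M \<Longrightarrow> \<delta> (norm_element \<odot>\<^bsub>M\<^esub> x) = norm_element \<odot>\<^bsub>M\<^esub> x"
proof -
  interpret M: module R M by fact
  note [simp] = b_closed b'_closed finite_I t_closed
  have f: "(\<lambda>x \<in> carrier M. norm_element \<odot>\<^bsub>M\<^esub> x) \<in> module_homs R M M" (is "?f \<in> _")
  proof (rule restrict_module_homsI[OF M])
    fix a x assume "a \<in> carrier R" "x \<in> carrier M"
    then show "norm_element \<odot>\<^bsub>M\<^esub> (a \<odot>\<^bsub>M\<^esub> x) = a \<odot>\<^bsub>M\<^esub> (norm_element \<odot>\<^bsub>M\<^esub> x)"
      using R.m_comm[of a norm_element] by (simp flip: M.smult_assoc1)
  qed (simp_all add: M.smult_r_distr)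
  obtain w where w: "w \<in> module_homs K (lin M) (lin M)"
    and fwf: "\<And>x. x \<in> carrier (lin M) \<Longrightarrow> ?f (w (?f x)) = ?f x"
    by (rule linear_generalized_inverse[OF K.field_axioms lin_module[OF M] lin_module[OF M] lin_hom[OF f]])
      (rule that)
  have nw: "norm_element \<odot>\<^bsub>M\<^esub> w (norm_element \<odot>\<^bsub>M\<^esub> x) = norm_element \<odot>\<^bsub>M\<^esub> x" if "x \<in> carrier M" for x
    using fwf[of x] that hom_closed[OF w, of "norm_element \<odot>\<^bsub>M\<^esub> x"] by simp
  have "trace M M w (norm_element \<odot>\<^bsub>M\<^esub> x) = norm_element \<odot>\<^bsub>M\<^esub> x" if x: "x \<in> carrier M" for x
  proof -
    have wc: "w (norm_element \<odot>\<^bsub>M\<^esub> x) \<in> carrier M" using hom_closed[OF w, of "norm_element \<odot>\<^bsub>M\<^esub> x"] x by simp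
    have b'n: "b' i \<odot>\<^bsub>M\<^esub> (norm_element \<odot>\<^bsub>M\<^esub> x) = norm_element \<odot>\<^bsub>M\<^esub> x" if i: "i \<in> I" for i
    proof -
      obtain d where d: "d \<in> carrier R" "b' i = \<one>\<^bsub>R\<^esub> \<oplus>\<^bsub>R\<^esub> t \<otimes>\<^bsub>R\<^esub> d" using b'_unipotent[OF i] by blast
      have "b' i \<otimes>\<^bsub>R\<^esub> norm_element = norm_element \<oplus>\<^bsub>R\<^esub> d \<otimes>\<^bsub>R\<^esub> (t \<otimes>\<^bsub>R\<^esub> norm_element)"
      proof -
        have "(\<one>\<^bsub>R\<^esub> \<oplus>\<^bsub>R\<^esub> t \<otimes>\<^bsub>R\<^esub> d) \<otimes>\<^bsub>R\<^esub> norm_element = norm_element \<oplus>\<^bsub>R\<^esub> t \<otimes>\<^bsub>R\<^esub> d \<otimes>\<^bsub>R\<^esub> norm_element"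
          using d(1) by (simp add: R.l_distr)
        also have "t \<otimes>\<^bsub>R\<^esub> d \<otimes>\<^bsub>R\<^esub> norm_element = d \<otimes>\<^bsub>R\<^esub> (t \<otimes>\<^bsub>R\<^esub> norm_element)"
          using d(1) by (simp add: R.m_ac)
        finally show ?thesis unfolding d(2) .
      qed
      also have "\<dots> = norm_element" using d(1) t_norm by (simp add: norm_element_def[symmetric])
      finally show ?thesis using x i by (simp flip: M.smult_assoc1)
    qed
    have "trace M M w (norm_element \<odot>\<^bsub>M\<^esub> x) = (\<Oplus>\<^bsub>M\<^esub> i \<in> I. b i \<odot>\<^bsub>M\<^esub> w (norm_element \<odot>\<^bsub>M\<^esub> x))"
      using x wc by (simp add: trace_apply b'n cong: M.M.finsum_cong)
    also have "\<dots> = norm_element \<odot>\<^bsub>M\<^esub> w (norm_element \<odot>\<^bsub>M\<^esub> x)"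
      unfolding norm_element_def by (rule M.finsum_smult_rdistr[symmetric]) (use x wc in \<open>auto simp: norm_element_def\<close>)
    finally show ?thesis using nw[OF x] by simp
  qed
  moreover have "factors_through_projective R M M (trace M M w)"
    using factors_through_projective_iff_trace[OF M M] w by blast
  ultimately show ?thesis using that trace_hom[OF M M w] by blast
qed

text \<open>
  The null endomorphisms of \<open>M\<close> form no nilpotent ideal when \<open>M\<close> has projective summands, so a stable
  idempotent cannot be lifted directly. Composing with \<open>1 - \<delta>\<close>, which is stably the identity and kills
  the multiples of the norm element, removes the obstruction.
\<close>

lemma stably_idempotent_splits:
  fixes M :: "('r, 'u) module"
  assumes M: "module R M" and e: "e \<in> module_homs R M M"
    and idem: "stably_equal M M (compose (carrier M) e e) e"
  obtains N :: "('r, 'u) module" and r i where "module R N" "r \<in> module_homs R M N" "i \<in> module_homs R N M"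
    "stably_equal M M (compose (carrier M) i r) e" "compose (carrier N) r i = (\<lambda>x \<in> carrier N. x)"
proof -
  interpret M: module R M by fact
  let ?id = "\<lambda>x \<in> carrier M. x"
  note cmp = hom_compose[OF M] and id = hom_id[OF M] and trans = stably_equal_euclid[OF M M]
    and sym = stably_equal_sym[OF M M] and refl = stably_equal_refl[OF M M]
  obtain \<delta> where \<delta>: "\<delta> \<in> module_homs R M M" "factors_through_projective R M M \<delta>"
    and \<delta>_norm: "\<And>x. x \<in> carrier M \<Longrightarrow> \<delta> (norm_element \<odot>\<^bsub>M\<^esub> x) = norm_element \<odot>\<^bsub>M\<^esub> x"
    by (rule norm_projection[OF M]) (rule that)
  define \<pi> where "\<pi> = (\<lambda>x \<in> carrier M. ?id x \<ominus>\<^bsub>M\<^esub> \<delta> x)"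
  have \<pi>: "\<pi> \<in> module_homs R M M" unfolding \<pi>_def by (rule hom_diff_map[OF M M id \<delta>(1)])
  have \<pi>_norm: "\<pi> (norm_element \<odot>\<^bsub>M\<^esub> x) = \<zero>\<^bsub>M\<^esub>" if "x \<in> carrier M" for x
    using that by (simp add: \<pi>_def \<delta>_norm M.M.minus_eq_zero_iff)
  have id_\<pi>: "stably_equal M M ?id \<pi>"
  proof -
    have "(\<lambda>x \<in> carrier M. ?id x \<ominus>\<^bsub>M\<^esub> \<pi> x) = \<delta>"
    proof (rule extensionalityI[of _ "carrier M"])
      fix x assume x: "x \<in> carrier M"
      then have "x \<ominus>\<^bsub>M\<^esub> (x \<ominus>\<^bsub>M\<^esub> \<delta> x) = \<delta> x" using hom_closed[OF \<delta>(1) x] by algebra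
      then show "(\<lambda>x \<in> carrier M. ?id x \<ominus>\<^bsub>M\<^esub> \<pi> x) x = \<delta> x" using x by (simp add: \<pi>_def)
    qed (use hom_extensional[OF \<delta>(1)] in simp_all)
    then show ?thesis using \<delta>(2) by (simp add: stably_equal_def)
  qed
  define e1 where "e1 = compose (carrier M) \<pi> e"
  have e1: "e1 \<in> module_homs R M M" unfolding e1_def by (rule cmp[OF e \<pi>])
  have e_e1: "stably_equal M M e e1"
    using stably_equal_compose[OF M M M e e refl[OF e] id \<pi> id_\<pi>] compose_id_left[OF e] by (simp add: e1_def)
  have ee1: "stably_equal M M (compose (carrier M) e e1) e"
  proof (rule trans[OF cmp[OF e1 e] e cmp[OF e e]])
    show "stably_equal M M (compose (carrier M) e e1) (compose (carrier M) e e)"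
      by (rule stably_equal_compose[OF M M M e1 e sym[OF e e1 e_e1] e e refl[OF e]])
    show "stably_equal M M e (compose (carrier M) e e)" by (rule sym[OF cmp[OF e e] e idem])
  qed
  define f where "f = (\<lambda>x \<in> carrier M. compose (carrier M) e e1 x \<ominus>\<^bsub>M\<^esub> e x)"
  have f: "f \<in> module_homs R M M" unfolding f_def by (rule hom_diff_map[OF M M cmp[OF e1 e] e])
  have "factors_through_projective R M M f" using ee1 by (simp add: stably_equal_def f_def)
  then obtain P :: "('r, 'u) module" and j q where P: "projective_module R P" and j: "j \<in> module_homs R M P"
    and q: "q \<in> module_homs R P M" and fqj: "f = compose (carrier M) q j"
    unfolding factors_through_projective_def by blast
  have PM: "module R P" using P by (simp add: projective_module_def)
  interpret P: module R P by fact
  have Psplit: "trace_split P" using projective_iff_trace_split[OF PM] P by blast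
  note cl [simp] = hom_closed[OF e] hom_closed[OF e1] hom_closed[OF f] hom_closed[OF \<pi>] hom_closed[OF j] hom_closed[OF q]
  define z where "z x = \<pi> (q (j x))" for x
  have z [simp]: "z x \<in> carrier M" if "x \<in> carrier M" for x using that by (simp add: z_def)
  have e1_sq: "e1 (e1 x) = e1 x \<oplus>\<^bsub>M\<^esub> z x" if x: "x \<in> carrier M" for x
  proof -
    have "z x = \<pi> (f x)" using x by (simp add: z_def fqj compose_eq)
    also have "f x = e (e1 x) \<ominus>\<^bsub>M\<^esub> e x" using x by (simp add: f_def compose_eq)
    also have "\<pi> \<dots> = \<pi> (e (e1 x)) \<ominus>\<^bsub>M\<^esub> \<pi> (e x)"
      by (rule hom_diff[OF M M \<pi>]) (use x in simp_all)
    also have "\<dots> = e1 (e1 x) \<ominus>\<^bsub>M\<^esub> e1 x" using x by (simp add: e1_def compose_eq)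
    finally have zx: "z x = e1 (e1 x) \<ominus>\<^bsub>M\<^esub> e1 x" .
    have "e1 x \<in> carrier M" "e1 (e1 x) \<in> carrier M" using x by simp_all
    then show ?thesis unfolding zx by algebra
  qed
  \<comment> \<open>nilpotency of \<open>z\<close>: the endomorphism \<open>a\<close> of \<open>P\<close> raises the \<open>t\<close>-adic filtration\<close>
  define a where "a y = j (\<pi> (q y))" for y
  have a [simp]: "a y \<in> carrier P" if "y \<in> carrier P" for y using that by (simp add: a_def)
  have a_smult: "a (c \<odot>\<^bsub>P\<^esub> y) = c \<odot>\<^bsub>P\<^esub> a y" if "c \<in> carrier R" "y \<in> carrier P" for c y
    using that by (simp add: a_def hom_smult[OF q] hom_smult[OF \<pi>] hom_smult[OF j])
  have a_t: "\<exists>y' \<in> carrier P. a y = t \<odot>\<^bsub>P\<^esub> y'" if y: "y \<in> carrier P" for y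
  proof (rule norm_kernel[OF PM Psplit])
    have "norm_element \<odot>\<^bsub>P\<^esub> a y = a (norm_element \<odot>\<^bsub>P\<^esub> y)" using y by (simp add: a_smult)
    also have "\<dots> = j (\<pi> (norm_element \<odot>\<^bsub>M\<^esub> q y))" using y by (simp add: a_def hom_smult[OF q])
    also have "\<dots> = \<zero>\<^bsub>P\<^esub>" using y by (simp add: \<pi>_norm hom_zero[OF M PM j])
    finally show "norm_element \<odot>\<^bsub>P\<^esub> a y = \<zero>\<^bsub>P\<^esub>" .
  qed (use y in simp)
  have a_pow: "\<exists>y' \<in> carrier P. (a ^^ k) y = (t [^]\<^bsub>R\<^esub> k) \<odot>\<^bsub>P\<^esub> y'" if y: "y \<in> carrier P" for k y
  proof (induction k)
    case 0
    show ?case using y by (intro bexI[of _ y]) simp_all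
  next
    case (Suc k)
    then obtain y' where y': "y' \<in> carrier P" "(a ^^ k) y = (t [^]\<^bsub>R\<^esub> k) \<odot>\<^bsub>P\<^esub> y'" by blast
    obtain y'' where y'': "y'' \<in> carrier P" "a y' = t \<odot>\<^bsub>P\<^esub> y''" using a_t[OF y'(1)] by blast
    have "(a ^^ Suc k) y = (t [^]\<^bsub>R\<^esub> Suc k) \<odot>\<^bsub>P\<^esub> y''"
      using y' y'' t_closed by (simp add: a_smult P.smult_assoc1)
    then show ?case using y''(1) by blast
  qed
  have a_nil: "(a ^^ n) y = \<zero>\<^bsub>P\<^esub>" if "y \<in> carrier P" for y
    using a_pow[OF that, of n] t_nilpotent by auto
  have z_pow: "(z ^^ Suc k) x = \<pi> (q ((a ^^ k) (j x)))" for k x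
    by (induction k) (simp_all add: z_def a_def)
  have z0: "z \<zero>\<^bsub>M\<^esub> = \<zero>\<^bsub>M\<^esub>"
    by (simp add: z_def hom_zero[OF M PM j] hom_zero[OF PM M q] hom_zero[OF M M \<pi>])
  have z_nil: "(z ^^ m) x = \<zero>\<^bsub>M\<^esub>" if m: "m > n" and x: "x \<in> carrier M" for m x
  proof -
    have "(z ^^ Suc n) x = \<zero>\<^bsub>M\<^esub>"
      unfolding z_pow using x by (simp add: a_nil hom_zero[OF PM M q] hom_zero[OF M M \<pi>])
    moreover have "(z ^^ k) \<zero>\<^bsub>M\<^esub> = \<zero>\<^bsub>M\<^esub>" for k by (induction k) (simp_all add: z0)
    moreover have "m = (m - Suc n) + Suc n" using m by simp
    ultimately show ?thesis by (metis comp_apply funpow_add)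
  qed
  interpret com: commuting_endomorphisms M e1 z
  proof
    fix x assume x: "x \<in> carrier M"
    have "e1 (e1 (e1 x)) = e1 (e1 x) \<oplus>\<^bsub>M\<^esub> z (e1 x)" by (rule e1_sq) (simp add: x)
    moreover have "e1 (e1 (e1 x)) = e1 (e1 x) \<oplus>\<^bsub>M\<^esub> e1 (z x)"
      using arg_cong[OF e1_sq[OF x], of e1] x by (simp add: hom_add[OF e1])
    ultimately show "e1 (z x) = z (e1 x)"
      using x M.M.r_neg1[of "e1 (e1 x)" "e1 (z x)"] M.M.r_neg1[of "e1 (e1 x)" "z (e1 x)"] by simp
  qed (simp_all add: hom_add[OF e1] z_def hom_add[OF j] hom_add[OF q] hom_add[OF \<pi>])
  \<comment> \<open>any power of \<open>p\<close> that exceeds \<open>n\<close> will do, as \<open>z\<close> vanishes in all powers above the \<open>n\<close>-th\<close>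
  define m where "m = p ^ Suc n"
  have m: "m > n" "m > 0"
  proof -
    have p2: "p \<ge> 2" using prime_p by (rule prime_ge_2_nat)
    then have "Suc n < p ^ Suc n" by (intro power_gt_expt) simp
    then show "m > n" "m > 0" unfolding m_def by linarith+
  qed
  \<comment> \<open>raise \<open>e1\<^sup>2 = e1 + z\<close> to the \<open>m\<close>-th power\<close>
  have idem_pow: "(e1 ^^ m) ((e1 ^^ m) x) = (e1 ^^ m) x" if x: "x \<in> carrier M" for x
  proof -
    have "((\<lambda>x. e1 (e1 x)) ^^ k) x = ((\<lambda>x. e1 x \<oplus>\<^bsub>M\<^esub> z x) ^^ k) x \<and> ((\<lambda>x. e1 (e1 x)) ^^ k) x \<in> carrier M" for k
    proof (induction k)
      case (Suc k)
      then show ?case using e1_sq by simp (metis cl(2) e1_sq)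
    qed (use x in simp)
    then have "((\<lambda>x. e1 (e1 x)) ^^ m) x = (e1 ^^ m) x \<oplus>\<^bsub>M\<^esub> (z ^^ m) x"
      using com.freshmans_dream_power[OF prime_p module_char_p[OF M] x, of "Suc n"] by (simp add: m_def)
    also have "\<dots> = (e1 ^^ m) x" using z_nil[OF m(1) x] com.f_pow_closed[OF x] by simp
    finally have "((e1 ^^ 2) ^^ m) x = (e1 ^^ m) x" by (simp add: numeral_2_eq_2 comp_def)
    moreover have "((e1 ^^ 2) ^^ m) x = (e1 ^^ m) ((e1 ^^ m) x)"
      by (simp add: funpow_mult mult_2 funpow_add)
    ultimately show ?thesis by simp
  qed
  define E where "E k = (\<lambda>x \<in> carrier M. (e1 ^^ k) x)" for k
  have E: "E k \<in> module_homs R M M" for k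
  proof -
    have "(e1 ^^ k) (c \<odot>\<^bsub>M\<^esub> x) = c \<odot>\<^bsub>M\<^esub> (e1 ^^ k) x" if "c \<in> carrier R" "x \<in> carrier M" for c x
      using that by (induction k) (simp_all add: hom_smult[OF e1] com.f_pow_closed)
    then show ?thesis unfolding E_def
      by (intro restrict_module_homsI[OF M]) (simp_all add: com.f_pow_closed com.f_pow_add)
  qed
  have e1e1: "stably_equal M M (compose (carrier M) e1 e1) e1"
  proof (rule trans[OF cmp[OF e1 e1] e1 e])
    have 1: "stably_equal M M (compose (carrier M) e1 e1) (compose (carrier M) e e)"
      using stably_equal_compose[OF M M M e1 e sym[OF e e1 e_e1] e1 e sym[OF e e1 e_e1]] .
    show "stably_equal M M (compose (carrier M) e1 e1) e"
      by (rule trans[OF cmp[OF e1 e1] e cmp[OF e e] 1 sym[OF cmp[OF e e] e idem]])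
    show "stably_equal M M e1 e" by (rule sym[OF e e1 e_e1])
  qed
  have E_e1: "stably_equal M M (E (Suc k)) e1" for k
  proof (induction k)
    case 0
    have "E (Suc 0) = e1" unfolding E_def using hom_extensional[OF e1]
      by (intro extensionalityI[of _ "carrier M"]) simp_all
    then show ?case using refl[OF e1] by simp
  next
    case (Suc k)
    have "E (Suc (Suc k)) = compose (carrier M) e1 (E (Suc k))"
      by (auto simp: E_def compose_def)
    moreover have "stably_equal M M (compose (carrier M) e1 (E (Suc k))) (compose (carrier M) e1 e1)"
      by (rule stably_equal_compose[OF M M M E e1 Suc e1 e1 refl[OF e1]])
    ultimately have "stably_equal M M (E (Suc (Suc k))) (compose (carrier M) e1 e1)" by simp
    then show ?case
      by (rule trans[OF E e1 cmp[OF e1 e1] _ sym[OF cmp[OF e1 e1] e1 e1e1]])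
  qed
  have Em: "stably_equal M M (E m) e"
  proof -
    obtain k where k: "m = Suc k" using m(2) by (cases m) auto
    show ?thesis unfolding k by (rule trans[OF E e e1 E_e1 e_e1])
  qed
  have EE: "E m (E m x) = E m x" if "x \<in> carrier M" for x
    using that idem_pow[OF that] com.f_pow_closed[OF that] by (simp add: E_def)
  define N where "N = M\<lparr>carrier := E m ` carrier M\<rparr>"
  note Ecl = hom_closed[OF E]
  have sub: "submodule (E m ` carrier M) R M"
  proof (rule M.submoduleI)
    show "E m ` carrier M \<subseteq> carrier M" using Ecl by auto
    show "\<zero>\<^bsub>M\<^esub> \<in> E m ` carrier M" using hom_zero[OF M M E, of m] by (metis M.M.zero_closed image_eqI)
    fix u assume "u \<in> E m ` carrier M"
    then obtain x where u: "u = E m x" and x: "x \<in> carrier M" by blast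
    show "\<ominus>\<^bsub>M\<^esub> u \<in> E m ` carrier M"
      unfolding u hom_neg[OF M M E x, symmetric] using x by (intro imageI) simp
    { fix c assume c: "c \<in> carrier R"
      show "c \<odot>\<^bsub>M\<^esub> u \<in> E m ` carrier M"
        unfolding u hom_smult[OF E c x, symmetric] using c x by (intro imageI) simp }
    fix v assume "v \<in> E m ` carrier M"
    then obtain y where v: "v = E m y" and y: "y \<in> carrier M" by blast
    show "u \<oplus>\<^bsub>M\<^esub> v \<in> E m ` carrier M"
      unfolding u v hom_add[OF E x y, symmetric] using x y by (intro imageI) simp
  qed
  have N: "module R N" unfolding N_def by (rule submodule.submodule_is_module[OF sub M])
  have rN: "E m \<in> module_homs R M N"
    by (rule module_homsI) (simp_all add: N_def hom_add[OF E] hom_smult[OF E] hom_extensional[OF E])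
  let ?i = "\<lambda>x \<in> carrier N. x"
  have iN: "?i \<in> module_homs R N M"
    by (rule restrict_module_homsI[OF N]) (use Ecl in \<open>auto simp: N_def\<close>)
  have "compose (carrier M) ?i (E m) = E m"
    using hom_extensional[OF E] by (intro extensionalityI[of _ "carrier M"]) (simp_all add: compose_eq N_def)
  moreover have "compose (carrier N) (E m) ?i = (\<lambda>x \<in> carrier N. x)"
    unfolding compose_def by (rule restrict_ext) (auto simp: N_def EE)
  ultimately show ?thesis using that[OF N rN iN] Em by simp
qed

lemma Stab_idempotents_split:
  fixes Z :: "('r, 'u) module"
  assumes "Z \<in> Ob (Stab R)" "e \<in> Hom (Stab R) Z Z" "Cmp (Stab R) Z Z Z e e = e"
  shows "\<exists>N \<in> Ob (Stab R). \<exists>r \<in> Hom (Stab R) Z N. \<exists>i \<in> Hom (Stab R) N Z.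
    Cmp (Stab R) Z N Z i r = e \<and> Cmp (Stab R) N Z N r i = Idn (Stab R) N"
proof -
  have Z: "module R Z" using assms(1) by simp
  obtain e' where e': "e' \<in> module_homs R Z Z" "e = stable_class R Z Z e'"
    using assms(2) by (auto simp: Hom_Stab)
  have "stably_equal Z Z (compose (carrier Z) e' e') e'"
    using assms(3) Z e' stable_class_eq_iff[OF Z Z hom_compose[OF Z e'(1) e'(1)] e'(1)]
    by (simp add: Cmp_stable_class)
  then obtain N :: "('r, 'u) module" and r i where N: "module R N" and r: "r \<in> module_homs R Z N"
    and i: "i \<in> module_homs R N Z" and ir: "stably_equal Z Z (compose (carrier Z) i r) e'"
    and ri: "compose (carrier N) r i = (\<lambda>x \<in> carrier N. x)"
    by (rule stably_idempotent_splits[OF Z e'(1)]) (rule that)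
  have "Cmp (Stab R) Z N Z (stable_class R N Z i) (stable_class R Z N r) = e"
    using Z N r i ir e' stable_class_eq_iff[OF Z Z hom_compose[OF Z r i] e'(1)] by (simp add: Cmp_stable_class)
  moreover have "Cmp (Stab R) N Z N (stable_class R Z N r) (stable_class R N Z i) = Idn (Stab R) N"
    using Z N r i ri by (simp add: Cmp_stable_class Idn_Stab)
  ultimately show ?thesis using N r i stable_class_Hom by (auto intro!: bexI)
qed

end

section \<open>Group algebras\<close>

locale finite_group_algebra = K: field K + H: comm_group H
  for K :: "('k, 'x) ring_scheme" and H :: "('h, 'y) monoid_scheme" +
  assumes finite_H: "finite (carrier H)"
begin

abbreviation KH :: "('h \<Rightarrow> 'k) ring" where "KH \<equiv> group_algebra K H"

definition delta :: "'h \<Rightarrow> 'h \<Rightarrow> 'k"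
  where "delta g = (\<lambda>x \<in> carrier H. if x = g then \<one>\<^bsub>K\<^esub> else \<zero>\<^bsub>K\<^esub>)"

definition scalar :: "'k \<Rightarrow> 'h \<Rightarrow> 'k"
  where "scalar c = (\<lambda>x \<in> carrier H. if x = \<one>\<^bsub>H\<^esub> then c else \<zero>\<^bsub>K\<^esub>)"

definition coeff_one :: "('h \<Rightarrow> 'k) \<Rightarrow> 'k"
  where "coeff_one = (\<lambda>f \<in> carrier KH. f \<one>\<^bsub>H\<^esub>)"

lemma carrier_KH: "carrier KH = carrier H \<rightarrow>\<^sub>E carrier K"
  by (simp add: group_algebra_def)

lemma KH_apply [simp]: "f \<in> carrier KH \<Longrightarrow> x \<in> carrier H \<Longrightarrow> f x \<in> carrier K"
  by (auto simp: carrier_KH)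

lemma KH_closedI: "(\<And>x. x \<in> carrier H \<Longrightarrow> g x \<in> carrier K) \<Longrightarrow> (\<lambda>x \<in> carrier H. g x) \<in> carrier KH"
  by (simp add: carrier_KH)

lemma KH_eqI:
  assumes "f \<in> carrier KH" "g \<in> carrier KH" "\<And>x. x \<in> carrier H \<Longrightarrow> f x = g x"
  shows "f = g"
  using assms by (auto simp: carrier_KH intro: PiE_ext)

lemma add_KH [simp]: "x \<in> carrier H \<Longrightarrow> (f \<oplus>\<^bsub>KH\<^esub> g) x = f x \<oplus>\<^bsub>K\<^esub> g x"
  and zero_KH [simp]: "x \<in> carrier H \<Longrightarrow> \<zero>\<^bsub>KH\<^esub> x = \<zero>\<^bsub>K\<^esub>"
  and mult_KH: "x \<in> carrier H \<Longrightarrow>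
    (f \<otimes>\<^bsub>KH\<^esub> g) x = (\<Oplus>\<^bsub>K\<^esub> y \<in> carrier H. f y \<otimes>\<^bsub>K\<^esub> g (inv\<^bsub>H\<^esub> y \<otimes>\<^bsub>H\<^esub> x))"
  by (simp_all add: group_algebra_def)

lemma one_KH: "\<one>\<^bsub>KH\<^esub> = scalar \<one>\<^bsub>K\<^esub>"
  by (simp add: group_algebra_def scalar_def)

lemma delta_closed [simp]: "delta g \<in> carrier KH"
  and scalar_closed [simp]: "c \<in> carrier K \<Longrightarrow> scalar c \<in> carrier KH"
  unfolding delta_def scalar_def by (auto intro!: KH_closedI)

lemma delta_one: "delta \<one>\<^bsub>H\<^esub> = \<one>\<^bsub>KH\<^esub>"
  by (simp add: delta_def one_KH scalar_def)

lemma add_KH_closed: "f \<in> carrier KH \<Longrightarrow> g \<in> carrier KH \<Longrightarrow> f \<oplus>\<^bsub>KH\<^esub> g \<in> carrier KH"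
  using KH_closedI[of "\<lambda>x. f x \<oplus>\<^bsub>K\<^esub> g x"] by (simp add: group_algebra_def)

lemma mult_KH_closed: "f \<in> carrier KH \<Longrightarrow> g \<in> carrier KH \<Longrightarrow> f \<otimes>\<^bsub>KH\<^esub> g \<in> carrier KH"
proof -
  assume f: "f \<in> carrier KH" and g: "g \<in> carrier KH"
  have "(\<lambda>x \<in> carrier H. \<Oplus>\<^bsub>K\<^esub> y \<in> carrier H. f y \<otimes>\<^bsub>K\<^esub> g (inv\<^bsub>H\<^esub> y \<otimes>\<^bsub>H\<^esub> x)) \<in> carrier KH"
    using f g by (intro KH_closedI K.finsum_closed) auto
  then show ?thesis by (simp add: group_algebra_def)
qed

lemma H_cancel:
  assumes "x \<in> carrier H" "y \<in> carrier H"
  shows "x \<otimes>\<^bsub>H\<^esub> (inv\<^bsub>H\<^esub> x \<otimes>\<^bsub>H\<^esub> y) = y" "inv\<^bsub>H\<^esub> x \<otimes>\<^bsub>H\<^esub> (x \<otimes>\<^bsub>H\<^esub> y) = y"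
  using assms by (simp_all flip: H.m_assoc)

lemma zero_KH_closed: "\<zero>\<^bsub>KH\<^esub> \<in> carrier KH"
  by (simp add: group_algebra_def)

lemma sum_translate:
  assumes "z \<in> carrier H" "F \<in> carrier H \<rightarrow> carrier K"
  shows "(\<Oplus>\<^bsub>K\<^esub> y \<in> carrier H. F y) = (\<Oplus>\<^bsub>K\<^esub> y \<in> carrier H. F (z \<otimes>\<^bsub>H\<^esub> y))"
  using K.add.finprod_reindex[of F "\<lambda>y. z \<otimes>\<^bsub>H\<^esub> y" "carrier H"] H.surj_const_mult[OF assms(1)]
    H.inj_on_cmult[OF assms(1)] assms(2) by simp

lemma inv_image: "m_inv H ` carrier H = carrier H"
  by (metis H.inv_closed H.inv_inv image_eqI image_subsetI subsetI subset_antisym)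

lemma inv_inj: "inj_on (m_inv H) (carrier H)"
  by (metis H.inv_inv inj_onI)

lemma sum_single:
  assumes "z \<in> carrier H" "F z \<in> carrier K" "\<And>y. y \<in> carrier H \<Longrightarrow> y \<noteq> z \<Longrightarrow> F y = \<zero>\<^bsub>K\<^esub>"
  shows "(\<Oplus>\<^bsub>K\<^esub> y \<in> carrier H. F y) = F z"
proof -
  have F: "F y \<in> carrier K" if "y \<in> carrier H" for y
    using assms(2,3) that by (cases "y = z") auto
  have "(\<Oplus>\<^bsub>K\<^esub> y \<in> carrier H. F y) = (\<Oplus>\<^bsub>K\<^esub> y \<in> {z}. F y)"
    by (rule K.add.finprod_mono_neutral_cong_right) (use assms F finite_H in auto)
  then show ?thesis using assms(2) by simp
qed

lemma mult_KH_comm: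
  assumes f: "f \<in> carrier KH" and g: "g \<in> carrier KH"
  shows "f \<otimes>\<^bsub>KH\<^esub> g = g \<otimes>\<^bsub>KH\<^esub> f"
proof (rule KH_eqI)
  fix x assume x: "x \<in> carrier H"
  have "(\<Oplus>\<^bsub>K\<^esub> y \<in> carrier H. f y \<otimes>\<^bsub>K\<^esub> g (inv\<^bsub>H\<^esub> y \<otimes>\<^bsub>H\<^esub> x))
    = (\<Oplus>\<^bsub>K\<^esub> y \<in> carrier H. f (x \<otimes>\<^bsub>H\<^esub> y) \<otimes>\<^bsub>K\<^esub> g (inv\<^bsub>H\<^esub> (x \<otimes>\<^bsub>H\<^esub> y) \<otimes>\<^bsub>H\<^esub> x))"
    by (rule sum_translate[OF x]) (use f g x in auto)
  also have "\<dots> = (\<Oplus>\<^bsub>K\<^esub> y \<in> carrier H. (\<lambda>z. f (x \<otimes>\<^bsub>H\<^esub> inv\<^bsub>H\<^esub> z) \<otimes>\<^bsub>K\<^esub> g z) (inv\<^bsub>H\<^esub> y))"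
  proof (rule K.finsum_cong')
    fix y assume y: "y \<in> carrier H"
    have "inv\<^bsub>H\<^esub> (x \<otimes>\<^bsub>H\<^esub> y) \<otimes>\<^bsub>H\<^esub> x = inv\<^bsub>H\<^esub> y"
      using x y by (simp add: H.inv_mult H.m_ac H_cancel)
    then show "f (x \<otimes>\<^bsub>H\<^esub> y) \<otimes>\<^bsub>K\<^esub> g (inv\<^bsub>H\<^esub> (x \<otimes>\<^bsub>H\<^esub> y) \<otimes>\<^bsub>H\<^esub> x)
      = (\<lambda>z. f (x \<otimes>\<^bsub>H\<^esub> inv\<^bsub>H\<^esub> z) \<otimes>\<^bsub>K\<^esub> g z) (inv\<^bsub>H\<^esub> y)" using y by simp
  qed (use f g x in auto)
  also have "\<dots> = (\<Oplus>\<^bsub>K\<^esub> z \<in> m_inv H ` carrier H. f (x \<otimes>\<^bsub>H\<^esub> inv\<^bsub>H\<^esub> z) \<otimes>\<^bsub>K\<^esub> g z)"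
    by (rule K.add.finprod_reindex[OF _ inv_inj, symmetric]) (use f g x in auto)
  also have "\<dots> = (\<Oplus>\<^bsub>K\<^esub> z \<in> carrier H. g z \<otimes>\<^bsub>K\<^esub> f (inv\<^bsub>H\<^esub> z \<otimes>\<^bsub>H\<^esub> x))"
    unfolding inv_image
    by (rule K.finsum_cong') (use f g x in \<open>auto simp: K.m_comm H.m_comm\<close>)
  finally show "(f \<otimes>\<^bsub>KH\<^esub> g) x = (g \<otimes>\<^bsub>KH\<^esub> f) x" using x by (simp add: mult_KH)
qed (use f g mult_KH_closed in auto)

lemma mult_KH_assoc:
  assumes f: "f \<in> carrier KH" and g: "g \<in> carrier KH" and h: "h \<in> carrier KH"
  shows "f \<otimes>\<^bsub>KH\<^esub> g \<otimes>\<^bsub>KH\<^esub> h = f \<otimes>\<^bsub>KH\<^esub> (g \<otimes>\<^bsub>KH\<^esub> h)"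
proof (rule KH_eqI)
  fix x assume x: "x \<in> carrier H"
  have "(f \<otimes>\<^bsub>KH\<^esub> g \<otimes>\<^bsub>KH\<^esub> h) x = (\<Oplus>\<^bsub>K\<^esub> y \<in> carrier H. (f \<otimes>\<^bsub>KH\<^esub> g) y \<otimes>\<^bsub>K\<^esub> h (inv\<^bsub>H\<^esub> y \<otimes>\<^bsub>H\<^esub> x))"
    using x by (simp add: mult_KH)
  also have "\<dots> = (\<Oplus>\<^bsub>K\<^esub> y \<in> carrier H. \<Oplus>\<^bsub>K\<^esub> z \<in> carrier H. f z \<otimes>\<^bsub>K\<^esub> (g (inv\<^bsub>H\<^esub> z \<otimes>\<^bsub>H\<^esub> y) \<otimes>\<^bsub>K\<^esub> h (inv\<^bsub>H\<^esub> y \<otimes>\<^bsub>H\<^esub> x)))"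
  proof (rule K.finsum_cong')
    fix y assume y: "y \<in> carrier H"
    have "(f \<otimes>\<^bsub>KH\<^esub> g) y \<otimes>\<^bsub>K\<^esub> h (inv\<^bsub>H\<^esub> y \<otimes>\<^bsub>H\<^esub> x)
      = (\<Oplus>\<^bsub>K\<^esub> z \<in> carrier H. f z \<otimes>\<^bsub>K\<^esub> g (inv\<^bsub>H\<^esub> z \<otimes>\<^bsub>H\<^esub> y) \<otimes>\<^bsub>K\<^esub> h (inv\<^bsub>H\<^esub> y \<otimes>\<^bsub>H\<^esub> x))"
      unfolding mult_KH[OF y] by (rule K.finsum_ldistr[OF finite_H]) (use f g h x y in auto)
    also have "\<dots> = (\<Oplus>\<^bsub>K\<^esub> z \<in> carrier H. f z \<otimes>\<^bsub>K\<^esub> (g (inv\<^bsub>H\<^esub> z \<otimes>\<^bsub>H\<^esub> y) \<otimes>\<^bsub>K\<^esub> h (inv\<^bsub>H\<^esub> y \<otimes>\<^bsub>H\<^esub> x)))"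
      by (rule K.finsum_cong') (use f g h x y in \<open>auto simp: K.m_assoc\<close>)
    finally show "(f \<otimes>\<^bsub>KH\<^esub> g) y \<otimes>\<^bsub>K\<^esub> h (inv\<^bsub>H\<^esub> y \<otimes>\<^bsub>H\<^esub> x) = \<dots>" .
  qed (use f g h x in \<open>auto intro!: K.finsum_closed\<close>)
  also have "\<dots> = (\<Oplus>\<^bsub>K\<^esub> z \<in> carrier H. \<Oplus>\<^bsub>K\<^esub> y \<in> carrier H. f z \<otimes>\<^bsub>K\<^esub> (g (inv\<^bsub>H\<^esub> z \<otimes>\<^bsub>H\<^esub> y) \<otimes>\<^bsub>K\<^esub> h (inv\<^bsub>H\<^esub> y \<otimes>\<^bsub>H\<^esub> x)))"
    by (rule K.finsum_swap[OF finite_H finite_H]) (use f g h x in auto)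
  also have "\<dots> = (\<Oplus>\<^bsub>K\<^esub> z \<in> carrier H. f z \<otimes>\<^bsub>K\<^esub> (g \<otimes>\<^bsub>KH\<^esub> h) (inv\<^bsub>H\<^esub> z \<otimes>\<^bsub>H\<^esub> x))"
  proof (rule K.finsum_cong')
    fix z assume z: "z \<in> carrier H"
    have "(\<Oplus>\<^bsub>K\<^esub> y \<in> carrier H. f z \<otimes>\<^bsub>K\<^esub> (g (inv\<^bsub>H\<^esub> z \<otimes>\<^bsub>H\<^esub> y) \<otimes>\<^bsub>K\<^esub> h (inv\<^bsub>H\<^esub> y \<otimes>\<^bsub>H\<^esub> x)))
      = f z \<otimes>\<^bsub>K\<^esub> (\<Oplus>\<^bsub>K\<^esub> y \<in> carrier H. g (inv\<^bsub>H\<^esub> z \<otimes>\<^bsub>H\<^esub> y) \<otimes>\<^bsub>K\<^esub> h (inv\<^bsub>H\<^esub> y \<otimes>\<^bsub>H\<^esub> x))"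
      by (rule K.finsum_rdistr[OF finite_H, symmetric]) (use f g h x z in auto)
    also have "(\<Oplus>\<^bsub>K\<^esub> y \<in> carrier H. g (inv\<^bsub>H\<^esub> z \<otimes>\<^bsub>H\<^esub> y) \<otimes>\<^bsub>K\<^esub> h (inv\<^bsub>H\<^esub> y \<otimes>\<^bsub>H\<^esub> x))
      = (\<Oplus>\<^bsub>K\<^esub> y \<in> carrier H. g (inv\<^bsub>H\<^esub> z \<otimes>\<^bsub>H\<^esub> (z \<otimes>\<^bsub>H\<^esub> y)) \<otimes>\<^bsub>K\<^esub> h (inv\<^bsub>H\<^esub> (z \<otimes>\<^bsub>H\<^esub> y) \<otimes>\<^bsub>H\<^esub> x))"
      by (rule sum_translate[OF z]) (use g h x z in auto)
    also have "\<dots> = (\<Oplus>\<^bsub>K\<^esub> y \<in> carrier H. g y \<otimes>\<^bsub>K\<^esub> h (inv\<^bsub>H\<^esub> y \<otimes>\<^bsub>H\<^esub> (inv\<^bsub>H\<^esub> z \<otimes>\<^bsub>H\<^esub> x)))"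
    proof (rule K.finsum_cong')
      fix y assume y: "y \<in> carrier H"
      have "inv\<^bsub>H\<^esub> z \<otimes>\<^bsub>H\<^esub> (z \<otimes>\<^bsub>H\<^esub> y) = y" using y z by (simp flip: H.m_assoc)
      moreover have "inv\<^bsub>H\<^esub> (z \<otimes>\<^bsub>H\<^esub> y) \<otimes>\<^bsub>H\<^esub> x = inv\<^bsub>H\<^esub> y \<otimes>\<^bsub>H\<^esub> (inv\<^bsub>H\<^esub> z \<otimes>\<^bsub>H\<^esub> x)"
        using x y z by (simp add: H.inv_mult H.m_ac)
      ultimately show "g (inv\<^bsub>H\<^esub> z \<otimes>\<^bsub>H\<^esub> (z \<otimes>\<^bsub>H\<^esub> y)) \<otimes>\<^bsub>K\<^esub> h (inv\<^bsub>H\<^esub> (z \<otimes>\<^bsub>H\<^esub> y) \<otimes>\<^bsub>H\<^esub> x)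
        = g y \<otimes>\<^bsub>K\<^esub> h (inv\<^bsub>H\<^esub> y \<otimes>\<^bsub>H\<^esub> (inv\<^bsub>H\<^esub> z \<otimes>\<^bsub>H\<^esub> x))" by simp
    qed (use g h x z in auto)
    also have "\<dots> = (g \<otimes>\<^bsub>KH\<^esub> h) (inv\<^bsub>H\<^esub> z \<otimes>\<^bsub>H\<^esub> x)" using x z by (simp add: mult_KH)
    finally show "(\<Oplus>\<^bsub>K\<^esub> y \<in> carrier H. f z \<otimes>\<^bsub>K\<^esub> (g (inv\<^bsub>H\<^esub> z \<otimes>\<^bsub>H\<^esub> y) \<otimes>\<^bsub>K\<^esub> h (inv\<^bsub>H\<^esub> y \<otimes>\<^bsub>H\<^esub> x)))
      = f z \<otimes>\<^bsub>K\<^esub> (g \<otimes>\<^bsub>KH\<^esub> h) (inv\<^bsub>H\<^esub> z \<otimes>\<^bsub>H\<^esub> x)" .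
  qed (use f mult_KH_closed[OF g h] x in auto)
  also have "\<dots> = (f \<otimes>\<^bsub>KH\<^esub> (g \<otimes>\<^bsub>KH\<^esub> h)) x" using x by (simp add: mult_KH)
  finally show "(f \<otimes>\<^bsub>KH\<^esub> g \<otimes>\<^bsub>KH\<^esub> h) x = (f \<otimes>\<^bsub>KH\<^esub> (g \<otimes>\<^bsub>KH\<^esub> h)) x" .
qed (use f g h mult_KH_closed in auto)

lemma scalar_mult_apply:
  assumes c: "c \<in> carrier K" and f: "f \<in> carrier KH" and x: "x \<in> carrier H"
  shows "(scalar c \<otimes>\<^bsub>KH\<^esub> f) x = c \<otimes>\<^bsub>K\<^esub> f x"
proof -
  have "(\<Oplus>\<^bsub>K\<^esub> y \<in> carrier H. scalar c y \<otimes>\<^bsub>K\<^esub> f (inv\<^bsub>H\<^esub> y \<otimes>\<^bsub>H\<^esub> x))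
    = scalar c \<one>\<^bsub>H\<^esub> \<otimes>\<^bsub>K\<^esub> f (inv\<^bsub>H\<^esub> \<one>\<^bsub>H\<^esub> \<otimes>\<^bsub>H\<^esub> x)"
    by (rule sum_single) (use assms in \<open>auto simp: scalar_def\<close>)
  then show ?thesis using assms by (simp add: mult_KH scalar_def)
qed

lemma mult_delta_apply:
  assumes f: "f \<in> carrier KH" and g: "g \<in> carrier H" and x: "x \<in> carrier H"
  shows "(f \<otimes>\<^bsub>KH\<^esub> delta g) x = f (x \<otimes>\<^bsub>H\<^esub> inv\<^bsub>H\<^esub> g)"
proof -
  have "(\<Oplus>\<^bsub>K\<^esub> y \<in> carrier H. f y \<otimes>\<^bsub>K\<^esub> delta g (inv\<^bsub>H\<^esub> y \<otimes>\<^bsub>H\<^esub> x))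
    = f (x \<otimes>\<^bsub>H\<^esub> inv\<^bsub>H\<^esub> g) \<otimes>\<^bsub>K\<^esub> delta g (inv\<^bsub>H\<^esub> (x \<otimes>\<^bsub>H\<^esub> inv\<^bsub>H\<^esub> g) \<otimes>\<^bsub>H\<^esub> x)"
  proof (rule sum_single)
    fix y assume y: "y \<in> carrier H" "y \<noteq> x \<otimes>\<^bsub>H\<^esub> inv\<^bsub>H\<^esub> g"
    have "inv\<^bsub>H\<^esub> y \<otimes>\<^bsub>H\<^esub> x \<noteq> g"
    proof
      assume "inv\<^bsub>H\<^esub> y \<otimes>\<^bsub>H\<^esub> x = g"
      then have "x \<otimes>\<^bsub>H\<^esub> inv\<^bsub>H\<^esub> g = y" using x y(1) H.m_comm[of y "inv\<^bsub>H\<^esub> x"] by (auto simp: H.inv_mult H_cancel)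
      then show False using y(2) by simp
    qed
    then show "f y \<otimes>\<^bsub>K\<^esub> delta g (inv\<^bsub>H\<^esub> y \<otimes>\<^bsub>H\<^esub> x) = \<zero>\<^bsub>K\<^esub>" using f x y(1) by (simp add: delta_def)
  qed (use assms in auto)
  moreover have "inv\<^bsub>H\<^esub> (x \<otimes>\<^bsub>H\<^esub> inv\<^bsub>H\<^esub> g) \<otimes>\<^bsub>H\<^esub> x = g" using g x by (simp add: H.inv_mult H.m_ac H_cancel)
  ultimately show ?thesis using assms by (simp add: mult_KH delta_def)
qed

lemma cring_KH: "cring KH"
proof (rule cringI)
  show "abelian_group KH"
  proof (rule abelian_groupI)
    fix f assume f: "f \<in> carrier KH"
    have "(\<lambda>x \<in> carrier H. \<ominus>\<^bsub>K\<^esub> f x) \<in> carrier KH" using f by (intro KH_closedI) simp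
    moreover from this have "(\<lambda>x \<in> carrier H. \<ominus>\<^bsub>K\<^esub> f x) \<oplus>\<^bsub>KH\<^esub> f = \<zero>\<^bsub>KH\<^esub>"
      using f by (intro KH_eqI add_KH_closed zero_KH_closed) (simp_all add: K.l_neg)
    ultimately show "\<exists>g \<in> carrier KH. g \<oplus>\<^bsub>KH\<^esub> f = \<zero>\<^bsub>KH\<^esub>" by blast
    show "\<zero>\<^bsub>KH\<^esub> \<oplus>\<^bsub>KH\<^esub> f = f" using f by (intro KH_eqI add_KH_closed zero_KH_closed) simp_all
    fix g assume g: "g \<in> carrier KH"
    show "f \<oplus>\<^bsub>KH\<^esub> g = g \<oplus>\<^bsub>KH\<^esub> f" using f g by (intro KH_eqI add_KH_closed) (simp_all add: K.a_comm)
    fix h assume h: "h \<in> carrier KH"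
    show "f \<oplus>\<^bsub>KH\<^esub> g \<oplus>\<^bsub>KH\<^esub> h = f \<oplus>\<^bsub>KH\<^esub> (g \<oplus>\<^bsub>KH\<^esub> h)"
      using f g h by (intro KH_eqI add_KH_closed) (simp_all add: K.a_assoc)
  qed (simp_all add: add_KH_closed zero_KH_closed)
  show "comm_monoid KH"
  proof (rule comm_monoidI)
    fix f assume f: "f \<in> carrier KH"
    show "\<one>\<^bsub>KH\<^esub> \<otimes>\<^bsub>KH\<^esub> f = f"
      unfolding one_KH using f by (intro KH_eqI mult_KH_closed) (simp_all add: scalar_mult_apply)
  qed (fact mult_KH_closed mult_KH_assoc mult_KH_comm | simp add: one_KH)+
  fix f g h assume f: "f \<in> carrier KH" and g: "g \<in> carrier KH" and h: "h \<in> carrier KH"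
  show "(f \<oplus>\<^bsub>KH\<^esub> g) \<otimes>\<^bsub>KH\<^esub> h = f \<otimes>\<^bsub>KH\<^esub> h \<oplus>\<^bsub>KH\<^esub> g \<otimes>\<^bsub>KH\<^esub> h"
  proof (rule KH_eqI)
    fix x assume x: "x \<in> carrier H"
    have "(\<Oplus>\<^bsub>K\<^esub> y \<in> carrier H. (f \<oplus>\<^bsub>KH\<^esub> g) y \<otimes>\<^bsub>K\<^esub> h (inv\<^bsub>H\<^esub> y \<otimes>\<^bsub>H\<^esub> x))
      = (\<Oplus>\<^bsub>K\<^esub> y \<in> carrier H. f y \<otimes>\<^bsub>K\<^esub> h (inv\<^bsub>H\<^esub> y \<otimes>\<^bsub>H\<^esub> x) \<oplus>\<^bsub>K\<^esub> g y \<otimes>\<^bsub>K\<^esub> h (inv\<^bsub>H\<^esub> y \<otimes>\<^bsub>H\<^esub> x))"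
      by (rule K.finsum_cong') (use f g h x in \<open>auto simp: K.l_distr\<close>)
    also have "\<dots> = (\<Oplus>\<^bsub>K\<^esub> y \<in> carrier H. f y \<otimes>\<^bsub>K\<^esub> h (inv\<^bsub>H\<^esub> y \<otimes>\<^bsub>H\<^esub> x))
        \<oplus>\<^bsub>K\<^esub> (\<Oplus>\<^bsub>K\<^esub> y \<in> carrier H. g y \<otimes>\<^bsub>K\<^esub> h (inv\<^bsub>H\<^esub> y \<otimes>\<^bsub>H\<^esub> x))"
      by (rule K.finsum_addf) (use f g h x in auto)
    finally show "((f \<oplus>\<^bsub>KH\<^esub> g) \<otimes>\<^bsub>KH\<^esub> h) x = (f \<otimes>\<^bsub>KH\<^esub> h \<oplus>\<^bsub>KH\<^esub> g \<otimes>\<^bsub>KH\<^esub> h) x"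
      using x by (simp add: mult_KH)
  qed (use f g h in \<open>simp_all add: add_KH_closed mult_KH_closed\<close>)
qed

sublocale KH: cring KH by (rule cring_KH)

lemma scalar_ring_hom: "scalar \<in> ring_hom K KH"
proof (rule ring_hom_memI)
  fix c d assume cd: "c \<in> carrier K" "d \<in> carrier K"
  show "scalar (c \<otimes>\<^bsub>K\<^esub> d) = scalar c \<otimes>\<^bsub>KH\<^esub> scalar d"
    using cd by (intro KH_eqI) (auto simp: scalar_mult_apply, simp add: scalar_def)
  show "scalar (c \<oplus>\<^bsub>K\<^esub> d) = scalar c \<oplus>\<^bsub>KH\<^esub> scalar d"
    using cd by (intro KH_eqI) (auto, simp add: scalar_def)
qed (simp_all add: one_KH)

lemma delta_mult:
  assumes "g \<in> carrier H" "h \<in> carrier H"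
  shows "delta g \<otimes>\<^bsub>KH\<^esub> delta h = delta (g \<otimes>\<^bsub>H\<^esub> h)"
proof (rule KH_eqI)
  fix x assume x: "x \<in> carrier H"
  have "x \<otimes>\<^bsub>H\<^esub> inv\<^bsub>H\<^esub> h = g \<longleftrightarrow> x = g \<otimes>\<^bsub>H\<^esub> h" using assms x H.inv_solve_right' by auto
  then show "(delta g \<otimes>\<^bsub>KH\<^esub> delta h) x = delta (g \<otimes>\<^bsub>H\<^esub> h) x"
    using assms x by (simp add: mult_delta_apply) (simp add: delta_def)
qed simp_all

lemma finsum_KH_apply:
  assumes "finite A" "F \<in> A \<rightarrow> carrier KH" "x \<in> carrier H"
  shows "(\<Oplus>\<^bsub>KH\<^esub> i \<in> A. F i) x = (\<Oplus>\<^bsub>K\<^esub> i \<in> A. F i x)"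
  using additive_finsum[OF KH.abelian_group_axioms K.abelian_group_axioms assms(1,2), of "\<lambda>f. f x"] assms(3)
  by simp

lemma delta_expansion:
  assumes f: "f \<in> carrier KH"
  shows "(\<Oplus>\<^bsub>KH\<^esub> g \<in> carrier H. scalar (f g) \<otimes>\<^bsub>KH\<^esub> delta g) = f"
proof (rule KH_eqI)
  show "(\<Oplus>\<^bsub>KH\<^esub> g \<in> carrier H. scalar (f g) \<otimes>\<^bsub>KH\<^esub> delta g) \<in> carrier KH"
    using f by (intro KH.finsum_closed) auto
  fix x assume x: "x \<in> carrier H"
  have "(\<Oplus>\<^bsub>KH\<^esub> g \<in> carrier H. scalar (f g) \<otimes>\<^bsub>KH\<^esub> delta g) x
      = (\<Oplus>\<^bsub>K\<^esub> g \<in> carrier H. (scalar (f g) \<otimes>\<^bsub>KH\<^esub> delta g) x)"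
    by (rule finsum_KH_apply[OF finite_H _ x]) (use f in auto)
  also have "\<dots> = (scalar (f x) \<otimes>\<^bsub>KH\<^esub> delta x) x"
    by (rule sum_single[OF x]) (use f x in \<open>auto simp: scalar_mult_apply\<close>, simp add: delta_def)
  also have "\<dots> = f x" using f x by (simp add: scalar_mult_apply) (simp add: delta_def)
  finally show "(\<Oplus>\<^bsub>KH\<^esub> g \<in> carrier H. scalar (f g) \<otimes>\<^bsub>KH\<^esub> delta g) x = f x" .
qed (rule f)

lemma coeff_one_mult_delta:
  assumes "f \<in> carrier KH" "g \<in> carrier H"
  shows "coeff_one (f \<otimes>\<^bsub>KH\<^esub> delta g) = f (inv\<^bsub>H\<^esub> g)"
  using assms by (simp add: coeff_one_def mult_delta_apply)

lemma sum_inverse: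
  assumes "F \<in> carrier H \<rightarrow> carrier KH"
  shows "(\<Oplus>\<^bsub>KH\<^esub> g \<in> carrier H. F (inv\<^bsub>H\<^esub> g)) = (\<Oplus>\<^bsub>KH\<^esub> g \<in> carrier H. F g)"
  using KH.add.finprod_reindex[OF _ inv_inj, of F] assms inv_image by simp

lemma frobenius_algebra_KH:
  assumes "\<And>g. g \<in> extensional (carrier KH) \<Longrightarrow> dec (enc g) = g"
  shows "frobenius_algebra K KH scalar enc dec coeff_one (carrier H) delta (\<lambda>g. delta (inv\<^bsub>H\<^esub> g))"
proof (intro frobenius_algebra.intro coinduction.intro coinduction_axioms.intro
    frobenius_algebra_axioms.intro)
  have M: "module K (restrict_scalars scalar (regular_module KH))"
    by (intro restrict_scalars_module[OF scalar_ring_hom K.cring_axioms] regular_module_module cring_KH)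
  show "coeff_one \<in> module_homs K (restrict_scalars scalar (regular_module KH)) (regular_module K)"
    using restrict_module_homsI[OF M, of "\<lambda>f. f \<one>\<^bsub>H\<^esub>" "regular_module K"]
    by (simp add: coeff_one_def scalar_mult_apply)
  fix f assume f: "f \<in> carrier KH"
  have "(\<Oplus>\<^bsub>KH\<^esub> g \<in> carrier H. scalar (coeff_one (f \<otimes>\<^bsub>KH\<^esub> delta g)) \<otimes>\<^bsub>KH\<^esub> delta (inv\<^bsub>H\<^esub> g))
    = (\<Oplus>\<^bsub>KH\<^esub> g \<in> carrier H. scalar (f (inv\<^bsub>H\<^esub> g)) \<otimes>\<^bsub>KH\<^esub> delta (inv\<^bsub>H\<^esub> g))"
    by (rule KH.finsum_cong') (use f in \<open>auto simp: coeff_one_mult_delta\<close>)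
  also have "\<dots> = (\<Oplus>\<^bsub>KH\<^esub> g \<in> carrier H. scalar (f g) \<otimes>\<^bsub>KH\<^esub> delta g)"
    by (rule sum_inverse) (use f in auto)
  finally show "(\<Oplus>\<^bsub>KH\<^esub> g \<in> carrier H. scalar (coeff_one (f \<otimes>\<^bsub>KH\<^esub> delta g)) \<otimes>\<^bsub>KH\<^esub> delta (inv\<^bsub>H\<^esub> g)) = f"
    using delta_expansion[OF f] by simp
  have "(\<Oplus>\<^bsub>KH\<^esub> g \<in> carrier H. scalar (coeff_one (f \<otimes>\<^bsub>KH\<^esub> delta (inv\<^bsub>H\<^esub> g))) \<otimes>\<^bsub>KH\<^esub> delta g)
    = (\<Oplus>\<^bsub>KH\<^esub> g \<in> carrier H. scalar (f g) \<otimes>\<^bsub>KH\<^esub> delta g)"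
    by (rule KH.finsum_cong') (use f in \<open>auto simp: coeff_one_mult_delta\<close>)
  then show "(\<Oplus>\<^bsub>KH\<^esub> g \<in> carrier H. scalar (coeff_one (f \<otimes>\<^bsub>KH\<^esub> delta (inv\<^bsub>H\<^esub> g))) \<otimes>\<^bsub>KH\<^esub> delta g) = f"
    using delta_expansion[OF f] by simp
qed (use assms finite_H in \<open>simp_all add: K.field_axioms K.cring_axioms cring_KH scalar_ring_hom\<close>)

lemma one_neq_zero_KH: "\<one>\<^bsub>KH\<^esub> \<noteq> \<zero>\<^bsub>KH\<^esub>"
proof
  assume "\<one>\<^bsub>KH\<^esub> = \<zero>\<^bsub>KH\<^esub>"
  from fun_cong[OF this, of "\<one>\<^bsub>H\<^esub>"] show False using K.one_not_zero by (simp add: one_KH scalar_def)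
qed

end

section \<open>The group algebra of a cyclic group of order p\<close>

lemma (in cring) add_pow_one_mult: "x \<in> carrier R \<Longrightarrow> add_pow R (k :: nat) \<one> \<otimes> x = add_pow R k x"
  by (induction k) (simp_all add: l_distr add.nat_pow_Suc)

lemma (in cring) freshmans_dream:
  assumes p: "prime p" and char: "add_pow R p \<one> = \<zero>" and x: "x \<in> carrier R" and y: "y \<in> carrier R"
  shows "(x \<oplus> y) [^] (p :: nat) = x [^] p \<oplus> y [^] p"
proof -
  have pow: "((\<lambda>v. c \<otimes> v) ^^ n) \<one> = c [^] n" if "c \<in> carrier R" for c and n :: nat
    using that by (induction n) (simp_all add: m_comm)
  interpret E: commuting_endomorphisms R "\<lambda>v. x \<otimes> v" "\<lambda>v. y \<otimes> v"
    by unfold_locales (use x y in \<open>simp_all add: r_distr m_lcomm\<close>)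
  have "add_pow R p v = \<zero>" if "v \<in> carrier R" for v
    using add_pow_one_mult[OF that, of p] char that by simp
  from E.freshmans_dream[OF p this one_closed]
  have "((\<lambda>v. x \<otimes> v \<oplus> y \<otimes> v) ^^ p) \<one> = x [^] p \<oplus> y [^] p"
    using pow x y by simp
  moreover have "((\<lambda>v. x \<otimes> v \<oplus> y \<otimes> v) ^^ n) \<one> = ((\<lambda>v. (x \<oplus> y) \<otimes> v) ^^ n) \<one>
      \<and> ((\<lambda>v. (x \<oplus> y) \<otimes> v) ^^ n) \<one> \<in> carrier R" for n
    by (induction n) (use x y in \<open>simp_all add: l_distr\<close>)
  ultimately show ?thesis using pow[of "x \<oplus> y" p] x y by simp
qed

lemma (in field) prime_characteristic:
  assumes "ring_characteristic R = p" "p > 0"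
  shows "prime p" "add_pow R p \<one> = \<zero>"
proof -
  have p: "p = group.ord (add_monoid R) \<one>" using assms(1) by (simp add: ring_characteristic_def)
  have dvd: "add_pow R n \<one> = \<zero> \<longleftrightarrow> p dvd n" for n :: nat
    using group.pow_eq_id[OF a_group, of \<one> n] by (simp add: p add_pow_def)
  then show "add_pow R p \<one> = \<zero>" by simp
  have "p \<noteq> 1" using dvd[of 1] one_not_zero by auto
  moreover have "m = 1 \<or> m = p" if "m dvd p" for m
  proof -
    obtain k where k: "p = m * k" using \<open>m dvd p\<close> by (auto simp: dvd_def)
    have "add_pow R m \<one> \<otimes> add_pow R k \<one> = \<zero>"
      using add_pow_one_mult[of "add_pow R k \<one>" m] dvd[of p] k
      by (simp add: add.nat_pow_pow mult.commute)
    then have "p dvd m \<or> p dvd k" using dvd by (simp add: integral_iff)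
    then show ?thesis
    proof
      assume "p dvd m" then show ?thesis using \<open>m dvd p\<close> by (simp add: dvd_antisym)
    next
      assume "p dvd k"
      then have "m * k dvd k" using k by simp
      then show ?thesis using assms(2) k by (metis dvd_antisym dvd_triv_right mult_cancel2 nat_mult_1 gr_implies_not0 mult_0_right)
    qed
  qed
  ultimately show "prime p" using assms(2) by (auto simp: prime_nat_iff)
qed

locale cyclic_group_algebra = finite_group_algebra K "integer_mod_group p"
  for K :: "('k, 'x) ring_scheme" and p :: nat +
  assumes prime_p: "prime p" and char_p: "add_pow K p \<one>\<^bsub>K\<^esub> = \<zero>\<^bsub>K\<^esub>"
begin

abbreviation Cp where "Cp \<equiv> integer_mod_group p"

definition t where "t = delta 1 \<ominus>\<^bsub>KH\<^esub> \<one>\<^bsub>KH\<^esub>"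

lemma t_closed [simp]: "t \<in> carrier KH"
  by (simp add: t_def)

lemma p_gt_1: "p > 1"
  using prime_p by (rule prime_gt_1_nat)

lemma carrier_Cp: "carrier Cp = {0..<int p}"
  using p_gt_1 by (simp add: carrier_integer_mod_group)

lemma delta_1: "delta 1 = \<one>\<^bsub>KH\<^esub> \<oplus>\<^bsub>KH\<^esub> t"
proof -
  have "delta 1 \<in> carrier KH" by simp
  then show ?thesis unfolding t_def using KH.one_closed by algebra
qed

lemma char_KH: "add_pow KH p \<one>\<^bsub>KH\<^esub> = \<zero>\<^bsub>KH\<^esub>"
proof -
  have "scalar (add_pow K k \<one>\<^bsub>K\<^esub>) = add_pow KH k \<one>\<^bsub>KH\<^esub>" for k :: nat
    by (induction k)
      (simp_all add: ring_hom_zero[OF scalar_ring_hom K.ring_axioms KH.ring_axioms]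
        ring_hom_add[OF scalar_ring_hom] ring_hom_one[OF scalar_ring_hom] K.add.nat_pow_Suc KH.add.nat_pow_Suc)
  from this[of p] show ?thesis
    using char_p ring_hom_zero[OF scalar_ring_hom K.ring_axioms KH.ring_axioms] by simp
qed

lemma delta_pow: "delta 1 [^]\<^bsub>KH\<^esub> k = delta (int k mod int p)"
proof (induction k)
  case 0
  then show ?case using delta_one by simp
next
  case (Suc k)
  have "int k mod int p \<in> carrier Cp" "(1 :: int) \<in> carrier Cp" using p_gt_1 by (auto simp: carrier_Cp)
  with Suc show ?case by (simp add: delta_mult mod_simps add.commute)
qed

text \<open>
  \<open>1 = \<sigma>\<^sup>p = (1 + t)\<^sup>p = 1 + t\<^sup>p\<close>.
\<close>

lemma t_nilpotent: "t [^]\<^bsub>KH\<^esub> p = \<zero>\<^bsub>KH\<^esub>"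
proof -
  have "\<one>\<^bsub>KH\<^esub> \<oplus>\<^bsub>KH\<^esub> t [^]\<^bsub>KH\<^esub> p = delta 1 [^]\<^bsub>KH\<^esub> p"
    unfolding delta_1 using KH.freshmans_dream[OF prime_p char_KH, of "\<one>\<^bsub>KH\<^esub>" t] by simp
  also have "\<dots> = \<one>\<^bsub>KH\<^esub>" unfolding delta_pow using delta_one by simp
  finally have "\<one>\<^bsub>KH\<^esub> \<oplus>\<^bsub>KH\<^esub> t [^]\<^bsub>KH\<^esub> p = \<one>\<^bsub>KH\<^esub>" .
  then show ?thesis
    using KH.r_neg1[of "\<one>\<^bsub>KH\<^esub>" "t [^]\<^bsub>KH\<^esub> p"] by (simp add: KH.l_neg)
qed

text \<open>
  \<open>\<sigma>\<^sup>k - 1\<close> is a multiple of \<open>\<sigma> - 1\<close>.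
\<close>

lemma delta_unipotent:
  assumes "g \<in> carrier Cp"
  shows "\<exists>d \<in> carrier KH. delta g = \<one>\<^bsub>KH\<^esub> \<oplus>\<^bsub>KH\<^esub> t \<otimes>\<^bsub>KH\<^esub> d"
proof -
  have "\<exists>d \<in> carrier KH. delta 1 [^]\<^bsub>KH\<^esub> k = \<one>\<^bsub>KH\<^esub> \<oplus>\<^bsub>KH\<^esub> t \<otimes>\<^bsub>KH\<^esub> d" for k :: nat
  proof (induction k)
    case 0
    show ?case by (intro bexI[of _ "\<zero>\<^bsub>KH\<^esub>"]) simp_all
  next
    case (Suc k)
    then obtain d where d: "d \<in> carrier KH" "delta 1 [^]\<^bsub>KH\<^esub> k = \<one>\<^bsub>KH\<^esub> \<oplus>\<^bsub>KH\<^esub> t \<otimes>\<^bsub>KH\<^esub> d" by blast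
    have "delta 1 [^]\<^bsub>KH\<^esub> Suc k = (\<one>\<^bsub>KH\<^esub> \<oplus>\<^bsub>KH\<^esub> t \<otimes>\<^bsub>KH\<^esub> d) \<otimes>\<^bsub>KH\<^esub> (\<one>\<^bsub>KH\<^esub> \<oplus>\<^bsub>KH\<^esub> t)"
      using d(2) delta_1 by simp
    also have "\<dots> = \<one>\<^bsub>KH\<^esub> \<oplus>\<^bsub>KH\<^esub> t \<otimes>\<^bsub>KH\<^esub> (\<one>\<^bsub>KH\<^esub> \<oplus>\<^bsub>KH\<^esub> d \<oplus>\<^bsub>KH\<^esub> t \<otimes>\<^bsub>KH\<^esub> d)"
      using d(1) t_closed KH.one_closed by algebra
    finally show ?case
      by (rule bexI[of _ "\<one>\<^bsub>KH\<^esub> \<oplus>\<^bsub>KH\<^esub> d \<oplus>\<^bsub>KH\<^esub> t \<otimes>\<^bsub>KH\<^esub> d"]) (use d(1) in simp)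
  qed
  from this[of "nat g"] show ?thesis
    using assms by (simp add: delta_pow carrier_Cp)
qed

lemma sum_delta_shift: "delta 1 \<otimes>\<^bsub>KH\<^esub> (\<Oplus>\<^bsub>KH\<^esub> g \<in> carrier Cp. delta g) = (\<Oplus>\<^bsub>KH\<^esub> g \<in> carrier Cp. delta g)"
proof -
  have 1: "(1 :: int) \<in> carrier Cp" using p_gt_1 by (simp add: carrier_Cp)
  have "delta 1 \<otimes>\<^bsub>KH\<^esub> (\<Oplus>\<^bsub>KH\<^esub> g \<in> carrier Cp. delta g) = (\<Oplus>\<^bsub>KH\<^esub> g \<in> carrier Cp. delta 1 \<otimes>\<^bsub>KH\<^esub> delta g)"
    by (rule KH.finsum_rdistr[OF finite_H]) auto
  also have "\<dots> = (\<Oplus>\<^bsub>KH\<^esub> g \<in> carrier Cp. delta (1 \<otimes>\<^bsub>Cp\<^esub> g))"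
    by (rule KH.finsum_cong') (use 1 in \<open>auto simp: delta_mult simp del: mult_integer_mod_group\<close>)
  also have "\<dots> = (\<Oplus>\<^bsub>KH\<^esub> g \<in> carrier Cp. delta g)"
    using KH.add.finprod_reindex[of delta "\<lambda>g. 1 \<otimes>\<^bsub>Cp\<^esub> g" "carrier Cp"]
      H.surj_const_mult[OF 1] H.inj_on_cmult[OF 1] by simp
  finally show ?thesis .
qed

lemma t_sum_delta: "t \<otimes>\<^bsub>KH\<^esub> (\<Oplus>\<^bsub>KH\<^esub> g \<in> carrier Cp. delta g) = \<zero>\<^bsub>KH\<^esub>"
proof -
  let ?s = "\<Oplus>\<^bsub>KH\<^esub> g \<in> carrier Cp. delta g"
  have s: "?s \<in> carrier KH" by (rule KH.finsum_closed) auto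
  have d: "delta 1 \<in> carrier KH" by simp
  have "t \<otimes>\<^bsub>KH\<^esub> ?s = delta 1 \<otimes>\<^bsub>KH\<^esub> ?s \<ominus>\<^bsub>KH\<^esub> ?s"
    unfolding t_def using s d KH.one_closed by algebra
  also have "\<dots> = \<zero>\<^bsub>KH\<^esub>" unfolding sum_delta_shift using s by algebra
  finally show ?thesis .
qed

text \<open>
  The algebra is local: an element \<open>f\<close> with augmentation \<open>c\<close> has the form \<open>c + t y\<close>, hence
  \<open>f\<^sup>p = c\<^sup>p\<close>, and this is a unit unless \<open>c = 0\<close>.
\<close>

lemma unit_or_t_multiple:
  assumes f: "f \<in> carrier KH"
  shows "f \<in> Units KH \<or> (\<exists>d \<in> carrier KH. f = t \<otimes>\<^bsub>KH\<^esub> d)"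
proof -
  have "\<forall>g. \<exists>d. g \<in> carrier Cp \<longrightarrow> d \<in> carrier KH \<and> delta g = \<one>\<^bsub>KH\<^esub> \<oplus>\<^bsub>KH\<^esub> t \<otimes>\<^bsub>KH\<^esub> d"
    using delta_unipotent by blast
  then obtain d where d: "\<And>g. g \<in> carrier Cp \<Longrightarrow> d g \<in> carrier KH"
    "\<And>g. g \<in> carrier Cp \<Longrightarrow> delta g = \<one>\<^bsub>KH\<^esub> \<oplus>\<^bsub>KH\<^esub> t \<otimes>\<^bsub>KH\<^esub> d g" by metis
  define y where "y = (\<Oplus>\<^bsub>KH\<^esub> g \<in> carrier Cp. scalar (f g) \<otimes>\<^bsub>KH\<^esub> d g)"
  define c where "c = (\<Oplus>\<^bsub>K\<^esub> g \<in> carrier Cp. f g)"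
  have y: "y \<in> carrier KH" unfolding y_def by (rule KH.finsum_closed) (use f d in auto)
  have c: "c \<in> carrier K" unfolding c_def by (rule K.finsum_closed) (use f in auto)
  have "f = (\<Oplus>\<^bsub>KH\<^esub> g \<in> carrier Cp. scalar (f g) \<otimes>\<^bsub>KH\<^esub> delta g)"
    using delta_expansion[OF f] by simp
  also have "\<dots> = (\<Oplus>\<^bsub>KH\<^esub> g \<in> carrier Cp. scalar (f g) \<oplus>\<^bsub>KH\<^esub> t \<otimes>\<^bsub>KH\<^esub> (scalar (f g) \<otimes>\<^bsub>KH\<^esub> d g))"
  proof (rule KH.finsum_cong')
    fix g assume g: "g \<in> carrier Cp"
    then have "scalar (f g) \<in> carrier KH" "d g \<in> carrier KH" using f d by auto
    then show "scalar (f g) \<otimes>\<^bsub>KH\<^esub> delta g = scalar (f g) \<oplus>\<^bsub>KH\<^esub> t \<otimes>\<^bsub>KH\<^esub> (scalar (f g) \<otimes>\<^bsub>KH\<^esub> d g)"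
      unfolding d(2)[OF g] using t_closed KH.one_closed by algebra
  qed (use f d in auto)
  also have "\<dots> = (\<Oplus>\<^bsub>KH\<^esub> g \<in> carrier Cp. scalar (f g)) \<oplus>\<^bsub>KH\<^esub> (\<Oplus>\<^bsub>KH\<^esub> g \<in> carrier Cp. t \<otimes>\<^bsub>KH\<^esub> (scalar (f g) \<otimes>\<^bsub>KH\<^esub> d g))"
    by (rule KH.finsum_addf) (use f d in auto)
  also have "(\<Oplus>\<^bsub>KH\<^esub> g \<in> carrier Cp. scalar (f g)) = scalar c"
    unfolding c_def
    by (rule additive_finsum[OF K.abelian_group_axioms KH.abelian_group_axioms finite_H, symmetric])
      (use f in \<open>auto simp: ring_hom_add[OF scalar_ring_hom]\<close>)
  also have "(\<Oplus>\<^bsub>KH\<^esub> g \<in> carrier Cp. t \<otimes>\<^bsub>KH\<^esub> (scalar (f g) \<otimes>\<^bsub>KH\<^esub> d g)) = t \<otimes>\<^bsub>KH\<^esub> y"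
    unfolding y_def by (rule KH.finsum_rdistr[OF finite_H, symmetric]) (use f d in auto)
  finally have f_eq: "f = scalar c \<oplus>\<^bsub>KH\<^esub> t \<otimes>\<^bsub>KH\<^esub> y" .
  show ?thesis
  proof (cases "c = \<zero>\<^bsub>K\<^esub>")
    case True
    then have "f = t \<otimes>\<^bsub>KH\<^esub> y"
      using f_eq y ring_hom_zero[OF scalar_ring_hom K.ring_axioms KH.ring_axioms] by simp
    then show ?thesis using y by blast
  next
    case False
    have cU: "c \<in> Units K" using False c by (simp add: K.field_Units)
    have "f [^]\<^bsub>KH\<^esub> p = scalar c [^]\<^bsub>KH\<^esub> p \<oplus>\<^bsub>KH\<^esub> (t \<otimes>\<^bsub>KH\<^esub> y) [^]\<^bsub>KH\<^esub> p"
      unfolding f_eq by (rule KH.freshmans_dream[OF prime_p char_KH]) (use c y in auto)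
    also have "(t \<otimes>\<^bsub>KH\<^esub> y) [^]\<^bsub>KH\<^esub> p = \<zero>\<^bsub>KH\<^esub>"
      using y by (simp add: KH.nat_pow_distrib t_nilpotent)
    finally have fp: "f [^]\<^bsub>KH\<^esub> p = scalar c [^]\<^bsub>KH\<^esub> p" using c by simp
    have "scalar c \<in> Units KH"
    proof -
      have "scalar (inv\<^bsub>K\<^esub> c) \<otimes>\<^bsub>KH\<^esub> scalar c = \<one>\<^bsub>KH\<^esub>"
        using ring_hom_mult[OF scalar_ring_hom, of "inv\<^bsub>K\<^esub> c" c] cU c by (simp add: one_KH)
      moreover have "scalar (inv\<^bsub>K\<^esub> c) \<in> carrier KH" using cU by simp
      ultimately show ?thesis
        using c KH.m_comm[of "scalar c" "scalar (inv\<^bsub>K\<^esub> c)"] unfolding Units_def by auto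
    qed
    then have u: "f [^]\<^bsub>KH\<^esub> p \<in> Units KH" unfolding fp by (rule KH.Units_pow_closed)
    define v where "v = f [^]\<^bsub>KH\<^esub> (p - 1) \<otimes>\<^bsub>KH\<^esub> inv\<^bsub>KH\<^esub> (f [^]\<^bsub>KH\<^esub> p)"
    have v: "v \<in> carrier KH" using u f by (simp add: v_def)
    have "p = Suc (p - 1)" using p_gt_1 by simp
    then have "f [^]\<^bsub>KH\<^esub> p = f \<otimes>\<^bsub>KH\<^esub> f [^]\<^bsub>KH\<^esub> (p - 1)"
      using KH.nat_pow_Suc2[OF f, of "p - 1"] by simp
    then have "f \<otimes>\<^bsub>KH\<^esub> v = \<one>\<^bsub>KH\<^esub>"
      using u f KH.Units_r_inv[OF u] by (simp add: v_def flip: KH.m_assoc)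
    then have "f \<in> Units KH" using v f KH.m_comm[OF f v] unfolding Units_def by auto
    then show ?thesis ..
  qed
qed

lemma local_frobenius_algebra_KH:
  assumes "\<And>g. g \<in> extensional (carrier KH) \<Longrightarrow> dec (enc g) = g"
  shows "local_frobenius_algebra K KH scalar enc dec coeff_one (carrier Cp) delta (\<lambda>g. delta (inv\<^bsub>Cp\<^esub> g)) t p p"
proof (intro local_frobenius_algebra.intro local_frobenius_algebra_axioms.intro)
  show "frobenius_algebra K KH scalar enc dec coeff_one (carrier Cp) delta (\<lambda>g. delta (inv\<^bsub>Cp\<^esub> g))"
    by (rule frobenius_algebra_KH[OF assms])
  show "(\<Oplus>\<^bsub>KH\<^esub> g \<in> carrier Cp. delta g) = (\<Oplus>\<^bsub>KH\<^esub> g \<in> carrier Cp. delta (inv\<^bsub>Cp\<^esub> g))"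
    by (rule sum_inverse[symmetric]) auto
  fix g assume g: "g \<in> carrier Cp"
  then show "\<exists>d \<in> carrier KH. delta g = \<one>\<^bsub>KH\<^esub> \<oplus>\<^bsub>KH\<^esub> t \<otimes>\<^bsub>KH\<^esub> d" by (rule delta_unipotent)
  show "\<exists>d \<in> carrier KH. delta (inv\<^bsub>Cp\<^esub> g) = \<one>\<^bsub>KH\<^esub> \<oplus>\<^bsub>KH\<^esub> t \<otimes>\<^bsub>KH\<^esub> d"
    by (rule delta_unipotent) (use g in \<open>simp del: inv_integer_mod_group\<close>)
qed (simp_all add: t_nilpotent t_sum_delta prime_p char_KH)

end

section \<open>Cyclic shifted subgroups\<close>

lemma elementary_abelian_finite_comm_group:
  assumes "elementary_abelian p G" "p > 0"
  shows "comm_group G" "finite (carrier G)"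
proof -
  obtain r :: nat where G: "group G" and iso: "G \<cong> product_group {..<r} (\<lambda>_. integer_mod_group p)"
    using assms(1) by (auto simp: elementary_abelian_def)
  let ?P = "product_group {..<r} (\<lambda>_. integer_mod_group p)"
  have "finite (carrier ?P)"
    using assms(2) by (auto simp: carrier_integer_mod_group intro!: finite_PiE)
  then show "finite (carrier G)" using iso_finite[OF iso] by simp
  have "group ?P" by simp
  then have "comm_group ?P"
    by (rule group.group_comm_groupI) (simp add: add.commute)
  moreover have "?P \<cong> G" using iso G by (simp add: group.iso_sym)
  ultimately show "comm_group G"
    using comm_group.iso_imp_comm_group G group.is_monoid by blast
qed

theorem theorem4p8:
  fixes K :: "('k, 'x) ring_scheme" and p :: nat and G :: "('g, 'y) monoid_scheme"
    and l :: "(int \<Rightarrow> 'k) \<Rightarrow> ('g \<Rightarrow> 'k)"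
    and kC :: "(int \<Rightarrow> 'k) ring" and kG :: "('g \<Rightarrow> 'k) ring"
    and StabC :: "((int \<Rightarrow> 'k, ('g \<Rightarrow> 'k, 'v) univ) module,
                   (('g \<Rightarrow> 'k, 'v) univ \<Rightarrow> ('g \<Rightarrow> 'k, 'v) univ) set) cat"
    and StabG :: "(('g \<Rightarrow> 'k, ('g \<Rightarrow> 'k, 'v) univ) module,
                   (('g \<Rightarrow> 'k, 'v) univ \<Rightarrow> ('g \<Rightarrow> 'k, 'v) univ) set) cat"
  assumes "field K" and "ring_characteristic K = p" and "p > 0"
    and "elementary_abelian p G"
    and "cyclic_shifted_subgroup K p G l"
    and "kC = group_algebra K (integer_mod_group p)" and "kG = group_algebra K G"
    and "StabC = Stab kC" and "StabG = Stab kG"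
    and "\<Phi> = Res_CoInd kC kG l"
    and "A = induced_monad \<Phi>"
  shows "adjunction StabG StabC \<Phi> \<and>
    equivalence_of_categories StabC (EM_category StabG A) (EM_functor \<Phi>) \<and>
    cfun_eq StabG (comp_cfun (EM_functor \<Phi>) (Res kC l)) (extension_of_scalars A)"
proof -
  interpret K: field K by fact
  note p = K.prime_characteristic[OF assms(2,3)]
  interpret C: cyclic_group_algebra K p
    by (intro cyclic_group_algebra.intro finite_group_algebra.intro finite_group_algebra_axioms.intro
        cyclic_group_algebra_axioms.intro abelian_integer_mod_group p K.field_axioms)
      (use assms(3) in \<open>simp add: carrier_integer_mod_group\<close>)
  interpret G: finite_group_algebra K G
    by (intro finite_group_algebra.intro finite_group_algebra_axioms.intro K.field_axioms
        elementary_abelian_finite_comm_group[OF assms(4,3)])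
  have l: "l \<in> ring_hom C.KH G.KH"
    and free: "free_module C.KH (restrict_scalars l (regular_module G.KH))"
    using assms(5) by (simp_all add: cyclic_shifted_subgroup_def)
  interpret F: coinduction C.KH G.KH l "Fun :: (('g \<Rightarrow> 'k) \<Rightarrow> ('g \<Rightarrow> 'k, 'v) univ) \<Rightarrow> _" app
    by (intro coinduction.intro coinduction_axioms.intro C.cring_KH G.cring_KH l) simp
  obtain \<pi> where \<pi>: "\<pi> \<in> module_homs C.KH F.scalars (regular_module C.KH)" "\<pi> \<one>\<^bsub>G.KH\<^esub> = \<one>\<^bsub>C.KH\<^esub>"
    by (rule F.linear_retraction[OF free G.one_neq_zero_KH C.t_closed C.t_nilpotent C.unit_or_t_multiple])
      (assumption, rule that)
  have \<pi>_l: "\<pi> (l r) = r" if "r \<in> carrier C.KH" for r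
    using hom_smult[OF \<pi>(1) that, of "\<one>\<^bsub>G.KH\<^esub>"] that \<pi>(2) by simp
  \<comment> \<open>functions on \<open>kC\<close> become functions on \<open>kG\<close> by composition with \<open>\<pi>\<close>; restriction along \<open>l\<close> undoes this\<close>
  define encC where "encC u = Fun (\<lambda>s. u (\<pi> s))" for u :: "(int \<Rightarrow> 'k) \<Rightarrow> ('g \<Rightarrow> 'k, 'v) univ"
  define decC where "decC w = (\<lambda>r \<in> carrier C.KH. app w (l r))" for w :: "('g \<Rightarrow> 'k, 'v) univ"
  have decC_encC: "decC (encC u) = u" if "u \<in> extensional (carrier C.KH)" for u
    using that \<pi>_l by (auto simp: decC_def encC_def extensional_def)
  interpret local: local_frobenius_algebra K C.KH C.scalar encC decC C.coeff_one "carrier C.Cp" C.delta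
    "\<lambda>g. C.delta (inv\<^bsub>C.Cp\<^esub> g)" C.t p p
    by (rule C.local_frobenius_algebra_KH[OF decC_encC])
  interpret res_coind K C.KH G.KH C.scalar encC decC C.coeff_one "carrier C.Cp" C.delta
    "\<lambda>g. C.delta (inv\<^bsub>C.Cp\<^esub> g)" G.scalar G.coeff_one "carrier G" G.delta "\<lambda>g. G.delta (inv\<^bsub>G\<^esub> g)" l
    by (intro res_coind.intro res_coind_axioms.intro local.frobenius_algebra_axioms F.coinduction_axioms
        G.frobenius_algebra_KH free) simp
  have \<Phi>: "\<Phi> = Res_CoInd C.KH G.KH l" and Stabs: "StabG = Stab G.KH" "StabC = Stab C.KH"
    using assms(6-10) by simp_all
  have adj: "adjunction StabG StabC \<Phi>"
    using adjunction_Res_CoInd unfolding \<Phi> Stabs .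
  interpret sep: separable_adjunction StabG StabC \<Phi>
    "\<lambda>N. stable_class C.KH N (res (F.coind N)) (section_rep \<pi> N)"
  proof
    show "adjunction StabG StabC \<Phi>" by (rule adj)
    show "natural_transformation StabC StabC id_cfun (comp_cfun (Lft \<Phi>) (Rgt \<Phi>))
        (\<lambda>N. stable_class C.KH N (res (F.coind N)) (section_rep \<pi> N))"
      using section_natural[OF \<pi>] unfolding \<Phi> Stabs .
    fix Z assume Z: "Z \<in> Ob StabC"
    then have ZM: "module C.KH Z" by (simp add: Stabs)
    show "Cmp StabC Z (FOb (Lft \<Phi>) (FOb (Rgt \<Phi>) Z)) Z (cnt \<Phi> Z)
        (stable_class C.KH Z (res (F.coind Z)) (section_rep \<pi> Z)) = Idn StabC Z"
      using ZM counit_section[OF \<pi> ZM] section_rep_hom[OF \<pi> ZM]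
      by (simp add: \<Phi> Stabs stable_simps)
    fix e assume "e \<in> Hom StabC Z Z" "Cmp StabC Z Z Z e e = e"
    with Z show "\<exists>N \<in> Ob StabC. \<exists>r \<in> Hom StabC Z N. \<exists>i \<in> Hom StabC N Z.
        Cmp StabC Z N Z i r = e \<and> Cmp StabC N Z N r i = Idn StabC N"
      unfolding Stabs by (rule local.Stab_idempotents_split)
  qed
  have "cfun_eq StabG (comp_cfun (EM_functor \<Phi>) (Res kC l)) (extension_of_scalars A)"
    unfolding assms(10,11)
    by (simp add: cfun_eq_def comp_cfun_def extension_of_scalars_def EM_functor_def induced_monad_def
        Res_CoInd_def Let_def)
  then show ?thesis using adj sep.EM_functor_equivalence unfolding assms(11) by blast
qed

end
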